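(* Let $(J^s)_{s\in(1/2,1)}$ satisfy Hypotheses (H1) and (H2) below with constant $\delta>0$ and limit kernel $J^1$. Let $0\le k<m<1$, $\theta=\frac{m-k}{m+d/2}$, and let $u_0,\bar u_0\in L^1_k$ be probability densities. Let $u^s_\varepsilon$ be the solution of $\partial_tu=\varepsilon^{-2s}(J^s_\varepsilon*u-u)+\mathrm{div}(xu)$ with $u(0)=u_0$ and $u_\varepsilon$ the solution of $\partial_tu=\varepsilon^{-2}(J^1_\varepsilon*u-u)+\mathrm{div}(xu)$ with $u(0)=\bar u_0$. Then for all $\varepsilon\in\Big(0,\sqrt{\tfrac{2}{4+2\delta+d}}\Big)$ there exists $T^*>0$ such that for all $t\ge T^*$ $$\|u^s_\varepsilon(t)-u_\varepsilon(t)\|_{L^1_k}\le C(1-s)^\theta\big(1+\varepsilon^{\theta\delta}|\log\varepsilon|\big),$$ with a constant $C$ independent of $s$.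
   Context: $\langle x\rangle=(1+|x|^2)^{1/2}$; $\|f\|_{L^1_k}=\int\langle x\rangle^k|f|$; $\hat f(\xi)=\int e^{-ix\cdot\xi}f$; $J_\varepsilon(x)=\varepsilon^{-d}J(x/\varepsilon)$; solutions are mild solutions in $C([0,\infty);L^1_k)$. Hypothesis (H1): $(J^s)_{s\in(1/2,1)}$ is a family of probability densities on $\mathbb{R}^d$ with $J^s\in L^1\cap L^p$ for some $p\in(1,\infty]$, such that (i) $\int\min\{1,|y|^2\}J^s<\infty$; (ii) there exist $\delta,C_0>0$ independent of $s$ with $\hat J^s(\xi)=1-|\xi|^{2s}+R_s(\xi)$, $|R_s(\xi)|\le C_0|\xi|^{2s+\delta}$ for $|\xi|\le1$; (iii) there exist $C,R>0$, $\Psi$ with $\int(1+|x|^2)|\Psi|<\infty$, $\int x\Psi=0$, independent of $s$, with $J^s(x)\le C(1-s)|x|^{-d-2s}+\Psi(x)$ for $|x|\ge R$. Hypothesis (H2): $J^1$ is a probability density with $\hat J^1(\xi)=1-|\xi|^2+R_1(\xi)$, $|R_1(\xi)|\le C_0|\xi|^{2+\delta}$ for $|\xi|\le1$, and there is $\mathfrak C>0$ with $\left|\frac{1-\hat J^s(\xi)}{|\xi|^{2s}}-\frac{1-\hat J^1(\xi)}{|\xi|^2}\right|\le\mathfrak C(1-s)|\xi|^\delta\max(1,|\log|\xi||)$ for all $s\in(1/2,1)$, $\xi\in\mathbb{R}^d$. *)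

theory Defs
  imports "HOL-Analysis.Analysis"
begin

definition bracket :: "'a::euclidean_space \<Rightarrow> real" where
  "bracket x = sqrt (1 + (norm x)\<^sup>2)"

definition L1k_norm :: "real \<Rightarrow> ('a::euclidean_space \<Rightarrow> real) \<Rightarrow> real" where
  "L1k_norm k f = (\<integral>x. bracket x powr k * \<bar>f x\<bar> \<partial>lborel)"

definition in_L1k :: "real \<Rightarrow> ('a::euclidean_space \<Rightarrow> real) \<Rightarrow> bool" where
  "in_L1k k f \<longleftrightarrow> f \<in> borel_measurable lborel \<and>
     integrable lborel (\<lambda>x. bracket x powr k * \<bar>f x\<bar>)"

definition prob_density :: "('a::euclidean_space \<Rightarrow> real) \<Rightarrow> bool" where
  "prob_density f \<longleftrightarrow> f \<in> borel_measurable lborel \<and> (AE x in lborel. 0 \<le> f x) \<and>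
     integrable lborel f \<and> (\<integral>x. f x \<partial>lborel) = 1"

definition fourier :: "('a::euclidean_space \<Rightarrow> real) \<Rightarrow> 'a \<Rightarrow> complex" where
  "fourier f \<xi> = (\<integral>x. cis (- (x \<bullet> \<xi>)) * complex_of_real (f x) \<partial>lborel)"

definition rescale :: "('a::euclidean_space \<Rightarrow> real) \<Rightarrow> real \<Rightarrow> 'a \<Rightarrow> real" where
  "rescale J \<epsilon> x = \<epsilon> powr (- real DIM('a)) * J ((1 / \<epsilon>) *\<^sub>R x)"

definition conv :: "('a::euclidean_space \<Rightarrow> real) \<Rightarrow> ('a \<Rightarrow> real) \<Rightarrow> 'a \<Rightarrow> real" where
  "conv K v x = (\<integral>y. K (x - y) * v y \<partial>lborel)"

text \<open>Mild solution in C([0,oo); L^1_k) of  d_t u = a (K*u - u) + div(x u),  u(0) = u0.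
  The group generated by div(x u) is (S(t) f)(x) = e^(d t) f(e^t x); the Duhamel formula
  u(t) = S(t) u0 + int_0^t S(t-tau)[a (K*u(tau) - u(tau))] dtau is imposed a.e. in x.\<close>
definition mild_solution ::
  "real \<Rightarrow> ('a::euclidean_space \<Rightarrow> real) \<Rightarrow> real \<Rightarrow> ('a \<Rightarrow> real) \<Rightarrow> (real \<Rightarrow> 'a \<Rightarrow> real) \<Rightarrow> bool" where
  "mild_solution k K a u0 u \<longleftrightarrow>
     (\<lambda>p. u (fst p) (snd p)) \<in> borel_measurable (lborel \<Otimes>\<^sub>M lborel) \<and>
     (\<forall>t\<ge>0. in_L1k k (u t)) \<and>
     (\<forall>t0\<ge>0. ((\<lambda>t. L1k_norm k (\<lambda>x. u t x - u t0 x)) \<longlongrightarrow> 0) (at t0 within {0..})) \<and>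
     (\<forall>t\<ge>0. AE x in lborel.
        u t x = exp (real DIM('a) * t) * u0 (exp t *\<^sub>R x)
          + (\<integral>\<tau>\<in>{0..t}. exp (real DIM('a) * (t - \<tau>)) * a *
               (conv K (u \<tau>) (exp (t - \<tau>) *\<^sub>R x) - u \<tau> (exp (t - \<tau>) *\<^sub>R x)) \<partial>lborel))"

definition H1 :: "(real \<Rightarrow> 'a::euclidean_space \<Rightarrow> real) \<Rightarrow> real \<Rightarrow> bool" where
  "H1 J \<delta> \<longleftrightarrow> \<delta> > 0 \<and>
    (\<forall>s\<in>{1/2<..<1}. prob_density (J s) \<and>
       ((\<exists>p>1. integrable lborel (\<lambda>x. \<bar>J s x\<bar> powr p)) \<or>
        (\<exists>M. AE x in lborel. \<bar>J s x\<bar> \<le> M)) \<and>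
       integrable lborel (\<lambda>y. min 1 ((norm y)\<^sup>2) * J s y)) \<and>
    (\<exists>C0>0. \<forall>s\<in>{1/2<..<1}. \<forall>\<xi>::'a. norm \<xi> \<le> 1 \<longrightarrow>
       cmod (fourier (J s) \<xi> - (1 - complex_of_real (norm \<xi> powr (2 * s))))
         \<le> C0 * norm \<xi> powr (2 * s + \<delta>)) \<and>
    (\<exists>C R (\<Psi>::'a \<Rightarrow> real). C > 0 \<and> R > 0 \<and> \<Psi> \<in> borel_measurable lborel \<and>
       integrable lborel (\<lambda>x. (1 + (norm x)\<^sup>2) * \<bar>\<Psi> x\<bar>) \<and>
       (\<integral>x. \<Psi> x *\<^sub>R x \<partial>lborel) = 0 \<and>
       (\<forall>s\<in>{1/2<..<1}. \<forall>x. norm x \<ge> R \<longrightarrow>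
          J s x \<le> C * (1 - s) * norm x powr (- real DIM('a) - 2 * s) + \<Psi> x))"

definition H2 :: "(real \<Rightarrow> 'a::euclidean_space \<Rightarrow> real) \<Rightarrow> ('a \<Rightarrow> real) \<Rightarrow> real \<Rightarrow> bool" where
  "H2 J J1 \<delta> \<longleftrightarrow> prob_density J1 \<and>
    (\<exists>C0>0. \<forall>\<xi>::'a. norm \<xi> \<le> 1 \<longrightarrow>
       cmod (fourier J1 \<xi> - (1 - complex_of_real ((norm \<xi>)\<^sup>2))) \<le> C0 * norm \<xi> powr (2 + \<delta>)) \<and>
    (\<exists>CC>0. \<forall>s\<in>{1/2<..<1}. \<forall>\<xi>::'a. \<xi> \<noteq> 0 \<longrightarrow>
       cmod ((1 - fourier (J s) \<xi>) / complex_of_real (norm \<xi> powr (2 * s))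
             - (1 - fourier J1 \<xi>) / complex_of_real ((norm \<xi>)\<^sup>2))
         \<le> CC * (1 - s) * norm \<xi> powr \<delta> * max 1 \<bar>ln (norm \<xi>)\<bar>)"

end

theory Submission
  imports Defs "HOL-Probability.Probability"
begin

text \<open>
  On the Fourier side a mild solution is
  \<open>u(t)^(\<xi>) = u0^(e^(-t) \<xi>) exp (- \<integral>\<^sub>0\<^sup>t \<psi> (e^(-\<tau>) \<xi>) d\<tau>)\<close> with
  \<open>\<psi> \<eta> = \<epsilon>^(-2s) (1 - J^(\<epsilon> \<eta>))\<close>, so \<open>u(t)\<close> is the contracted initial datum convolved with a
  compound Poisson law. The expansion of \<open>J^\<close> at the origin bounds the moments of order less than 1
  of these laws uniformly in \<open>s\<close>, \<open>\<epsilon>\<close>, \<open>t\<close>. By interpolation between \<open>L\<^sup>2\<close> and the weighted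
  \<open>L\<^sup>1\<close> norm it remains to compare the laws in \<open>L\<^sup>2\<close>, by Plancherel. As \<open>t\<close> grows their
  characteristic functions tend to \<open>exp (- \<integral>\<^sub>0\<^sup>\<infinity> \<psi> (e^(-\<tau>) \<xi>) d\<tau>)\<close>, which decay like
  \<open>\<bar>\<xi>\<bar> powr (- p)\<close> for every \<open>p\<close> below \<open>2 + \<delta> + d/2\<close> once \<open>s\<close> is close to 1, because
  \<open>\<epsilon>^(-2) > 2 + \<delta> + d/2\<close>; their exponents differ by \<open>O (1 - s)\<close> times a power of \<open>\<xi>\<close> slightly
  above \<open>2 + \<delta>\<close>. The moments allow an exponent \<open>m'\<close> slightly larger than \<open>m\<close>, hence a better
  interpolation rate than required, and this room pays for the missing decay. For \<open>s\<close> bounded away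
  from 1 the moment bounds alone suffice.
\<close>


section \<open>Gaussian kernels and the Fourier transform\<close>

text \<open>At a finite time a compound Poisson law keeps an atom at the origin, so its
  characteristic function does not decay; only the equilibria can be compared in L^2. Their decay
  comes from the time integral of \<open>1 - cos (exp (- \<tau>) * z)\<close>, which grows like the
  logarithm of |z|: the jump rate \<epsilon>^(-2s) in front of it becomes a decay exponent. Hence
  the threshold on \<epsilon>, and hence the need that jumps do not charge thin slabs around
  hyperplanes, uniformly in s. Finite times are reached by a split at |\<xi>| = e^t: below it the
  laws decay as the equilibria do, above it they are exponentially small in t, which beats the
  growth of the L^2 norm of a datum contracted by the drift. This asks for data in L^2 with moments
  of order m', whereas the given ones are only in L^1_k, so they are first replaced by bounded data
  of bounded support at distance (1 - s)^\<gamma>. The weighted norms of these may be huge, but the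
  contraction carries all mass to the origin, where the weight is 1. The waiting time pays for this,
  not the constant.\<close>

lemma borel_measurable_cis [measurable]:
  "f \<in> borel_measurable M \<Longrightarrow> (\<lambda>x. cis (f x)) \<in> borel_measurable M"
  by (rule measurable_compose[of f M borel cis borel])
     (auto intro!: borel_measurable_continuous_onI continuous_intros simp: cis_conv_exp)

lemma cis_sum: "finite A \<Longrightarrow> cis (\<Sum>a\<in>A. f a) = (\<Prod>a\<in>A. cis (f a))"
  by (induction rule: finite_induct) (auto simp: cis_mult[symmetric])

definition gweight :: "real \<Rightarrow> 'a::euclidean_space \<Rightarrow> real" where
  "gweight \<sigma> \<xi> = exp (- (\<sigma>\<^sup>2 * (norm \<xi>)\<^sup>2 / 2))"

text \<open>The Fourier transform of \<open>gweight \<sigma>\<close> without a normalising factor.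
  Its total mass is therefore (2 pi)^d, which becomes the Plancherel constant.\<close>

definition gkernel :: "real \<Rightarrow> 'a::euclidean_space \<Rightarrow> real" where
  "gkernel \<sigma> x = (sqrt (2 * pi) / \<sigma>) ^ DIM('a) * exp (- ((norm x)\<^sup>2 / (2 * \<sigma>\<^sup>2)))"

lemma gweight_pos: "0 < gweight \<sigma> \<xi>" and gweight_le_1: "gweight \<sigma> \<xi> \<le> 1"
  by (auto simp: gweight_def)

lemma gkernel_nonneg: "0 < \<sigma> \<Longrightarrow> 0 \<le> gkernel \<sigma> x"
  by (auto simp: gkernel_def)

lemma gweight_measurable [measurable]: "gweight \<sigma> \<in> borel_measurable borel"
  unfolding gweight_def[abs_def] by measurable

lemma gkernel_measurable [measurable]: "gkernel \<sigma> \<in> borel_measurable borel"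
  unfolding gkernel_def[abs_def] by measurable

text \<open>Scaling the variable by \<sigma> turns the integral into the characteristic function of
  the standard normal law at \<open>- (y / \<sigma>)\<close>.\<close>

lemma fourier_gauss_1d:
  fixes y \<sigma> :: real
  assumes "\<sigma> > 0"
  shows "integrable lborel (\<lambda>x. cis (- (y * x)) * complex_of_real (exp (- (\<sigma>\<^sup>2 * x\<^sup>2 / 2))))" (is ?I)
    and "(\<integral>x. cis (- (y * x)) * complex_of_real (exp (- (\<sigma>\<^sup>2 * x\<^sup>2 / 2))) \<partial>lborel)
      = complex_of_real (sqrt (2 * pi) / \<sigma> * exp (- (y\<^sup>2 / (2 * \<sigma>\<^sup>2))))" (is "?L = ?R")
proof -
  define h where "h = (\<lambda>x. iexp (- (y / \<sigma>) * x) * complex_of_real (std_normal_density x))"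
  have "integrable lborel (\<lambda>x. complex_of_real (std_normal_density x))"
    by (intro integrable_of_real integrable_normal_density) simp
  then have hi: "integrable lborel h"
    unfolding h_def by (rule Bochner_Integration.integrable_bound) (auto simp: norm_mult)
  have "char std_normal_distribution (- (y / \<sigma>)) = integral\<^sup>L lborel h"
    unfolding char_def h_def
    by (subst integral_density) (auto simp: scaleR_conv_of_real mult_ac)
  then have h1: "integral\<^sup>L lborel h = complex_of_real (exp (- (y\<^sup>2 / (2 * \<sigma>\<^sup>2))))"
    unfolding char_std_normal_distribution by (simp add: power_divide field_simps)
  have eq: "cis (- (y * x)) * complex_of_real (exp (- (\<sigma>\<^sup>2 * x\<^sup>2 / 2)))
     = complex_of_real (sqrt (2 * pi)) * h (0 + \<sigma> * x)" for x
    using assms by (auto simp: h_def cis_conv_exp std_normal_density_def field_simps exp_minus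
         real_sqrt_mult)
  show ?I
    unfolding eq using hi assms by (intro integrable_mult_right lborel_integrable_real_affine) auto
  have "integral\<^sup>L lborel h = \<sigma> *\<^sub>R (\<integral>x. h (0 + \<sigma> * x) \<partial>lborel)"
    using assms by (subst lborel_integral_real_affine[of \<sigma> _ 0]) auto
  then show "?L = ?R"
    unfolding eq integral_mult_right_zero using assms h1 by (simp add: scaleR_conv_of_real field_simps)
qed

text \<open>Lebesgue measure is the image of a product measure over \<open>Basis\<close>, and in
  these coordinates both the Gaussian and the character factorise.\<close>

lemma fourier_gauss:
  fixes x :: "'a::euclidean_space"
  assumes "\<sigma> > 0"
  shows "integrable lborel (\<lambda>\<xi>. cis (- (x \<bullet> \<xi>)) * complex_of_real (gweight \<sigma> \<xi>))" (is ?I)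
    and "(\<integral>\<xi>. cis (- (x \<bullet> \<xi>)) * complex_of_real (gweight \<sigma> \<xi>) \<partial>lborel) = complex_of_real (gkernel \<sigma> x)"
      (is "?L = ?R")
proof -
  interpret P: product_sigma_finite "\<lambda>b::'a. lborel :: real measure" by standard
  let ?P = "\<Pi>\<^sub>M b\<in>(Basis::'a set). (lborel :: real measure)"
  let ?T = "\<lambda>f. \<Sum>b\<in>(Basis::'a set). f b *\<^sub>R b :: 'a"
  let ?g = "\<lambda>b t. cis (- ((x \<bullet> b) * t)) * complex_of_real (exp (- (\<sigma>\<^sup>2 * t\<^sup>2 / 2)))"
  let ?h = "\<lambda>\<xi>. cis (- (x \<bullet> \<xi>)) * complex_of_real (gweight \<sigma> \<xi>)"
  have T [measurable]: "?T \<in> measurable ?P borel" by measurable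
  have prod: "?h (?T f) = (\<Prod>b\<in>Basis. ?g b (f b))" for f
  proof -
    have n: "(norm (?T f))\<^sup>2 = (\<Sum>b\<in>Basis. (f b)\<^sup>2)"
      unfolding power2_norm_eq_inner
      by (subst euclidean_inner) (simp add: power2_eq_square)
    have i: "x \<bullet> ?T f = (\<Sum>b\<in>Basis. (x \<bullet> b) * f b)"
      by (simp add: inner_sum_right mult.commute)
    show ?thesis
      unfolding gweight_def n i
      by (simp add: sum_negf[symmetric] cis_sum sum_distrib_left sum_divide_distrib exp_sum prod.distrib)
  qed
  have "integrable ?P (\<lambda>f. \<Prod>b\<in>Basis. ?g b (f b))"
    by (intro P.product_integrable_prod fourier_gauss_1d assms) auto
  then show ?I
    by (subst lborel_eq, subst integrable_distr_eq[OF T]) (auto simp: prod)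
  have "?L = (\<integral>f. ?h (?T f) \<partial>?P)"
    by (subst lborel_eq, subst integral_distr[OF T]) auto
  also have "\<dots> = (\<Prod>b\<in>Basis. integral\<^sup>L lborel (?g b))"
    unfolding prod by (intro P.product_integral_prod fourier_gauss_1d assms) auto
  also have "\<dots> = complex_of_real (\<Prod>b\<in>(Basis::'a set). sqrt (2 * pi) / \<sigma> * exp (- ((x \<bullet> b)\<^sup>2 / (2 * \<sigma>\<^sup>2))))"
    by (subst fourier_gauss_1d[OF assms]) simp
  also have "(\<Prod>b\<in>(Basis::'a set). sqrt (2 * pi) / \<sigma> * exp (- ((x \<bullet> b)\<^sup>2 / (2 * \<sigma>\<^sup>2)))) = gkernel \<sigma> x"
  proof -
    have n: "(norm x)\<^sup>2 = (\<Sum>b\<in>Basis. (x \<bullet> b)\<^sup>2)"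
      unfolding power2_norm_eq_inner by (subst euclidean_inner) (simp add: power2_eq_square)
    have "exp (- ((norm x)\<^sup>2 / (2 * \<sigma>\<^sup>2))) = (\<Prod>b\<in>(Basis::'a set). exp (- ((x \<bullet> b)\<^sup>2 / (2 * \<sigma>\<^sup>2))))"
      unfolding n by (simp add: exp_sum sum_divide_distrib sum_negf[symmetric])
    then show ?thesis
      unfolding gkernel_def by (simp only: prod.distrib prod_constant)
  qed
  finally show "?L = ?R" .
qed

lemma gkernel_integral:
  assumes "\<sigma> > 0"
  shows "integrable lborel (gkernel \<sigma> :: 'a::euclidean_space \<Rightarrow> real)"
    and "integral\<^sup>L lborel (gkernel \<sigma> :: 'a \<Rightarrow> real) = (2 * pi) ^ DIM('a)"
proof -
  \<comment> \<open>The kernel is a multiple of \<open>gweight (1/\<sigma>)\<close>, so its mass is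
    a Fourier transform evaluated at 0.\<close>
  have e: "gkernel \<sigma> = (\<lambda>x::'a. (sqrt (2 * pi) / \<sigma>) ^ DIM('a) * Re (cis (- (0 \<bullet> x)) * complex_of_real (gweight (1/\<sigma>) x)))"
    by (rule ext) (simp add: gkernel_def gweight_def power_divide)
  have s: "1/\<sigma> > 0" using assms by simp
  note fg = fourier_gauss[OF s, of "0::'a"]
  have m: "(sqrt (2 * pi) / \<sigma>) ^ DIM('a) * gkernel (1/\<sigma>) (0::'a) = (2 * pi) ^ DIM('a)"
    using assms by (simp only: gkernel_def mult.assoc[symmetric] power_mult_distrib[symmetric]) simp
  show "integrable lborel (gkernel \<sigma> :: 'a \<Rightarrow> real)"
    unfolding e by (intro integrable_mult_right integrable_Re fg)
  show "integral\<^sup>L lborel (gkernel \<sigma> :: 'a \<Rightarrow> real) = (2 * pi) ^ DIM('a)"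
    unfolding e integral_mult_right_zero
    by (subst integral_Re[OF fg(1)], subst fg(2)) (simp add: m)
qed

lemma gkernel_scale:
  "\<sigma> > 0 \<Longrightarrow> gkernel \<sigma> (\<sigma> *\<^sub>R z) * \<sigma> ^ DIM('a) = gkernel 1 (z::'a::euclidean_space)"
  by (simp add: gkernel_def power_divide power_mult_distrib)

lemma nn_integral_affine:
  fixes t :: "'a::euclidean_space"
  assumes [measurable]: "f \<in> borel_measurable borel" and c: "c \<noteq> 0"
  shows "(\<integral>\<^sup>+x. f x \<partial>lborel) = ennreal (\<bar>c\<bar> ^ DIM('a)) * (\<integral>\<^sup>+x. f (t + c *\<^sub>R x) \<partial>lborel)"
  by (subst lborel_affine[OF c, of t])
     (simp add: nn_integral_density nn_integral_distr nn_integral_cmult ennreal_power)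

lemma integrable_affine:
  fixes t :: "'a::euclidean_space" and f :: "'a \<Rightarrow> 'b::{banach, second_countable_topology}"
  assumes f: "integrable lborel f" and c: "c \<noteq> 0"
  shows "integrable lborel (\<lambda>x. f (t + c *\<^sub>R x))"
proof -
  have [measurable]: "f \<in> borel_measurable borel" using f by auto
  have "ennreal (\<bar>c\<bar> ^ DIM('a)) * (\<integral>\<^sup>+x. norm (f (t + c *\<^sub>R x)) \<partial>lborel) < \<infinity>"
    using f by (subst nn_integral_affine[symmetric]) (auto simp: c integrable_iff_bounded)
  then show ?thesis
    using c by (auto simp: integrable_iff_bounded ennreal_mult_less_top)
qed

lemma integral_affine:
  fixes t :: "'a::euclidean_space" and f :: "'a \<Rightarrow> 'b::{banach, second_countable_topology}"
  assumes [measurable]: "f \<in> borel_measurable borel" and c: "c \<noteq> 0"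
  shows "(\<integral>x. f x \<partial>lborel) = (\<bar>c\<bar> ^ DIM('a)) *\<^sub>R (\<integral>x. f (t + c *\<^sub>R x) \<partial>lborel)"
  by (subst lborel_affine[OF c, of t])
     (simp add: integral_density integral_distr)

lemma borel_measurable_cnj [measurable]:
  "f \<in> borel_measurable M \<Longrightarrow> (\<lambda>x. cnj (f x)) \<in> borel_measurable M"
  by (rule measurable_compose[of f M borel cnj borel])
     (auto intro!: borel_measurable_continuous_onI continuous_intros)

lemma fourier_measurable [measurable]:
  assumes [measurable]: "f \<in> borel_measurable borel"
  shows "fourier f \<in> borel_measurable borel"
  unfolding fourier_def[abs_def] by measurable

lemma fourier_integrand_integrable:
  fixes f :: "'a::euclidean_space \<Rightarrow> real"
  assumes "integrable lborel f"
  shows "integrable lborel (\<lambda>x. cis (- (x \<bullet> \<xi>)) * complex_of_real (f x))"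
  using assms by (intro Bochner_Integration.integrable_bound[OF assms]) (auto simp: norm_mult)

lemma norm_fourier_le:
  assumes "integrable lborel f"
  shows "cmod (fourier f \<xi>) \<le> (\<integral>x. \<bar>f x\<bar> \<partial>lborel)"
  unfolding fourier_def
  by (rule order_trans[OF integral_norm_bound]) (simp add: norm_mult)

text \<open>The multiplication formula: by Fubini the transform moves from one factor of a pairing
  to the other.\<close>

lemma fourier_exchange:
  fixes f :: "'a::euclidean_space \<Rightarrow> real" and h :: "'a \<Rightarrow> complex"
  assumes f: "integrable lborel f" and h: "integrable lborel h"
  shows "(\<integral>x. complex_of_real (f x) * (\<integral>\<xi>. cis (- (x \<bullet> \<xi>)) * h \<xi> \<partial>lborel) \<partial>lborel)
    = (\<integral>\<xi>. h \<xi> * fourier f \<xi> \<partial>lborel)"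
proof -
  have [measurable]: "f \<in> borel_measurable borel" "h \<in> borel_measurable borel" using f h by auto
  let ?F = "\<lambda>x \<xi>. complex_of_real (f x) * (cis (- (x \<bullet> \<xi>)) * h \<xi>)"
  have int: "integrable (lborel \<Otimes>\<^sub>M lborel) (case_prod ?F)"
  proof (rule lborel_pair.Fubini_integrable)
    have "integrable lborel (\<lambda>x. \<bar>f x\<bar> * (\<integral>\<xi>. cmod (h \<xi>) \<partial>lborel))"
      using f by (intro integrable_mult_left) auto
    then show "integrable lborel (\<lambda>x. \<integral>y. norm (case (x, y) of (x, y) \<Rightarrow> ?F x y) \<partial>lborel)"
      by (simp add: norm_mult)
    have "integrable lborel (\<lambda>y. ?F x y)" for x
      using h by (intro integrable_mult_right Bochner_Integration.integrable_bound[OF h]) (auto simp: norm_mult)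
    then show "AE x in lborel. integrable lborel (\<lambda>y. case (x, y) of (x, y) \<Rightarrow> ?F x y)"
      by simp
  qed measurable
  have "(\<integral>x. complex_of_real (f x) * (\<integral>\<xi>. cis (- (x \<bullet> \<xi>)) * h \<xi> \<partial>lborel) \<partial>lborel)
    = (\<integral>x. (\<integral>\<xi>. ?F x \<xi> \<partial>lborel) \<partial>lborel)"
    by simp
  also have "\<dots> = (\<integral>\<xi>. (\<integral>x. ?F x \<xi> \<partial>lborel) \<partial>lborel)"
    by (rule lborel_pair.Fubini_integral[OF int, symmetric])
  also have "\<dots> = (\<integral>\<xi>. h \<xi> * fourier f \<xi> \<partial>lborel)"
  proof (intro Bochner_Integration.integral_cong refl)
    fix \<xi>
    have "(\<integral>x. ?F x \<xi> \<partial>lborel) = (\<integral>x. h \<xi> * (cis (- (x \<bullet> \<xi>)) * complex_of_real (f x)) \<partial>lborel)"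
      by (intro Bochner_Integration.integral_cong) (auto simp: mult_ac)
    then show "(\<integral>x. ?F x \<xi> \<partial>lborel) = h \<xi> * fourier f \<xi>"
      by (simp add: fourier_def)
  qed
  finally show ?thesis .
qed

section \<open>Plancherel bounds by Gaussian regularisation\<close>

lemma gweight_integrable:
  assumes "\<sigma> > 0" shows "integrable lborel (gweight \<sigma> :: 'a::euclidean_space \<Rightarrow> real)"
  using integrable_norm[OF fourier_gauss(1)[OF assms, of "0::'a"]]
  by (simp add: norm_mult abs_of_pos gweight_pos)

lemma fourier_gweight_integrable:
  fixes f :: "'a::euclidean_space \<Rightarrow> real"
  assumes f: "integrable lborel f" and s: "\<sigma> > 0" and [measurable]: "c \<in> borel_measurable borel"
    and c: "\<And>\<xi>. cmod (c \<xi>) \<le> B"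
  shows "integrable lborel (\<lambda>\<xi>. c \<xi> * complex_of_real (gweight \<sigma> \<xi>))"
  by (intro Bochner_Integration.integrable_bound[OF integrable_mult_right[OF gweight_integrable[OF s], of B]])
     (use c gweight_pos[of \<sigma>] in \<open>auto simp: norm_mult abs_mult less_imp_le intro!: mult_right_mono order_trans[OF c]\<close>)

text \<open>Parseval's identity with a convergence factor. The Gaussian weight makes the frequency
  integral absolutely convergent for merely integrable functions; in space it appears as a
  convolution with \<open>gkernel \<sigma>\<close>.\<close>

lemma fourier_pairing:
  fixes f g :: "'a::euclidean_space \<Rightarrow> real"
  assumes f: "integrable lborel f" and g: "integrable lborel g" and s: "\<sigma> > 0"
  shows "(\<integral>\<xi>. fourier f \<xi> * cnj (fourier g \<xi>) * complex_of_real (gweight \<sigma> \<xi>) \<partial>lborel)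
    = complex_of_real (\<integral>x. f x * (\<integral>y. g y * gkernel \<sigma> (x - y) \<partial>lborel) \<partial>lborel)"
proof -
  have [measurable]: "f \<in> borel_measurable borel" "g \<in> borel_measurable borel" using f g by auto
  have inner: "complex_of_real (\<integral>y. g y * gkernel \<sigma> (x - y) \<partial>lborel)
     = (\<integral>\<xi>. cis (- (x \<bullet> \<xi>)) * (cnj (fourier g \<xi>) * complex_of_real (gweight \<sigma> \<xi>)) \<partial>lborel)" for x
  proof -
    have G: "complex_of_real (gkernel \<sigma> (x - y)) =
       (\<integral>\<xi>. cis (- (y \<bullet> \<xi>)) * (cis (x \<bullet> \<xi>) * complex_of_real (gweight \<sigma> \<xi>)) \<partial>lborel)" for y
    proof -
      have "gkernel \<sigma> (x - y) = gkernel \<sigma> (y - x)" by (simp add: gkernel_def norm_minus_commute)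
      moreover have "cis (- ((y - x) \<bullet> \<xi>)) = cis (- (y \<bullet> \<xi>)) * cis (x \<bullet> \<xi>)" for \<xi>
        by (simp add: cis_mult inner_diff_left)
      ultimately show ?thesis
        using fourier_gauss(2)[OF s, of "y - x"] by (simp add: mult.assoc)
    qed
    have hi: "integrable lborel (\<lambda>\<xi>. cis (x \<bullet> \<xi>) * complex_of_real (gweight \<sigma> \<xi>))"
      by (rule fourier_gweight_integrable[OF f s, of _ 1]) auto
    have "complex_of_real (\<integral>y. g y * gkernel \<sigma> (x - y) \<partial>lborel)
      = (\<integral>y. complex_of_real (g y) * complex_of_real (gkernel \<sigma> (x - y)) \<partial>lborel)"
      by (simp flip: integral_complex_of_real)
    also have "\<dots> = (\<integral>\<xi>. cis (x \<bullet> \<xi>) * complex_of_real (gweight \<sigma> \<xi>) * fourier g \<xi> \<partial>lborel)"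
      unfolding G by (rule fourier_exchange[OF g hi])
    finally have "complex_of_real (\<integral>y. g y * gkernel \<sigma> (x - y) \<partial>lborel)
      = (\<integral>\<xi>. cis (x \<bullet> \<xi>) * complex_of_real (gweight \<sigma> \<xi>) * fourier g \<xi> \<partial>lborel)" .
    \<comment> \<open>The left side is real, so conjugation only affects the right side, where it
      puts the conjugate on \<open>fourier g\<close> and restores the sign of the character.\<close>
    then have "cnj (complex_of_real (\<integral>y. g y * gkernel \<sigma> (x - y) \<partial>lborel))
      = (\<integral>\<xi>. cnj (cis (x \<bullet> \<xi>) * complex_of_real (gweight \<sigma> \<xi>) * fourier g \<xi>) \<partial>lborel)"
      by (simp only: Bochner_Integration.integral_cnj)
    then show ?thesis
      by (simp only: cis_cnj complex_cnj_mult complex_cnj_complex_of_real mult_ac)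
  qed
  have hi: "integrable lborel (\<lambda>\<xi>. cnj (fourier g \<xi>) * complex_of_real (gweight \<sigma> \<xi>))"
    by (rule fourier_gweight_integrable[OF f s, where B="\<integral>x. \<bar>g x\<bar> \<partial>lborel"]) (auto intro: norm_fourier_le[OF g])
  have "complex_of_real (\<integral>x. f x * (\<integral>y. g y * gkernel \<sigma> (x - y) \<partial>lborel) \<partial>lborel)
    = (\<integral>x. complex_of_real (f x) * complex_of_real (\<integral>y. g y * gkernel \<sigma> (x - y) \<partial>lborel) \<partial>lborel)"
    by (simp flip: integral_complex_of_real)
  also have "\<dots> = (\<integral>\<xi>. cnj (fourier g \<xi>) * complex_of_real (gweight \<sigma> \<xi>) * fourier f \<xi> \<partial>lborel)"
    unfolding inner by (rule fourier_exchange[OF f hi])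
  finally show ?thesis by (simp add: mult_ac)
qed

lemma nn_integral_gkernel_shift:
  fixes x :: "'a::euclidean_space"
  assumes "\<sigma> > 0"
  shows "(\<integral>\<^sup>+y. ennreal (gkernel \<sigma> (x - y)) \<partial>lborel) = ennreal ((2 * pi) ^ DIM('a))"
proof -
  have "(\<integral>\<^sup>+y. ennreal (gkernel \<sigma> (y::'a)) \<partial>lborel) = (\<integral>\<^sup>+y. ennreal (gkernel \<sigma> (x + (-1) *\<^sub>R y)) \<partial>lborel)"
    by (subst nn_integral_affine[where c="-1" and t=x]) auto
  moreover have "(\<integral>\<^sup>+y. ennreal (gkernel \<sigma> (y::'a)) \<partial>lborel) = ennreal ((2 * pi) ^ DIM('a))"
    using gkernel_integral[OF assms, where 'a='a]
    by (subst nn_integral_eq_integral) (auto simp: gkernel_nonneg assms)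
  ultimately show ?thesis by simp
qed

lemma gkernel_minus_commute: "gkernel \<sigma> (x - y) = gkernel \<sigma> (y - x)"
  by (simp add: gkernel_def norm_minus_commute)

lemma ennreal_norm_integral_le:
  fixes f :: "'a \<Rightarrow> 'b::{banach, second_countable_topology}"
  shows "ennreal (norm (integral\<^sup>L M f)) \<le> (\<integral>\<^sup>+x. ennreal (norm (f x)) \<partial>M)"
  by (cases "integrable M f") (auto intro: integral_norm_bound_ennreal simp: not_integrable_integral_eq)

text \<open>Schur's test: |f(x) f(y)| is at most half of f(x)^2 + f(y)^2, and the kernel has mass (2
  pi)^d in either variable.\<close>

lemma gkernel_quadratic_form_le:
  fixes f :: "'a::euclidean_space \<Rightarrow> real"
  assumes f: "integrable lborel f" and f2: "integrable lborel (\<lambda>x. (f x)\<^sup>2)" and s: "\<sigma> > 0"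
  shows "\<bar>\<integral>x. f x * (\<integral>y. f y * gkernel \<sigma> (x - y) \<partial>lborel) \<partial>lborel\<bar> \<le> (2 * pi) ^ DIM('a) * (\<integral>x. (f x)\<^sup>2 \<partial>lborel)"
proof -
  have [measurable]: "f \<in> borel_measurable borel" using f by auto
  let ?c = "(2 * pi) ^ DIM('a)"
  let ?G = "\<lambda>x y. ennreal (gkernel \<sigma> (x - y))"
  have Q: "(\<integral>\<^sup>+x. \<integral>\<^sup>+y. ennreal ((f x)\<^sup>2) * ?G x y \<partial>lborel \<partial>lborel) = ennreal (?c * (\<integral>x. (f x)\<^sup>2 \<partial>lborel))"
    by (simp add: nn_integral_cmult nn_integral_multc nn_integral_gkernel_shift[OF s] nn_integral_eq_integral[OF f2]
        ennreal_mult' mult.commute)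
  have Q': "(\<integral>\<^sup>+x. \<integral>\<^sup>+y. ennreal ((f y)\<^sup>2) * ?G x y \<partial>lborel \<partial>lborel) = ennreal (?c * (\<integral>x. (f x)\<^sup>2 \<partial>lborel))"
    unfolding Q[symmetric]
    by (subst lborel_pair.Fubini') (auto simp: gkernel_minus_commute)
  have "ennreal \<bar>\<integral>x. f x * (\<integral>y. f y * gkernel \<sigma> (x - y) \<partial>lborel) \<partial>lborel\<bar>
     \<le> (\<integral>\<^sup>+x. ennreal \<bar>f x * (\<integral>y. f y * gkernel \<sigma> (x - y) \<partial>lborel)\<bar> \<partial>lborel)"
    using ennreal_norm_integral_le[of lborel "\<lambda>x. f x * (\<integral>y. f y * gkernel \<sigma> (x - y) \<partial>lborel)"] by simp
  also have "\<dots> \<le> (\<integral>\<^sup>+x. \<integral>\<^sup>+y. ennreal (1/2) * (ennreal ((f x)\<^sup>2) * ?G x y + ennreal ((f y)\<^sup>2) * ?G x y) \<partial>lborel \<partial>lborel)"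
  proof (rule nn_integral_mono)
    fix x
    have "ennreal \<bar>f x * (\<integral>y. f y * gkernel \<sigma> (x - y) \<partial>lborel)\<bar> = ennreal \<bar>\<integral>y. f x * (f y * gkernel \<sigma> (x - y)) \<partial>lborel\<bar>"
      by simp
    also have "\<dots> \<le> (\<integral>\<^sup>+y. ennreal \<bar>f x * (f y * gkernel \<sigma> (x - y))\<bar> \<partial>lborel)"
      using ennreal_norm_integral_le[of lborel "\<lambda>y. f x * (f y * gkernel \<sigma> (x - y))"] by simp
    also have "\<dots> \<le> (\<integral>\<^sup>+y. ennreal (1/2) * (ennreal ((f x)\<^sup>2) * ?G x y + ennreal ((f y)\<^sup>2) * ?G x y) \<partial>lborel)"
    proof (rule nn_integral_mono)
      fix y
      have g: "0 \<le> gkernel \<sigma> (x - y)" by (rule gkernel_nonneg[OF s])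
      have "2 * (\<bar>f x\<bar> * \<bar>f y\<bar>) \<le> (f x)\<^sup>2 + (f y)\<^sup>2"
        using sum_squares_bound[of "\<bar>f x\<bar>" "\<bar>f y\<bar>"] by simp
      then have "\<bar>f x\<bar> * \<bar>f y\<bar> * gkernel \<sigma> (x - y) \<le> 1/2 * ((f x)\<^sup>2 + (f y)\<^sup>2) * gkernel \<sigma> (x - y)"
        using g by (intro mult_right_mono) auto
      then have "\<bar>f x * (f y * gkernel \<sigma> (x - y))\<bar> \<le> 1/2 * ((f x)\<^sup>2 * gkernel \<sigma> (x - y) + (f y)\<^sup>2 * gkernel \<sigma> (x - y))"
        using g by (simp add: abs_mult algebra_simps)
      then have "ennreal \<bar>f x * (f y * gkernel \<sigma> (x - y))\<bar> \<le> ennreal (1/2 * ((f x)\<^sup>2 * gkernel \<sigma> (x - y) + (f y)\<^sup>2 * gkernel \<sigma> (x - y)))"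
        by (rule ennreal_leI)
      also have "\<dots> = ennreal (1/2) * (ennreal ((f x)\<^sup>2) * ?G x y + ennreal ((f y)\<^sup>2) * ?G x y)"
        using g by (simp only: ennreal_mult'[symmetric] ennreal_mult''[symmetric] ennreal_plus[symmetric]
            mult_nonneg_nonneg zero_le_power2)
      finally show "ennreal \<bar>f x * (f y * gkernel \<sigma> (x - y))\<bar> \<le> ennreal (1/2) * (ennreal ((f x)\<^sup>2) * ?G x y + ennreal ((f y)\<^sup>2) * ?G x y)" .
    qed
    finally show "ennreal \<bar>f x * (\<integral>y. f y * gkernel \<sigma> (x - y) \<partial>lborel)\<bar>
      \<le> (\<integral>\<^sup>+y. ennreal (1/2) * (ennreal ((f x)\<^sup>2) * ?G x y + ennreal ((f y)\<^sup>2) * ?G x y) \<partial>lborel)" .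
  qed
  also have "\<dots> = ennreal (1/2) * (ennreal (?c * (\<integral>x. (f x)\<^sup>2 \<partial>lborel)) + ennreal (?c * (\<integral>x. (f x)\<^sup>2 \<partial>lborel)))"
    by (subst (1) Q[symmetric], subst Q'[symmetric]) (simp add: nn_integral_cmult nn_integral_add)
  also have "\<dots> = ennreal (?c * (\<integral>x. (f x)\<^sup>2 \<partial>lborel))"
  proof -
    have "ennreal (1/2) * (ennreal X + ennreal X) = ennreal X" if "0 \<le> X" for X
    proof -
      have "ennreal X + ennreal X = ennreal (2 * X)" using that by (simp add: ennreal_plus[symmetric] del: ennreal_plus)
      then show ?thesis using that by (simp add: ennreal_mult'[symmetric] del: ennreal_half)
    qed
    then show ?thesis by simp
  qed
  finally show ?thesis
    by (subst (asm) ennreal_le_iff) auto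
qed

lemma nn_integral_fourier_gweight_le:
  fixes f :: "'a::euclidean_space \<Rightarrow> real"
  assumes f: "integrable lborel f" and f2: "integrable lborel (\<lambda>x. (f x)\<^sup>2)" and s: "\<sigma> > 0"
  shows "(\<integral>\<^sup>+\<xi>. ennreal ((cmod (fourier f \<xi>))\<^sup>2 * gweight \<sigma> \<xi>) \<partial>lborel) \<le> ennreal ((2 * pi) ^ DIM('a) * (\<integral>x. (f x)\<^sup>2 \<partial>lborel))"
proof -
  have [measurable]: "f \<in> borel_measurable borel" using f by auto
  have e: "complex_of_real ((cmod (fourier f \<xi>))\<^sup>2 * gweight \<sigma> \<xi>) = fourier f \<xi> * cnj (fourier f \<xi>) * complex_of_real (gweight \<sigma> \<xi>)" for \<xi>
    by (simp only: of_real_mult complex_norm_square)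
  have "integrable lborel (\<lambda>\<xi>. complex_of_real ((cmod (fourier f \<xi>))\<^sup>2) * complex_of_real (gweight \<sigma> \<xi>))"
    by (rule fourier_gweight_integrable[OF f s, where B="(\<integral>x. \<bar>f x\<bar> \<partial>lborel)\<^sup>2"])
       (auto simp: norm_power norm_mult intro!: power_mono norm_fourier_le[OF f])
  then have i: "integrable lborel (\<lambda>\<xi>. (cmod (fourier f \<xi>))\<^sup>2 * gweight \<sigma> \<xi>)"
    by (auto dest: integrable_Re simp flip: of_real_mult)
  have "complex_of_real (\<integral>\<xi>. (cmod (fourier f \<xi>))\<^sup>2 * gweight \<sigma> \<xi> \<partial>lborel)
    = complex_of_real (\<integral>x. f x * (\<integral>y. f y * gkernel \<sigma> (x - y) \<partial>lborel) \<partial>lborel)"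
    unfolding fourier_pairing[OF f f s, symmetric] e[symmetric] by (rule integral_complex_of_real[symmetric])
  then have "(\<integral>\<xi>. (cmod (fourier f \<xi>))\<^sup>2 * gweight \<sigma> \<xi> \<partial>lborel) \<le> (2 * pi) ^ DIM('a) * (\<integral>x. (f x)\<^sup>2 \<partial>lborel)"
    using gkernel_quadratic_form_le[OF f f2 s] by (simp only: of_real_eq_iff)
  then show ?thesis
    by (subst nn_integral_eq_integral[OF i]) (auto intro!: ennreal_leI simp: gweight_pos less_imp_le)
qed

lemma gweight_tendsto: "(\<lambda>n. gweight (1 / real (Suc n)) \<xi>) \<longlonglongrightarrow> 1"
proof -
  have "(\<lambda>n. exp (- ((1 / real (Suc n))\<^sup>2 * (norm \<xi>)\<^sup>2 / 2))) \<longlonglongrightarrow> exp (- (0\<^sup>2 * (norm \<xi>)\<^sup>2 / 2))"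
    by (intro tendsto_intros LIMSEQ_Suc[OF lim_1_over_n]) simp
  then show ?thesis by (simp add: gweight_def)
qed

text \<open>The upper half of Plancherel's identity, by Fatou's lemma as the Gaussian weight
  increases to 1.\<close>

theorem nn_integral_fourier_le:
  fixes f :: "'a::euclidean_space \<Rightarrow> real"
  assumes f: "integrable lborel f" and f2: "integrable lborel (\<lambda>x. (f x)\<^sup>2)"
  shows "(\<integral>\<^sup>+\<xi>. ennreal ((cmod (fourier f \<xi>))\<^sup>2) \<partial>lborel) \<le> ennreal ((2 * pi) ^ DIM('a) * (\<integral>x. (f x)\<^sup>2 \<partial>lborel))"
proof -
  have [measurable]: "f \<in> borel_measurable borel" using f by auto
  let ?h = "\<lambda>n \<xi>. ennreal ((cmod (fourier f \<xi>))\<^sup>2 * gweight (1 / real (Suc n)) \<xi>)"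
  have "liminf (\<lambda>n. ?h n \<xi>) = ennreal ((cmod (fourier f \<xi>))\<^sup>2)" for \<xi>
  proof (rule lim_imp_Liminf)
    have "(\<lambda>n. (cmod (fourier f \<xi>))\<^sup>2 * gweight (1 / real (Suc n)) \<xi>) \<longlonglongrightarrow> (cmod (fourier f \<xi>))\<^sup>2 * 1"
      by (intro tendsto_intros gweight_tendsto)
    then show "(\<lambda>n. ?h n \<xi>) \<longlonglongrightarrow> ennreal ((cmod (fourier f \<xi>))\<^sup>2)"
      by (intro tendsto_ennrealI) simp
  qed simp
  then have "(\<integral>\<^sup>+\<xi>. ennreal ((cmod (fourier f \<xi>))\<^sup>2) \<partial>lborel) = (\<integral>\<^sup>+\<xi>. liminf (\<lambda>n. ?h n \<xi>) \<partial>lborel)"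
    by simp
  also have "\<dots> \<le> liminf (\<lambda>n. \<integral>\<^sup>+\<xi>. ?h n \<xi> \<partial>lborel)"
    by (rule nn_integral_liminf) simp
  also have "\<dots> \<le> liminf (\<lambda>n::nat. ennreal ((2 * pi) ^ DIM('a) * (\<integral>x. (f x)\<^sup>2 \<partial>lborel)))"
    by (intro Liminf_mono always_eventually allI nn_integral_fourier_gweight_le f f2) simp
  finally show ?thesis by (simp add: Liminf_const)
qed

text \<open>After the substitution y = x - \<sigma> z the kernel no longer depends on \<sigma>.
  Dominated convergence then applies, and the limit carries the mass (2 pi)^d of the kernel.\<close>

lemma gkernel_mollify_tendsto:
  fixes \<phi> :: "'a::euclidean_space \<Rightarrow> real"
  assumes \<phi>: "continuous_on UNIV \<phi>" and B: "\<And>x. \<bar>\<phi> x\<bar> \<le> B"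
  shows "(\<lambda>n. \<integral>y. \<phi> y * gkernel (1 / real (Suc n)) (x - y) \<partial>lborel) \<longlonglongrightarrow> (2 * pi) ^ DIM('a) * \<phi> x"
    and "\<sigma> > 0 \<Longrightarrow> \<bar>\<integral>y. \<phi> y * gkernel \<sigma> (x - y) \<partial>lborel\<bar> \<le> (2 * pi) ^ DIM('a) * B"
proof -
  have [measurable]: "\<phi> \<in> borel_measurable borel"
    by (rule borel_measurable_continuous_onI[OF \<phi>])
  have e: "(\<integral>y. \<phi> y * gkernel \<sigma> (x - y) \<partial>lborel) = (\<integral>z. \<phi> (x + (- \<sigma>) *\<^sub>R z) * gkernel 1 z \<partial>lborel)" if "\<sigma> > 0" for \<sigma>
    by (subst integral_affine[where c="- \<sigma>" and t=x])
       (use that in \<open>auto simp: gkernel_scale[OF that, symmetric] mult_ac\<close>)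
  have gi: "integrable lborel (\<lambda>z::'a. B * gkernel 1 z)"
    by (intro integrable_mult_right gkernel_integral) simp
  show "\<bar>\<integral>y. \<phi> y * gkernel \<sigma> (x - y) \<partial>lborel\<bar> \<le> (2 * pi) ^ DIM('a) * B" if "\<sigma> > 0"
  proof -
    have "\<bar>\<integral>z. \<phi> (x + (- \<sigma>) *\<^sub>R z) * gkernel 1 z \<partial>lborel\<bar> \<le> integral\<^sup>L lborel (\<lambda>z::'a. B * gkernel 1 z)"
    proof (rule integral_abs_bound_integral[OF _ gi])
      have le: "\<bar>\<phi> (x + (- \<sigma>) *\<^sub>R z) * gkernel 1 z\<bar> \<le> B * gkernel 1 z" for z
        unfolding abs_mult abs_of_nonneg[OF gkernel_nonneg[OF zero_less_one]]
        by (intro mult_right_mono B gkernel_nonneg) simp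
      then show "\<bar>\<phi> (x + (- \<sigma>) *\<^sub>R z) * gkernel 1 z\<bar> \<le> B * gkernel 1 z" for z .
      show "integrable lborel (\<lambda>z. \<phi> (x + (- \<sigma>) *\<^sub>R z) * gkernel 1 z)"
        by (rule Bochner_Integration.integrable_bound[OF gi])
           (use order_trans[OF le abs_ge_self] in auto)
    qed
    then show ?thesis
      unfolding e[OF that] by (simp add: gkernel_integral mult.commute)
  qed
  have "(\<lambda>n. \<integral>z. \<phi> (x + (- (1 / real (Suc n))) *\<^sub>R z) * gkernel 1 z \<partial>lborel) \<longlonglongrightarrow> integral\<^sup>L lborel (\<lambda>z::'a. \<phi> x * gkernel 1 z)"
  proof (rule integral_dominated_convergence[OF _ _ gi])
    show "AE z in lborel. (\<lambda>n. \<phi> (x + (- (1 / real (Suc n))) *\<^sub>R z) * gkernel 1 z) \<longlonglongrightarrow> \<phi> x * gkernel 1 z"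
    proof (rule AE_I2)
      fix z
      have "(\<lambda>n. x + (- (1 / real (Suc n))) *\<^sub>R z) \<longlonglongrightarrow> x + (- 0) *\<^sub>R z"
        by (intro tendsto_intros LIMSEQ_Suc[OF lim_1_over_n])
      then have "(\<lambda>n. \<phi> (x + (- (1 / real (Suc n))) *\<^sub>R z)) \<longlonglongrightarrow> \<phi> (x + (- 0) *\<^sub>R z)"
        by (intro continuous_on_tendsto_compose[OF \<phi>]) auto
      then show "(\<lambda>n. \<phi> (x + (- (1 / real (Suc n))) *\<^sub>R z) * gkernel 1 z) \<longlonglongrightarrow> \<phi> x * gkernel 1 z"
        by (intro tendsto_mult_right) simp
    qed
  qed (auto simp: abs_mult abs_of_nonneg[OF gkernel_nonneg] intro!: mult_right_mono B gkernel_nonneg)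
  then show "(\<lambda>n. \<integral>y. \<phi> y * gkernel (1 / real (Suc n)) (x - y) \<partial>lborel) \<longlonglongrightarrow> (2 * pi) ^ DIM('a) * \<phi> x"
    by (simp add: e gkernel_integral mult.commute)
qed

text \<open>The other half of Plancherel in dual form. Since \<open>f\<close> is only integrable,
  its L^2 size is known on the Fourier side alone and has to be read off from pairings with test
  functions. Cauchy-Schwarz is applied to the regularised pairing, and mollification then removes
  the regularisation.\<close>

theorem integral_mult_le_fourier:
  fixes f \<phi> :: "'a::euclidean_space \<Rightarrow> real"
  assumes f: "integrable lborel f" and \<phi>: "continuous_on UNIV \<phi>" and B: "\<And>x. \<bar>\<phi> x\<bar> \<le> B"
    and \<phi>i: "integrable lborel \<phi>" and \<phi>2: "integrable lborel (\<lambda>x. (\<phi> x)\<^sup>2)"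
    and P: "(\<integral>\<^sup>+\<xi>. ennreal ((cmod (fourier f \<xi>))\<^sup>2) \<partial>lborel) \<le> ennreal (P\<^sup>2)" "0 \<le> P"
    and N: "(\<integral>x. (\<phi> x)\<^sup>2 \<partial>lborel) \<le> N\<^sup>2" "0 \<le> N"
  shows "\<bar>\<integral>x. f x * \<phi> x \<partial>lborel\<bar> \<le> P * N"
proof -
  have [measurable]: "f \<in> borel_measurable borel" "\<phi> \<in> borel_measurable borel" using f \<phi>i by auto
  let ?c = "(2 * pi) ^ DIM('a)"
  have c1: "?c \<ge> 1" using pi_ge_two by (intro one_le_power) linarith
  define I where "I \<sigma> = (\<integral>x. f x * (\<integral>y. \<phi> y * gkernel \<sigma> (x - y) \<partial>lborel) \<partial>lborel)" for \<sigma>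
  have I_le: "\<bar>I \<sigma>\<bar> \<le> P * (sqrt ?c * N)" if s: "\<sigma> > 0" for \<sigma>
  proof -
    have "ennreal \<bar>I \<sigma>\<bar> = ennreal (cmod (\<integral>\<xi>. fourier f \<xi> * cnj (fourier \<phi> \<xi>) * complex_of_real (gweight \<sigma> \<xi>) \<partial>lborel))"
      unfolding I_def fourier_pairing[OF f \<phi>i s] by simp
    also have "\<dots> \<le> (\<integral>\<^sup>+\<xi>. ennreal (cmod (fourier f \<xi> * cnj (fourier \<phi> \<xi>) * complex_of_real (gweight \<sigma> \<xi>))) \<partial>lborel)"
      by (rule ennreal_norm_integral_le)
    also have "\<dots> \<le> (\<integral>\<^sup>+\<xi>. ennreal (cmod (fourier f \<xi>)) * ennreal (cmod (fourier \<phi> \<xi>)) \<partial>lborel)"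
    proof (rule nn_integral_mono)
      fix \<xi> :: 'a
      have "\<bar>gweight \<sigma> \<xi>\<bar> \<le> 1" using gweight_pos[of \<sigma> \<xi>] gweight_le_1[of \<sigma> \<xi>] by simp
      then show "ennreal (cmod (fourier f \<xi> * cnj (fourier \<phi> \<xi>) * complex_of_real (gweight \<sigma> \<xi>)))
         \<le> ennreal (cmod (fourier f \<xi>)) * ennreal (cmod (fourier \<phi> \<xi>))"
        by (auto simp: norm_mult ennreal_mult[symmetric] intro!: ennreal_leI mult_right_le_one_le)
    qed
    finally have 1: "ennreal \<bar>I \<sigma>\<bar> \<le> (\<integral>\<^sup>+\<xi>. ennreal (cmod (fourier f \<xi>)) * ennreal (cmod (fourier \<phi> \<xi>)) \<partial>lborel)" .
    have "ennreal (\<bar>I \<sigma>\<bar>\<^sup>2) = (ennreal \<bar>I \<sigma>\<bar>)\<^sup>2" by (simp add: ennreal_power)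
    also have "\<dots> \<le> (\<integral>\<^sup>+\<xi>. ennreal (cmod (fourier f \<xi>)) * ennreal (cmod (fourier \<phi> \<xi>)) \<partial>lborel)\<^sup>2"
      by (rule power_mono[OF 1]) simp
    also have "\<dots> \<le> (\<integral>\<^sup>+\<xi>. (ennreal (cmod (fourier f \<xi>)))\<^sup>2 \<partial>lborel) * (\<integral>\<^sup>+\<xi>. (ennreal (cmod (fourier \<phi> \<xi>)))\<^sup>2 \<partial>lborel)"
      by (rule Cauchy_Schwarz_nn_integral) measurable
    also have "\<dots> \<le> ennreal (P\<^sup>2) * ennreal (?c * N\<^sup>2)"
    proof (rule mult_mono)
      show "(\<integral>\<^sup>+\<xi>. (ennreal (cmod (fourier f \<xi>)))\<^sup>2 \<partial>lborel) \<le> ennreal (P\<^sup>2)"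
        using P by (simp add: ennreal_power)
      have "?c * (\<integral>x. (\<phi> x)\<^sup>2 \<partial>lborel) \<le> ?c * N\<^sup>2" using N c1 by (intro mult_left_mono) auto
      then show "(\<integral>\<^sup>+\<xi>. (ennreal (cmod (fourier \<phi> \<xi>)))\<^sup>2 \<partial>lborel) \<le> ennreal (?c * N\<^sup>2)"
        using order_trans[OF nn_integral_fourier_le[OF \<phi>i \<phi>2] ennreal_leI] by (simp add: ennreal_power)
    qed auto
    also have "\<dots> = ennreal ((P * (sqrt ?c * N))\<^sup>2)"
      using c1 by (simp add: ennreal_mult'[symmetric] power_mult_distrib)
    finally have "\<bar>I \<sigma>\<bar>\<^sup>2 \<le> (P * (sqrt ?c * N))\<^sup>2"
      by (subst (asm) ennreal_le_iff) simp_all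
    then show ?thesis
      by (rule power2_le_imp_le) (use c1 P(2) N(2) in \<open>simp add: zero_le_mult_iff\<close>)
  qed
  have lim: "(\<lambda>n. I (1 / real (Suc n))) \<longlonglongrightarrow> (\<integral>x. f x * (?c * \<phi> x) \<partial>lborel)"
    unfolding I_def
  proof (rule integral_dominated_convergence[where w="\<lambda>x. \<bar>f x\<bar> * (?c * B)"])
    show "integrable lborel (\<lambda>x. \<bar>f x\<bar> * (?c * B))" using f by auto
    show "AE x in lborel. (\<lambda>n. f x * (\<integral>y. \<phi> y * gkernel (1 / real (Suc n)) (x - y) \<partial>lborel)) \<longlonglongrightarrow> f x * (?c * \<phi> x)"
      by (intro AE_I2 tendsto_mult_left gkernel_mollify_tendsto[OF \<phi> B])
    show "AE x in lborel. norm (f x * (\<integral>y. \<phi> y * gkernel (1 / real (Suc n)) (x - y) \<partial>lborel)) \<le> \<bar>f x\<bar> * (?c * B)" for n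
      unfolding real_norm_def abs_mult
      by (intro AE_I2 mult_left_mono gkernel_mollify_tendsto[OF \<phi> B]) auto
  qed measurable
  have "\<bar>\<integral>x. f x * (?c * \<phi> x) \<partial>lborel\<bar> \<le> P * (sqrt ?c * N)"
    by (rule Lim_bounded[OF tendsto_rabs[OF lim], of 0], intro allI impI I_le) simp
  also have "(\<integral>x. f x * (?c * \<phi> x) \<partial>lborel) = ?c * (\<integral>x. f x * \<phi> x \<partial>lborel)"
    by (simp only: mult.left_commute[of _ ?c] integral_mult_right_zero)
  finally have "?c * \<bar>\<integral>x. f x * \<phi> x \<partial>lborel\<bar> \<le> P * (sqrt ?c * N)" using c1 by (simp add: abs_mult)
  \<comment> \<open>The inequality so far has the sharp factor (2 pi)^(-d/2); it is at most 1 and is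
    discarded.\<close>
  also have "\<dots> \<le> ?c * (P * N)"
  proof -
    have "sqrt ?c \<le> ?c" by (rule real_le_lsqrt) (use c1 self_le_power[OF c1, of 2] in simp_all)
    then have "sqrt ?c * (P * N) \<le> ?c * (P * N)" using P(2) N(2) by (intro mult_right_mono) auto
    then show ?thesis by (simp add: mult_ac)
  qed
  finally show ?thesis using c1 by (simp add: mult_le_cancel_left_pos)
qed

section \<open>Local L^1 norms and uniqueness of the Fourier transform\<close>

definition cutoff :: "real \<Rightarrow> 'a::euclidean_space \<Rightarrow> real" where
  "cutoff R x = max 0 (min 1 (R + 1 - norm x))"

lemma cutoff_bounds: "0 \<le> cutoff R x" "cutoff R x \<le> 1" "norm x \<le> R \<Longrightarrow> cutoff R x = 1"
  "cutoff R x \<le> indicator (cball 0 (R + 1)) x"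
  by (auto simp: cutoff_def indicator_def)

lemma cutoff_measurable [measurable]: "cutoff R \<in> borel_measurable borel"
  unfolding cutoff_def[abs_def] by measurable

lemma integrable_indicator_cball [simp]:
  "integrable lborel (indicator (cball (c::'a::euclidean_space) R) :: 'a \<Rightarrow> real)"
  by (rule integrable_real_indicator) (use emeasure_lborel_cball_finite[of c R] in auto)

text \<open>Testing \<open>f\<close> against its own sign on a ball gives the local L^1 norm. The
  sign is only measurable, so it is approximated off a null set by continuous functions, which are
  clamped to [-1, 1] and cut off near the ball; their L^2 norms are bounded by the root of the
  volume. Dominated convergence returns to the sign.\<close>

lemma local_L1_le_fourier:
  fixes f :: "'a::euclidean_space \<Rightarrow> real"
  assumes f: "integrable lborel f"
    and P: "(\<integral>\<^sup>+\<xi>. ennreal ((cmod (fourier f \<xi>))\<^sup>2) \<partial>lborel) \<le> ennreal (P\<^sup>2)" "0 \<le> P"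
  shows "(\<integral>x. indicator (cball 0 R) x * \<bar>f x\<bar> \<partial>lborel) \<le> P * sqrt (measure lborel (cball (0::'a) (R + 1)))"
proof -
  have [measurable]: "f \<in> borel_measurable borel" using f by auto
  have "(\<lambda>x. sgn (f x)) \<in> borel_measurable lborel" unfolding sgn_real_def by measurable
  then have "(\<lambda>x. sgn (f x)) \<in> borel_measurable lebesgue" by (rule measurable_completion)
  then have "(\<lambda>x. sgn (f x)) measurable_on UNIV" by (rule lebesgue_measurable_imp_measurable_on) simp
  then obtain N g where N: "negligible N" and g: "\<And>n. continuous_on UNIV (g n)"
    and lim: "\<And>x. x \<notin> N \<Longrightarrow> (\<lambda>n. g n x) \<longlonglongrightarrow> sgn (f x)"
    unfolding measurable_on_def by auto
  have "AE x in lebesgue. x \<notin> N"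
    using N by (intro AE_not_in) (simp add: negligible_iff_null_sets)
  then have N': "AE x in lborel. x \<notin> N" by (simp add: AE_completion_iff)
  define \<phi> where "\<phi> n x = max (- 1) (min 1 (g n x)) * cutoff R x" for n x
  let ?M = "measure lborel (cball (0::'a) (R + 1))"
  have \<phi>c: "continuous_on UNIV (\<phi> n)" for n
    unfolding \<phi>_def cutoff_def by (intro continuous_intros g)
  then have [measurable]: "\<phi> n \<in> borel_measurable borel" for n
    by (rule borel_measurable_continuous_onI)
  have clamp: "\<bar>max (- 1) (min 1 t)\<bar> \<le> 1" for t :: real by auto
  have \<phi>b: "\<bar>\<phi> n x\<bar> \<le> indicator (cball 0 (R + 1)) x" for n x
  proof -
    have "\<bar>\<phi> n x\<bar> \<le> 1 * cutoff R x"
      unfolding \<phi>_def abs_mult using cutoff_bounds(1)[of R x] clamp by (intro mult_mono) auto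
    then show ?thesis using cutoff_bounds(4)[of R x] by simp
  qed
  have \<phi>1: "\<bar>\<phi> n x\<bar> \<le> 1" for n x
    by (rule order_trans[OF \<phi>b]) (simp add: indicator_def)
  have ind: "integrable lborel (indicator (cball 0 (R + 1)) :: 'a \<Rightarrow> real)" by simp
  have \<phi>i: "integrable lborel (\<phi> n)" for n
    by (rule Bochner_Integration.integrable_bound[OF ind]) (auto simp: \<phi>b)
  have sq: "(\<phi> n x)\<^sup>2 \<le> indicator (cball 0 (R + 1)) x" for n x
  proof -
    have "(\<phi> n x)\<^sup>2 \<le> \<bar>\<phi> n x\<bar>"
      using mult_left_mono[OF \<phi>1[of n x] abs_ge_zero[of "\<phi> n x"]] by (simp add: power2_eq_square)
    then show ?thesis using \<phi>b[of n x] by linarith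
  qed
  have \<phi>2: "integrable lborel (\<lambda>x. (\<phi> n x)\<^sup>2)" for n
    by (rule Bochner_Integration.integrable_bound[OF ind]) (auto simp: sq)
  have "(\<integral>x. (\<phi> n x)\<^sup>2 \<partial>lborel) \<le> ?M" for n
    using integral_mono[OF \<phi>2 ind sq] by simp
  then have bound: "\<bar>\<integral>x. f x * \<phi> n x \<partial>lborel\<bar> \<le> P * sqrt ?M" for n
    by (intro integral_mult_le_fourier[OF f \<phi>c \<phi>1 \<phi>i \<phi>2 P]) auto
  have "(\<lambda>n. \<integral>x. f x * \<phi> n x \<partial>lborel) \<longlonglongrightarrow> (\<integral>x. f x * (sgn (f x) * cutoff R x) \<partial>lborel)"
  proof (rule integral_dominated_convergence[where w="\<lambda>x. \<bar>f x\<bar>"])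
    show "(\<lambda>x. f x * (sgn (f x) * cutoff R x)) \<in> borel_measurable lborel"
      unfolding sgn_real_def by measurable
    show "AE x in lborel. (\<lambda>n. f x * \<phi> n x) \<longlonglongrightarrow> f x * (sgn (f x) * cutoff R x)"
      using N'
    proof eventually_elim
      case (elim x)
      have "(\<lambda>n. max (- 1) (min 1 (g n x))) \<longlonglongrightarrow> max (- 1) (min 1 (sgn (f x)))"
        by (intro tendsto_intros lim elim)
      also have "max (- 1) (min 1 (sgn (f x))) = sgn (f x)"
        by (auto simp: sgn_real_def)
      finally show ?case unfolding \<phi>_def by (intro tendsto_intros)
    qed
    show "AE x in lborel. norm (f x * \<phi> n x) \<le> \<bar>f x\<bar>" for n
      using \<phi>1 by (auto simp: abs_mult intro!: mult_right_le_one_le)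
  qed (use f in auto)
  then have "(\<integral>x. f x * (sgn (f x) * cutoff R x) \<partial>lborel) \<le> P * sqrt ?M"
    by (rule Lim_bounded[of _ _ 0]) (use bound in \<open>auto simp: abs_le_iff\<close>)
  also have "(\<integral>x. f x * (sgn (f x) * cutoff R x) \<partial>lborel) = (\<integral>x. \<bar>f x\<bar> * cutoff R x \<partial>lborel)"
    by (intro Bochner_Integration.integral_cong) (auto simp: sgn_real_def)
  finally have 1: "(\<integral>x. \<bar>f x\<bar> * cutoff R x \<partial>lborel) \<le> P * sqrt ?M" .
  have i1: "integrable lborel (\<lambda>x. \<bar>f x\<bar> * cutoff R x)"
    by (rule Bochner_Integration.integrable_bound[OF f])
      (auto simp: abs_mult cutoff_bounds abs_of_nonneg intro!: mult_right_le_one_le)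
  have "(\<integral>x. indicator (cball 0 R) x * \<bar>f x\<bar> \<partial>lborel) \<le> (\<integral>x. \<bar>f x\<bar> * cutoff R x \<partial>lborel)"
    by (rule integral_mono_AE'[OF i1]) (auto simp: indicator_def cutoff_bounds intro!: mult_nonneg_nonneg)
  with 1 show ?thesis by linarith
qed

lemma fourier_diff:
  "integrable lborel f \<Longrightarrow> integrable lborel g \<Longrightarrow> fourier (\<lambda>x. f x - g x) \<xi> = fourier f \<xi> - fourier g \<xi>"
  unfolding fourier_def
  by (subst Bochner_Integration.integral_diff[symmetric])
     (auto intro: fourier_integrand_integrable simp: right_diff_distrib)

text \<open>The local bound with \<open>P = 0\<close> makes the difference vanish almost everywhere
  on every ball.\<close>

theorem fourier_unique:
  fixes f g :: "'a::euclidean_space \<Rightarrow> real"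
  assumes f: "integrable lborel f" and g: "integrable lborel g" and eq: "\<And>\<xi>. fourier f \<xi> = fourier g \<xi>"
  shows "AE x in lborel. f x = g x"
proof -
  let ?h = "\<lambda>x. f x - g x"
  have h: "integrable lborel ?h" using f g by simp
  have P: "(\<integral>\<^sup>+\<xi>. ennreal ((cmod (fourier ?h \<xi>))\<^sup>2) \<partial>lborel) \<le> ennreal (0\<^sup>2)"
    by (simp add: fourier_diff[OF f g] eq)
  have "AE x in lborel. indicator (cball 0 (real n)) x * \<bar>?h x\<bar> = 0" for n
  proof -
    have i: "integrable lborel (\<lambda>x. indicator (cball 0 (real n)) x * \<bar>?h x\<bar>)"
      by (rule Bochner_Integration.integrable_bound[OF h]) (use f g in \<open>auto simp: indicator_def\<close>)
    have "(\<integral>x. indicator (cball 0 (real n)) x * \<bar>?h x\<bar> \<partial>lborel) \<le> 0"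
      using local_L1_le_fourier[OF h P, of "real n"] by simp
    moreover have "0 \<le> (\<integral>x. indicator (cball 0 (real n)) x * \<bar>?h x\<bar> \<partial>lborel)"
      by (rule integral_nonneg_AE) auto
    ultimately show ?thesis
      using integral_nonneg_eq_0_iff_AE[OF i] by auto
  qed
  then have "AE x in lborel. \<forall>n::nat. indicator (cball 0 (real n)) x * \<bar>?h x\<bar> = 0"
    by (subst AE_all_countable) auto
  then show ?thesis
  proof eventually_elim
    case (elim x)
    obtain n :: nat where "norm x \<le> real n" using real_arch_simple by blast
    then show ?case using elim[rule_format, of n] by (auto simp: indicator_def)
  qed
qed

section \<open>Weighted L^1 spaces and interpolation with L^2\<close>

lemma bracket_ge_1: "1 \<le> bracket x" and bracket_pos: "0 < bracket x" and norm_le_bracket: "norm x \<le> bracket x"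
  and bracket_le: "bracket x \<le> 1 + norm x"
proof -
  show "1 \<le> bracket x" by (simp add: bracket_def)
  then show "0 < bracket x" by simp
  show "norm x \<le> bracket x" unfolding bracket_def by (intro real_le_rsqrt) simp
  show "bracket x \<le> 1 + norm x" unfolding bracket_def
    by (intro real_le_lsqrt) (auto simp: power2_eq_square algebra_simps)
qed

lemma bracket_measurable [measurable]: "bracket \<in> borel_measurable borel"
  unfolding bracket_def[abs_def] by measurable

lemma bracket_powr_ge_1: "0 \<le> k \<Longrightarrow> 1 \<le> bracket x powr k"
  using bracket_ge_1[of x] by (rule ge_one_powr_ge_zero)

lemma bracket_powr_mono: "k \<le> m \<Longrightarrow> bracket x powr k \<le> bracket x powr m"
  using bracket_ge_1[of x] by (rule powr_mono[rotated])

lemma in_L1k_integrable: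
  assumes "in_L1k k f" "0 \<le> k" shows "integrable lborel f"
proof -
  have i: "integrable lborel (\<lambda>x. bracket x powr k * \<bar>f x\<bar>)" and [measurable]: "f \<in> borel_measurable borel"
    using assms by (auto simp: in_L1k_def)
  have "\<bar>f x\<bar> \<le> bracket x powr k * \<bar>f x\<bar>" for x
    using bracket_powr_ge_1[OF assms(2), of x] by (simp add: mult_le_cancel_right1)
  then show ?thesis
    by (intro Bochner_Integration.integrable_bound[OF i]) (auto intro!: order_trans[OF _ abs_ge_self])
qed

lemma in_L1k_mono:
  assumes "in_L1k m f" "k \<le> m" shows "in_L1k k f"
proof -
  have i: "integrable lborel (\<lambda>x. bracket x powr m * \<bar>f x\<bar>)" and [measurable]: "f \<in> borel_measurable borel"
    using assms by (auto simp: in_L1k_def)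
  have "integrable lborel (\<lambda>x. bracket x powr k * \<bar>f x\<bar>)"
    by (intro Bochner_Integration.integrable_bound[OF i])
       (use assms(2) in \<open>auto simp: abs_mult intro!: mult_right_mono bracket_powr_mono\<close>)
  then show ?thesis by (simp add: in_L1k_def)
qed

lemma in_L1k_diff:
  assumes "in_L1k k f" "in_L1k k g" shows "in_L1k k (\<lambda>x. f x - g x)"
proof -
  have fi: "integrable lborel (\<lambda>x. bracket x powr k * \<bar>f x\<bar>)" and gi: "integrable lborel (\<lambda>x. bracket x powr k * \<bar>g x\<bar>)"
    and [measurable]: "f \<in> borel_measurable borel" "g \<in> borel_measurable borel"
    using assms by (auto simp: in_L1k_def)
  have "integrable lborel (\<lambda>x. bracket x powr k * \<bar>f x - g x\<bar>)"
  proof (rule Bochner_Integration.integrable_bound[OF Bochner_Integration.integrable_add[OF fi gi]])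
    have "bracket x powr k * \<bar>f x - g x\<bar> \<le> bracket x powr k * \<bar>f x\<bar> + bracket x powr k * \<bar>g x\<bar>" for x
      unfolding distrib_left[symmetric] by (intro mult_left_mono abs_triangle_ineq4) simp
    then show "AE x in lborel. norm (bracket x powr k * \<bar>f x - g x\<bar>) \<le> norm (bracket x powr k * \<bar>f x\<bar> + bracket x powr k * \<bar>g x\<bar>)"
      by (intro AE_I2) (simp add: abs_mult)
  qed measurable
  then show ?thesis by (simp add: in_L1k_def)
qed

text \<open>Both powers of 2 come from \<open>R + 1 \<le> 2 * R\<close>, used once for the weight on
  the ball of radius R and once for the volume of the enlarged ball.\<close>

definition interp_const :: "'a::euclidean_space itself \<Rightarrow> real \<Rightarrow> real" where
  "interp_const _ k = 2 powr k * sqrt (unit_ball_vol (DIM('a)) * 2 ^ DIM('a))"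

text \<open>The integral is split at a free radius \<open>R\<close>. Inside, Cauchy-Schwarz trades
  L^1 for L^2 at the price of the weight and the root of the volume; outside, lowering the weight
  from m to k gains \<open>R powr (k - m)\<close>. Balancing both terms in \<open>R\<close> later
  produces the rate (m - k)/(m + d/2).\<close>

theorem L1k_interpolation:
  fixes f :: "'a::euclidean_space \<Rightarrow> real"
  assumes f: "in_L1k m f" and k: "0 \<le> k" "k \<le> m" and R: "1 \<le> R"
    and P: "(\<integral>\<^sup>+\<xi>. ennreal ((cmod (fourier f \<xi>))\<^sup>2) \<partial>lborel) \<le> ennreal (P\<^sup>2)" "0 \<le> P"
  shows "L1k_norm k f \<le> interp_const TYPE('a) k * R powr (k + DIM('a) / 2) * P + R powr (k - m) * L1k_norm m f"
proof -
  have fi: "integrable lborel f" using f k by (intro in_L1k_integrable[OF f]) auto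
  have m: "integrable lborel (\<lambda>x. bracket x powr m * \<bar>f x\<bar>)" and [measurable]: "f \<in> borel_measurable borel"
    using f by (auto simp: in_L1k_def)
  have i1: "integrable lborel (\<lambda>x. (2 * R) powr k * (indicator (cball 0 R) x * \<bar>f x\<bar>))"
    by (intro integrable_mult_right Bochner_Integration.integrable_bound[OF fi]) (auto simp: indicator_def)
  have i2: "integrable lborel (\<lambda>x. R powr (k - m) * (bracket x powr m * \<bar>f x\<bar>))"
    by (intro integrable_mult_right m)
  have le: "bracket x powr k * \<bar>f x\<bar> \<le> (2 * R) powr k * (indicator (cball 0 R) x * \<bar>f x\<bar>)
      + R powr (k - m) * (bracket x powr m * \<bar>f x\<bar>)" for x
  proof (cases "norm x \<le> R")
    case True
    then have "bracket x powr k \<le> (2 * R) powr k"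
      using bracket_le[of x] bracket_pos[of x] R k by (intro powr_mono2) auto
    then have "bracket x powr k * \<bar>f x\<bar> \<le> (2 * R) powr k * \<bar>f x\<bar>" by (intro mult_right_mono) auto
    moreover have "0 \<le> R powr (k - m) * (bracket x powr m * \<bar>f x\<bar>)" by simp
    moreover have "indicator (cball 0 R) x = (1::real)" using True by (simp add: indicator_def)
    ultimately show ?thesis by (simp only: mult_1_left)
  next
    case False
    have "bracket x powr (k - m) \<le> R powr (k - m)"
      using False norm_le_bracket[of x] R k by (intro powr_mono2') auto
    then have "bracket x powr (k - m) * bracket x powr m * \<bar>f x\<bar> \<le> R powr (k - m) * bracket x powr m * \<bar>f x\<bar>"
      by (intro mult_right_mono) auto
    then show ?thesis using False by (simp add: powr_add[symmetric] mult.assoc)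
  qed
  have "L1k_norm k f \<le> (\<integral>x. (2 * R) powr k * (indicator (cball 0 R) x * \<bar>f x\<bar>)
      + R powr (k - m) * (bracket x powr m * \<bar>f x\<bar>) \<partial>lborel)"
    unfolding L1k_norm_def
    by (rule integral_mono_AE'[OF Bochner_Integration.integrable_add[OF i1 i2]]) (auto simp: le)
  also have "\<dots> = (2 * R) powr k * (\<integral>x. indicator (cball 0 R) x * \<bar>f x\<bar> \<partial>lborel) + R powr (k - m) * L1k_norm m f"
    by (subst Bochner_Integration.integral_add[OF i1 i2]) (simp add: L1k_norm_def)
  also have "(2 * R) powr k * (\<integral>x. indicator (cball 0 R) x * \<bar>f x\<bar> \<partial>lborel) \<le> (2 * R) powr k * (P * sqrt (measure lborel (cball (0::'a) (R + 1))))"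
    by (intro mult_left_mono local_L1_le_fourier[OF fi P]) auto
  also have "\<dots> \<le> (2 * R) powr k * (P * sqrt (unit_ball_vol (DIM('a)) * (2 * R) ^ DIM('a)))"
  proof -
    have "(R + 1) ^ DIM('a) \<le> (2 * R) ^ DIM('a)" using R by (intro power_mono) auto
    then have "measure lborel (cball (0::'a) (R + 1)) \<le> unit_ball_vol (DIM('a)) * (2 * R) ^ DIM('a)"
      using R by (simp only: content_cball mult_left_mono unit_ball_vol_nonneg add_nonneg_nonneg zero_le_one)
    then show ?thesis using R P(2) by (intro mult_left_mono) auto
  qed
  also have "\<dots> = interp_const TYPE('a) k * R powr (k + DIM('a) / 2) * P"
  proof -
    have "sqrt (R ^ DIM('a)) = R powr (DIM('a) / 2)"
      using R by (simp add: powr_realpow[symmetric] powr_half_sqrt[symmetric] powr_powr)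
    then show ?thesis
      using R by (simp add: interp_const_def powr_mult power_mult_distrib real_sqrt_mult powr_add)
  qed
  finally show ?thesis by simp
qed

section \<open>The Fourier transform of mild solutions\<close>

lemma exp_of_DIM_mult: "exp (real n * r) = exp r ^ n"
  by (simp add: exp_of_nat_mult)

lemma dilate_integrable:
  fixes f :: "'a::euclidean_space \<Rightarrow> real"
  assumes "integrable lborel f"
  shows "integrable lborel (\<lambda>x. exp (real DIM('a) * r) * f (exp r *\<^sub>R x))"
  using integrable_affine[OF assms, of "exp r" 0] by (intro integrable_mult_right) auto

lemma dilate_integral:
  fixes f :: "'a::euclidean_space \<Rightarrow> real"
  assumes "integrable lborel f"
  shows "(\<integral>x. exp (real DIM('a) * r) * f (exp r *\<^sub>R x) \<partial>lborel) = (\<integral>x. f x \<partial>lborel)"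
  using assms by (subst (2) integral_affine[where c="exp r" and t=0]) (auto simp: exp_of_DIM_mult)

lemma fourier_dilate:
  fixes f :: "'a::euclidean_space \<Rightarrow> real"
  assumes "integrable lborel f"
  shows "fourier (\<lambda>x. exp (real DIM('a) * r) * f (exp r *\<^sub>R x)) \<xi> = fourier f (exp (- r) *\<^sub>R \<xi>)"
proof -
  have [measurable]: "f \<in> borel_measurable borel" using assms by auto
  have "fourier f (exp (- r) *\<^sub>R \<xi>) = exp r ^ DIM('a) *\<^sub>R (\<integral>x. cis (- ((exp r *\<^sub>R x) \<bullet> (exp (- r) *\<^sub>R \<xi>))) * complex_of_real (f (exp r *\<^sub>R x)) \<partial>lborel)"
    unfolding fourier_def by (subst integral_affine[where c="exp r" and t=0]) auto
  also have "\<dots> = (\<integral>x. exp r ^ DIM('a) *\<^sub>R (cis (- (x \<bullet> \<xi>)) * complex_of_real (f (exp r *\<^sub>R x))) \<partial>lborel)"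
    by (simp add: mult.assoc[symmetric] exp_add[symmetric])
  also have "\<dots> = fourier (\<lambda>x. exp (real DIM('a) * r) * f (exp r *\<^sub>R x)) \<xi>"
    unfolding fourier_def
    by (intro Bochner_Integration.integral_cong) (auto simp: scaleR_conv_of_real exp_of_DIM_mult)
  finally show ?thesis ..
qed

lemma fourier_continuous:
  fixes f :: "'a::euclidean_space \<Rightarrow> real"
  assumes f: "integrable lborel f"
  shows "continuous_on S (fourier f)"
proof -
  have [measurable]: "f \<in> borel_measurable borel" using assms by auto
  have "isCont (fourier f) \<xi>" for \<xi>
  proof (rule continuous_at_sequentiallyI)
    fix X :: "nat \<Rightarrow> 'a" assume X: "X \<longlonglongrightarrow> \<xi>"
    show "(\<lambda>n. fourier f (X n)) \<longlonglongrightarrow> fourier f \<xi>"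
      unfolding fourier_def
    proof (rule integral_dominated_convergence[where w="\<lambda>x. \<bar>f x\<bar>"])
      show "AE x in lborel. (\<lambda>n. cis (- (x \<bullet> X n)) * complex_of_real (f x)) \<longlonglongrightarrow> cis (- (x \<bullet> \<xi>)) * complex_of_real (f x)"
      proof (rule AE_I2)
        fix x
        have "continuous_on UNIV cis" by (auto intro!: continuous_intros simp: cis_conv_exp)
        then have "(\<lambda>n. cis (- (x \<bullet> X n))) \<longlonglongrightarrow> cis (- (x \<bullet> \<xi>))"
          by (rule continuous_on_tendsto_compose) (auto intro!: tendsto_intros X)
        then show "(\<lambda>n. cis (- (x \<bullet> X n)) * complex_of_real (f x)) \<longlonglongrightarrow> cis (- (x \<bullet> \<xi>)) * complex_of_real (f x)"
          by (rule tendsto_mult_right)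
      qed
    qed (use f in \<open>auto simp: norm_mult\<close>)
  qed
  then show ?thesis by (simp add: continuous_at_imp_continuous_on)
qed

lemma integrable_conv_kernel:
  fixes K w :: "'a::euclidean_space \<Rightarrow> real"
  assumes K: "integrable lborel K" and w: "integrable lborel w"
  shows "integrable (lborel \<Otimes>\<^sub>M lborel) (\<lambda>(y, x). K (x - y) * w y)"
proof (rule lborel_pair.Fubini_integrable)
  have [measurable]: "K \<in> borel_measurable borel" "w \<in> borel_measurable borel" using K w by auto
  show "(\<lambda>(y, x). K (x - y) * w y) \<in> borel_measurable (lborel \<Otimes>\<^sub>M lborel)" by measurable
  have sh: "integrable lborel (\<lambda>x. K (x - y))" for y
    using integrable_affine[OF K, of 1 "- y"] by simp
  have "(\<integral>x. \<bar>K (x - y)\<bar> \<partial>lborel) = (\<integral>x. \<bar>K x\<bar> \<partial>lborel)" for y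
    by (subst (2) integral_affine[where c=1 and t="- y"]) auto
  then have "(\<integral>x. norm (K (x - y) * w y) \<partial>lborel) = (\<integral>x. \<bar>K x\<bar> \<partial>lborel) * \<bar>w y\<bar>" for y
    by (simp add: abs_mult)
  then show "integrable lborel (\<lambda>y. \<integral>x. norm (case (y, x) of (y, x) \<Rightarrow> K (x - y) * w y) \<partial>lborel)"
    using w by simp
  show "AE y in lborel. integrable lborel (\<lambda>x. case (y, x) of (y, x) \<Rightarrow> K (x - y) * w y)"
    using sh by simp
qed

lemma conv_measurable [measurable]:
  fixes K w :: "'a::euclidean_space \<Rightarrow> real"
  assumes [measurable]: "K \<in> borel_measurable borel" "w \<in> borel_measurable borel"
  shows "conv K w \<in> borel_measurable borel"
  unfolding conv_def[abs_def] by measurable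

lemma conv_integrable:
  fixes K w :: "'a::euclidean_space \<Rightarrow> real"
  assumes K: "integrable lborel K" and w: "integrable lborel w"
  shows "integrable lborel (conv K w)"
    and "(\<integral>x. \<bar>conv K w x\<bar> \<partial>lborel) \<le> (\<integral>x. \<bar>K x\<bar> \<partial>lborel) * (\<integral>x. \<bar>w x\<bar> \<partial>lborel)"
proof -
  have [measurable]: "K \<in> borel_measurable borel" "w \<in> borel_measurable borel" using K w by auto
  note int = integrable_conv_kernel[OF K w]
  show "integrable lborel (conv K w)"
    unfolding conv_def[abs_def] using lborel_pair.integrable_snd[OF int] .
  have int': "integrable (lborel \<Otimes>\<^sub>M lborel) (\<lambda>(y, x). \<bar>K (x - y) * w y\<bar>)"
    using integrable_norm[OF int] by (simp add: case_prod_unfold)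
  have "(\<integral>x. \<bar>conv K w x\<bar> \<partial>lborel) \<le> (\<integral>x. \<integral>y. \<bar>K (x - y) * w y\<bar> \<partial>lborel \<partial>lborel)"
    unfolding conv_def
    by (rule integral_mono_AE'[OF lborel_pair.integrable_snd[OF int']])
       (auto intro!: integral_abs_bound)
  also have "\<dots> = (\<integral>y. \<integral>x. \<bar>K (x - y) * w y\<bar> \<partial>lborel \<partial>lborel)"
    by (rule lborel_pair.Fubini_integral[OF int'])
  also have "\<dots> = (\<integral>y. (\<integral>x. \<bar>K x\<bar> \<partial>lborel) * \<bar>w y\<bar> \<partial>lborel)"
  proof -
    have "(\<integral>x. \<bar>K (x - y)\<bar> \<partial>lborel) = (\<integral>x. \<bar>K x\<bar> \<partial>lborel)" for y
      by (subst (2) integral_affine[where c=1 and t="- y"]) auto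
    then show ?thesis by (simp add: abs_mult)
  qed
  finally show "(\<integral>x. \<bar>conv K w x\<bar> \<partial>lborel) \<le> (\<integral>x. \<bar>K x\<bar> \<partial>lborel) * (\<integral>x. \<bar>w x\<bar> \<partial>lborel)"
    by simp
qed

lemma fourier_conv:
  fixes K w :: "'a::euclidean_space \<Rightarrow> real"
  assumes K: "integrable lborel K" and w: "integrable lborel w"
  shows "fourier (conv K w) \<xi> = fourier K \<xi> * fourier w \<xi>"
proof -
  have [measurable]: "K \<in> borel_measurable borel" "w \<in> borel_measurable borel" using K w by auto
  let ?F = "\<lambda>y x. cis (- (x \<bullet> \<xi>)) * complex_of_real (K (x - y) * w y)"
  have int: "integrable (lborel \<Otimes>\<^sub>M lborel) (case_prod ?F)"
    by (rule Bochner_Integration.integrable_bound[OF integrable_conv_kernel[OF K w]])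
       (auto simp: norm_mult)
  have "fourier (conv K w) \<xi> = (\<integral>x. \<integral>y. ?F y x \<partial>lborel \<partial>lborel)"
    unfolding fourier_def conv_def by (simp only: integral_complex_of_real[symmetric] integral_mult_right_zero)
  also have "\<dots> = (\<integral>y. \<integral>x. ?F y x \<partial>lborel \<partial>lborel)"
    by (rule lborel_pair.Fubini_integral[OF int])
  also have "\<dots> = (\<integral>y. fourier K \<xi> * (cis (- (y \<bullet> \<xi>)) * complex_of_real (w y)) \<partial>lborel)"
  proof (intro Bochner_Integration.integral_cong refl)
    fix y
    have "fourier K \<xi> = (\<integral>x. cis (- ((- y + 1 *\<^sub>R x) \<bullet> \<xi>)) * complex_of_real (K (- y + 1 *\<^sub>R x)) \<partial>lborel)"
      unfolding fourier_def by (subst integral_affine[where c=1 and t="- y"]) auto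
    then have "fourier K \<xi> * (cis (- (y \<bullet> \<xi>)) * complex_of_real (w y))
      = (\<integral>x. cis (- ((- y + 1 *\<^sub>R x) \<bullet> \<xi>)) * complex_of_real (K (- y + 1 *\<^sub>R x)) * (cis (- (y \<bullet> \<xi>)) * complex_of_real (w y)) \<partial>lborel)"
      by (simp only: integral_mult_left_zero)
    also have "\<dots> = (\<integral>x. ?F y x \<partial>lborel)"
    proof (intro Bochner_Integration.integral_cong refl)
      fix x
      have "cis (- (x \<bullet> \<xi>)) = cis (- ((- y + 1 *\<^sub>R x) \<bullet> \<xi>)) * cis (- (y \<bullet> \<xi>))"
        by (simp add: cis_mult inner_add_left inner_diff_left)
      then show "cis (- ((- y + 1 *\<^sub>R x) \<bullet> \<xi>)) * complex_of_real (K (- y + 1 *\<^sub>R x)) * (cis (- (y \<bullet> \<xi>)) * complex_of_real (w y)) = ?F y x"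
        by simp
    qed
    finally show "(\<integral>x. ?F y x \<partial>lborel) = fourier K \<xi> * (cis (- (y \<bullet> \<xi>)) * complex_of_real (w y))" ..
  qed
  also have "\<dots> = fourier K \<xi> * fourier w \<xi>"
    unfolding fourier_def by (rule integral_mult_right_zero)
  finally show ?thesis .
qed

text \<open>The integrating factor: y times the exponential of minus the primitive of g has
  derivative zero.\<close>

lemma linear_volterra:
  fixes y g :: "real \<Rightarrow> complex"
  assumes y: "continuous_on {0..} y" and g: "continuous_on {0..} g"
    and eq: "\<And>t. 0 \<le> t \<Longrightarrow> y t = c + integral {0..t} (\<lambda>\<tau>. g \<tau> * y \<tau>)" and t: "0 \<le> t"
  shows "y t = c * exp (integral {0..t} g)"
proof -
  define G where "G = (\<lambda>x. integral {0..x} g)"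
  have sub: "{0..t} \<subseteq> {0..}" by auto
  have G': "(G has_vector_derivative g x) (at x within {0..t})" if "x \<in> {0..t}" for x
    unfolding G_def using that by (intro integral_has_vector_derivative continuous_on_subset[OF g]) auto
  have y': "(y has_vector_derivative (g x * y x)) (at x within {0..t})" if x: "x \<in> {0..t}" for x
  proof -
    have "((\<lambda>x. c + integral {0..x} (\<lambda>\<tau>. g \<tau> * y \<tau>)) has_vector_derivative (0 + g x * y x)) (at x within {0..t})"
      using x by (intro has_vector_derivative_add has_vector_derivative_const integral_has_vector_derivative
        continuous_intros continuous_on_subset[OF g] continuous_on_subset[OF y]) auto
    from this[simplified add_0] show ?thesis
      by (rule has_vector_derivative_transform[OF x, rotated]) (use eq in auto)
  qed
  define z where "z = (\<lambda>x. y x * exp (- G x))"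
  have "(z has_vector_derivative 0) (at x within {0..t})" if x: "x \<in> {0..t}" for x
  proof -
    have "((\<lambda>x. exp (- G x)) has_vector_derivative (- g x * exp (- G x))) (at x within {0..t})"
      using field_vector_diff_chain_within[of "\<lambda>x. - G x" "- g x" x "{0..t}" exp "exp (- G x)"]
        has_vector_derivative_minus[OF G'[OF x]]
      by (auto simp: o_def intro: DERIV_exp has_field_derivative_at_within)
    from has_vector_derivative_mult[OF y'[OF x] this] show ?thesis
      unfolding z_def by (simp add: algebra_simps)
  qed
  then have "(z has_derivative (\<lambda>h. 0)) (at x within {0..t})" if "x \<in> {0..t}" for x
    using that by (simp add: has_vector_derivative_def)
  then have "\<exists>k. \<forall>x\<in>{0..t}. z x = k"
    by (rule has_derivative_zero_constant[OF convex_real_interval(5)])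
  then have "z t = z 0" using t by (metis atLeastAtMost_iff order_refl)
  moreover have "z 0 = c" using eq[of 0] by (simp add: z_def G_def)
  ultimately have "y t * exp (- G t) = c" by (simp add: z_def)
  then have "y t * exp (- G t) * exp (G t) = c * exp (G t)" by simp
  then show ?thesis by (simp add: mult.assoc exp_minus G_def)
qed

text \<open>The exponent of an Ornstein-Uhlenbeck process driven by compound Poisson jumps of rate
  \<open>a\<close> and density \<open>K\<close>: the symbol of the jumps, integrated along the orbit
  of \<xi> under the drift.\<close>

definition exponent :: "('a::euclidean_space \<Rightarrow> real) \<Rightarrow> real \<Rightarrow> real \<Rightarrow> 'a \<Rightarrow> complex" where
  "exponent K a t \<xi> = (\<integral>\<tau>\<in>{0..t}. complex_of_real a * (1 - fourier K (exp (- \<tau>) *\<^sub>R \<xi>)) \<partial>lborel)"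

text \<open>Continuity in L^1_k makes the norm a continuous function of time, hence bounded on
  compact intervals. This gives the integrability in time and space that Fubini requires in the
  Duhamel formula.\<close>

lemma L1k_norm_bounded_on:
  assumes m: "mild_solution k K a u0 u" and k: "0 \<le> k"
  shows "\<exists>N\<ge>0. \<forall>\<tau>\<in>{0..t}. L1k_norm k (u \<tau>) \<le> N"
proof -
  have inL: "in_L1k k (u \<tau>)" if "0 \<le> \<tau>" for \<tau> using m that by (auto simp: mild_solution_def)
  have lim: "((\<lambda>t. L1k_norm k (\<lambda>x. u t x - u t0 x)) \<longlongrightarrow> 0) (at t0 within {0..})" if "0 \<le> t0" for t0
    using m that by (auto simp: mild_solution_def)
  have tri: "\<bar>L1k_norm k f - L1k_norm k g\<bar> \<le> L1k_norm k (\<lambda>x. f x - g x)" if f: "in_L1k k f" and g: "in_L1k k g" for f g :: "'a \<Rightarrow> real"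
  proof -
    have fi: "integrable lborel (\<lambda>x. bracket x powr k * \<bar>f x\<bar>)" and gi: "integrable lborel (\<lambda>x. bracket x powr k * \<bar>g x\<bar>)"
      and [measurable]: "f \<in> borel_measurable borel" "g \<in> borel_measurable borel"
      using f g by (auto simp: in_L1k_def)
    have di: "integrable lborel (\<lambda>x. bracket x powr k * \<bar>f x - g x\<bar>)"
      using in_L1k_diff[OF f g] by (simp add: in_L1k_def)
    have le: "\<bar>bracket x powr k * \<bar>f x\<bar> - bracket x powr k * \<bar>g x\<bar>\<bar> \<le> bracket x powr k * \<bar>f x - g x\<bar>" for x
      unfolding right_diff_distrib[symmetric] abs_mult abs_of_nonneg[OF powr_ge_zero]
      by (intro mult_left_mono abs_triangle_ineq3) simp
    show ?thesis
      unfolding L1k_norm_def Bochner_Integration.integral_diff[OF fi gi, symmetric]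
      by (rule order_trans[OF integral_abs_bound], rule integral_mono_AE'[OF di]) (simp_all add: le)
  qed
  have "continuous_on {0..t} (\<lambda>\<tau>. L1k_norm k (u \<tau>))"
    unfolding continuous_on_def
  proof
    fix t0 assume t0: "t0 \<in> {0..t}"
    have "((\<lambda>\<tau>. L1k_norm k (u \<tau>) - L1k_norm k (u t0)) \<longlongrightarrow> 0) (at t0 within {0..t})"
    proof (rule Lim_null_comparison)
      show "((\<lambda>t. L1k_norm k (\<lambda>x. u t x - u t0 x)) \<longlongrightarrow> 0) (at t0 within {0..t})"
        using t0 by (intro tendsto_within_subset[OF lim]) auto
      show "\<forall>\<^sub>F \<tau> in at t0 within {0..t}. norm (L1k_norm k (u \<tau>) - L1k_norm k (u t0)) \<le> L1k_norm k (\<lambda>x. u \<tau> x - u t0 x)"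
        using t0 by (auto simp: eventually_at_filter intro!: always_eventually tri inL)
    qed
    then show "((\<lambda>\<tau>. L1k_norm k (u \<tau>)) \<longlongrightarrow> L1k_norm k (u t0)) (at t0 within {0..t})"
      by (simp add: LIM_zero_iff)
  qed
  then have "bounded ((\<lambda>\<tau>. L1k_norm k (u \<tau>)) ` {0..t})"
    by (intro compact_imp_bounded compact_continuous_image) auto
  then obtain N where "\<forall>\<tau>\<in>{0..t}. norm (L1k_norm k (u \<tau>)) \<le> N" by (auto simp: bounded_iff)
  then show ?thesis by (intro exI[of _ "max 0 N"]) (auto simp: max_def)
qed

lemma integral_abs_le_L1k_norm:
  assumes "in_L1k k f" "0 \<le> k" shows "(\<integral>x. \<bar>f x\<bar> \<partial>lborel) \<le> L1k_norm k f"
  unfolding L1k_norm_def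
proof (rule integral_mono_AE')
  show "integrable lborel (\<lambda>x. bracket x powr k * \<bar>f x\<bar>)" using assms by (auto simp: in_L1k_def)
  show "AE x in lborel. \<bar>f x\<bar> \<le> bracket x powr k * \<bar>f x\<bar>"
    using mult_right_mono[OF bracket_powr_ge_1[OF assms(2)] abs_ge_zero] by (intro AE_I2) simp
qed auto

text \<open>On the Fourier side the drift is a transport of frequencies. Along the moving frequency
  \<open>exp \<tau> *\<^sub>R \<xi>0\<close> it disappears, and the transformed Duhamel formula is
  the scalar Volterra equation solved above.\<close>

theorem fourier_mild_solution:
  fixes K u0 :: "'a::euclidean_space \<Rightarrow> real"
  assumes m: "mild_solution k K a u0 u" and k: "0 \<le> k" and K: "integrable lborel K"
    and u0: "integrable lborel u0" and T: "0 \<le> T"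
  shows "fourier (u T) \<xi> = fourier u0 (exp (- T) *\<^sub>R \<xi>) * exp (- exponent K a T \<xi>)"
proof -
  let ?D = "real DIM('a)"
  have [measurable]: "K \<in> borel_measurable borel" "u0 \<in> borel_measurable borel" using K u0 by auto
  have um: "(\<lambda>(\<tau>, x). u \<tau> x) \<in> borel_measurable (lborel \<Otimes>\<^sub>M lborel)"
    using m by (simp add: mild_solution_def case_prod_unfold)
  note um [measurable]
  have inL: "in_L1k k (u \<tau>)" if "0 \<le> \<tau>" for \<tau> using m that by (auto simp: mild_solution_def)
  have ui: "integrable lborel (u \<tau>)" if "0 \<le> \<tau>" for \<tau>
    by (rule in_L1k_integrable[OF inL[OF that] k])
  have duhamel: "fourier (u t) \<xi> = fourier u0 (exp (- t) *\<^sub>R \<xi>) +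
      (\<integral>\<tau>\<in>{0..t}. complex_of_real a * (fourier K (exp (\<tau> - t) *\<^sub>R \<xi>) - 1) * fourier (u \<tau>) (exp (\<tau> - t) *\<^sub>R \<xi>) \<partial>lborel)"
    if t: "0 \<le> t" for t \<xi>
  proof -
    obtain N where N: "0 \<le> N" "\<And>\<tau>. \<tau> \<in> {0..t} \<Longrightarrow> L1k_norm k (u \<tau>) \<le> N"
      using L1k_norm_bounded_on[OF m k, of t] by auto
    define w where "w \<tau> x = conv K (u \<tau>) x - u \<tau> x" for \<tau> x
    \<comment> \<open>With the indicator inside \<open>G\<close> the Duhamel integral runs over the
      whole line, so that Fubini can be used on a product of Lebesgue measures.\<close>
    define G where "G \<tau> x = indicator {0..t} \<tau> * (a * (exp (?D * (t - \<tau>)) * w \<tau> (exp (t - \<tau>) *\<^sub>R x)))" for \<tau> x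
    have wi: "integrable lborel (w \<tau>)" if "\<tau> \<in> {0..t}" for \<tau>
      unfolding w_def[abs_def] using that by (intro Bochner_Integration.integrable_diff conv_integrable K ui) auto
    have w_le: "(\<integral>x. \<bar>w \<tau> x\<bar> \<partial>lborel) \<le> ((\<integral>x. \<bar>K x\<bar> \<partial>lborel) + 1) * N" if \<tau>: "\<tau> \<in> {0..t}" for \<tau>
    proof -
      have un: "(\<integral>x. \<bar>u \<tau> x\<bar> \<partial>lborel) \<le> N"
        using integral_abs_le_L1k_norm[OF inL k, of \<tau>] N(2)[OF \<tau>] \<tau> by auto
      have ci: "integrable lborel (conv K (u \<tau>))" using \<tau> by (intro conv_integrable K ui) auto
      have "(\<integral>x. \<bar>w \<tau> x\<bar> \<partial>lborel) \<le> (\<integral>x. \<bar>conv K (u \<tau>) x\<bar> + \<bar>u \<tau> x\<bar> \<partial>lborel)"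
        using \<tau> by (intro integral_mono_AE' Bochner_Integration.integrable_add integrable_abs ci ui)
          (auto simp: w_def abs_triangle_ineq4)
      also have "\<dots> = (\<integral>x. \<bar>conv K (u \<tau>) x\<bar> \<partial>lborel) + (\<integral>x. \<bar>u \<tau> x\<bar> \<partial>lborel)"
        using \<tau> by (intro Bochner_Integration.integral_add integrable_abs ci ui) auto
      also have "\<dots> \<le> (\<integral>x. \<bar>K x\<bar> \<partial>lborel) * (\<integral>x. \<bar>u \<tau> x\<bar> \<partial>lborel) + (\<integral>x. \<bar>u \<tau> x\<bar> \<partial>lborel)"
        using \<tau> by (intro add_right_mono conv_integrable K ui) auto
      also have "\<dots> = ((\<integral>x. \<bar>K x\<bar> \<partial>lborel) + 1) * (\<integral>x. \<bar>u \<tau> x\<bar> \<partial>lborel)"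
        by (simp add: distrib_right)
      also have "\<dots> \<le> ((\<integral>x. \<bar>K x\<bar> \<partial>lborel) + 1) * N"
        by (intro mult_left_mono un add_nonneg_nonneg integral_nonneg_AE) auto
      finally show ?thesis .
    qed
    have Gm: "(\<lambda>(\<tau>, x). G \<tau> x) \<in> borel_measurable (lborel \<Otimes>\<^sub>M lborel)"
      unfolding G_def w_def conv_def by measurable
    have int: "integrable (lborel \<Otimes>\<^sub>M lborel) (\<lambda>(\<tau>, x). G \<tau> x)"
    proof (rule lborel_pair.Fubini_integrable[OF Gm])
      let ?C = "\<bar>a\<bar> * (((\<integral>x. \<bar>K x\<bar> \<partial>lborel) + 1) * N)"
      have le: "(\<integral>x. \<bar>G \<tau> x\<bar> \<partial>lborel) \<le> indicator {0..t} \<tau> * ?C" for \<tau>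
      proof (cases "\<tau> \<in> {0..t}")
        case True
        have "(\<integral>x. \<bar>G \<tau> x\<bar> \<partial>lborel) = \<bar>a\<bar> * (\<integral>x. exp (?D * (t - \<tau>)) * \<bar>w \<tau> (exp (t - \<tau>) *\<^sub>R x)\<bar> \<partial>lborel)"
          using True by (simp add: G_def abs_mult)
        also have "(\<integral>x. exp (?D * (t - \<tau>)) * \<bar>w \<tau> (exp (t - \<tau>) *\<^sub>R x)\<bar> \<partial>lborel) = (\<integral>x. \<bar>w \<tau> x\<bar> \<partial>lborel)"
          using dilate_integral[OF integrable_abs[OF wi[OF True]], of "t - \<tau>"] by simp
        finally show ?thesis using w_le[OF True] True by (auto intro!: mult_left_mono)
      qed (simp add: G_def)
      have "integrable lborel (\<lambda>\<tau>. indicator {0..t} \<tau> * ?C)"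
        by (intro integrable_mult_left integrable_real_indicator) (auto simp: emeasure_lborel_Icc_eq)
      then show "integrable lborel (\<lambda>\<tau>. \<integral>x. norm (case (\<tau>, x) of (\<tau>, x) \<Rightarrow> G \<tau> x) \<partial>lborel)"
      proof (rule Bochner_Integration.integrable_bound)
        show "(\<lambda>\<tau>. \<integral>x. norm (case (\<tau>, x) of (\<tau>, x) \<Rightarrow> G \<tau> x) \<partial>lborel) \<in> borel_measurable lborel"
          using Gm by measurable
        have nn: "0 \<le> (\<integral>x. \<bar>G \<tau> x\<bar> \<partial>lborel)" for \<tau> by (intro integral_nonneg_AE) auto
        show "AE \<tau> in lborel. norm (\<integral>x. norm (case (\<tau>, x) of (\<tau>, x) \<Rightarrow> G \<tau> x) \<partial>lborel) \<le> norm (indicator {0..t} \<tau> * ?C)"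
          using order_trans[OF le abs_ge_self] nn by (intro AE_I2) (simp add: abs_of_nonneg)
      qed
      have "integrable lborel (G \<tau>)" for \<tau>
      proof (cases "\<tau> \<in> {0..t}")
        case True
        have "integrable lborel (\<lambda>x. a * (exp (?D * (t - \<tau>)) * w \<tau> (exp (t - \<tau>) *\<^sub>R x)))"
          by (intro integrable_mult_right[where c=a] dilate_integrable wi True)
        then show ?thesis using True by (simp add: G_def[abs_def])
      qed (simp add: G_def[abs_def])
      then show "AE \<tau> in lborel. integrable lborel (\<lambda>x. case (\<tau>, x) of (\<tau>, x) \<Rightarrow> G \<tau> x)" by simp
    qed
    have AE: "AE x in lborel. u t x = exp (?D * t) * u0 (exp t *\<^sub>R x) + (\<integral>\<tau>. G \<tau> x \<partial>lborel)"
    proof -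
      have "AE x in lborel. u t x = exp (?D * t) * u0 (exp t *\<^sub>R x)
          + (\<integral>\<tau>\<in>{0..t}. exp (?D * (t - \<tau>)) * a *
               (conv K (u \<tau>) (exp (t - \<tau>) *\<^sub>R x) - u \<tau> (exp (t - \<tau>) *\<^sub>R x)) \<partial>lborel)"
        using m t unfolding mild_solution_def by blast
      moreover have "(\<integral>\<tau>\<in>{0..t}. exp (?D * (t - \<tau>)) * a *
               (conv K (u \<tau>) (exp (t - \<tau>) *\<^sub>R x) - u \<tau> (exp (t - \<tau>) *\<^sub>R x)) \<partial>lborel) = (\<integral>\<tau>. G \<tau> x \<partial>lborel)" for x
        unfolding set_lebesgue_integral_def G_def w_def
        by (intro Bochner_Integration.integral_cong) (auto simp: mult_ac)
      ultimately show ?thesis by simp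
    qed
    have Gi: "integrable lborel (\<lambda>x. \<integral>\<tau>. G \<tau> x \<partial>lborel)"
      by (rule lborel_pair.integrable_snd[OF int])
    have di: "integrable lborel (\<lambda>x. exp (?D * t) * u0 (exp t *\<^sub>R x))" by (rule dilate_integrable[OF u0])
    have "fourier (u t) \<xi> = fourier (\<lambda>x. exp (?D * t) * u0 (exp t *\<^sub>R x) + (\<integral>\<tau>. G \<tau> x \<partial>lborel)) \<xi>"
      unfolding fourier_def
    proof (rule integral_cong_AE)
      show "AE x in lborel. cis (- (x \<bullet> \<xi>)) * complex_of_real (u t x) =
        cis (- (x \<bullet> \<xi>)) * complex_of_real (exp (?D * t) * u0 (exp t *\<^sub>R x) + (\<integral>\<tau>. G \<tau> x \<partial>lborel))"
        using AE by eventually_elim simp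
    qed (use ui[OF t] Gi di in measurable)
    also have "\<dots> = fourier (\<lambda>x. exp (?D * t) * u0 (exp t *\<^sub>R x)) \<xi> + fourier (\<lambda>x. \<integral>\<tau>. G \<tau> x \<partial>lborel) \<xi>"
      unfolding fourier_def of_real_add distrib_left
      by (intro Bochner_Integration.integral_add fourier_integrand_integrable di Gi)
    also have "fourier (\<lambda>x. exp (?D * t) * u0 (exp t *\<^sub>R x)) \<xi> = fourier u0 (exp (- t) *\<^sub>R \<xi>)"
      by (rule fourier_dilate[OF u0])
    also have "fourier (\<lambda>x. \<integral>\<tau>. G \<tau> x \<partial>lborel) \<xi>
      = (\<integral>x. \<integral>\<tau>. cis (- (x \<bullet> \<xi>)) * complex_of_real (G \<tau> x) \<partial>lborel \<partial>lborel)"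
      unfolding fourier_def by (simp only: integral_complex_of_real[symmetric] integral_mult_right_zero)
    also have "\<dots> = (\<integral>\<tau>. \<integral>x. cis (- (x \<bullet> \<xi>)) * complex_of_real (G \<tau> x) \<partial>lborel \<partial>lborel)"
      by (rule lborel_pair.Fubini_integral, rule Bochner_Integration.integrable_bound[OF int])
         (use Gm in \<open>auto simp: norm_mult\<close>)
    also have "\<dots> = (\<integral>\<tau>\<in>{0..t}. complex_of_real a * (fourier K (exp (\<tau> - t) *\<^sub>R \<xi>) - 1) * fourier (u \<tau>) (exp (\<tau> - t) *\<^sub>R \<xi>) \<partial>lborel)"
      unfolding set_lebesgue_integral_def
    proof (intro Bochner_Integration.integral_cong refl)
      fix \<tau>
      show "(\<integral>x. cis (- (x \<bullet> \<xi>)) * complex_of_real (G \<tau> x) \<partial>lborel) =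
         indicator {0..t} \<tau> *\<^sub>R (complex_of_real a * (fourier K (exp (\<tau> - t) *\<^sub>R \<xi>) - 1) * fourier (u \<tau>) (exp (\<tau> - t) *\<^sub>R \<xi>))"
      proof (cases "\<tau> \<in> {0..t}")
        case True
        then have \<tau>: "0 \<le> \<tau>" by auto
        have "(\<integral>x. cis (- (x \<bullet> \<xi>)) * complex_of_real (G \<tau> x) \<partial>lborel)
          = (\<integral>x. complex_of_real a * (cis (- (x \<bullet> \<xi>)) * complex_of_real (exp (?D * (t - \<tau>)) * w \<tau> (exp (t - \<tau>) *\<^sub>R x))) \<partial>lborel)"
          using True by (intro Bochner_Integration.integral_cong) (auto simp: G_def mult_ac)
        also have "\<dots> = complex_of_real a * fourier (\<lambda>x. exp (?D * (t - \<tau>)) * w \<tau> (exp (t - \<tau>) *\<^sub>R x)) \<xi>"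
          by (simp only: integral_mult_right_zero fourier_def)
        also have "\<dots> = complex_of_real a * fourier (w \<tau>) (exp (\<tau> - t) *\<^sub>R \<xi>)"
          by (subst fourier_dilate[OF wi[OF True]]) simp
        also have "fourier (w \<tau>) (exp (\<tau> - t) *\<^sub>R \<xi>) = (fourier K (exp (\<tau> - t) *\<^sub>R \<xi>) - 1) * fourier (u \<tau>) (exp (\<tau> - t) *\<^sub>R \<xi>)"
          unfolding w_def[abs_def] by (simp add: fourier_diff conv_integrable K ui \<tau> fourier_conv left_diff_distrib)
        finally show ?thesis using True by (simp add: mult.assoc)
      qed (simp add: G_def)
    qed
    finally show ?thesis .
  qed
  \<comment> \<open>The starting point of the orbit that arrives at \<xi> at time
    \<open>T\<close>.\<close>
  define \<xi>0 where "\<xi>0 = exp (- T) *\<^sub>R \<xi>"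
  define y where "y \<tau> = fourier (u \<tau>) (exp \<tau> *\<^sub>R \<xi>0)" for \<tau>
  define g where "g \<tau> = complex_of_real a * (fourier K (exp \<tau> *\<^sub>R \<xi>0) - 1)" for \<tau>
  have g: "continuous_on {0..} g"
    unfolding g_def[abs_def]
    by (intro continuous_intros continuous_on_compose2[OF fourier_continuous[OF K, of UNIV]]) auto
  have y: "continuous_on {0..} y"
    unfolding continuous_on_def
  proof
    fix t0 :: real assume t0: "t0 \<in> {0..}"
    have lim: "((\<lambda>t. L1k_norm k (\<lambda>x. u t x - u t0 x)) \<longlongrightarrow> 0) (at t0 within {0..})"
      using m t0 by (auto simp: mild_solution_def)
    \<comment> \<open>Continuity of \<open>y\<close> has two sources. Here only the solution varies,
      and the change is bounded by the L^1_k norm at whatever frequency; below, the solution is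
      frozen at \<open>t0\<close> and the frequency moves.\<close>
    have 1: "((\<lambda>t. fourier (u t) (exp t *\<^sub>R \<xi>0) - fourier (u t0) (exp t *\<^sub>R \<xi>0)) \<longlongrightarrow> 0) (at t0 within {0..})"
    proof (rule Lim_null_comparison[OF _ lim])
      have "norm (fourier (u t) (exp t *\<^sub>R \<xi>0) - fourier (u t0) (exp t *\<^sub>R \<xi>0)) \<le> L1k_norm k (\<lambda>x. u t x - u t0 x)"
        if t: "0 \<le> t" for t
      proof -
        have d: "in_L1k k (\<lambda>x. u t x - u t0 x)" using inL t t0 by (intro in_L1k_diff) auto
        have "fourier (u t) (exp t *\<^sub>R \<xi>0) - fourier (u t0) (exp t *\<^sub>R \<xi>0) = fourier (\<lambda>x. u t x - u t0 x) (exp t *\<^sub>R \<xi>0)"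
          using t t0 by (subst fourier_diff) (auto intro: ui)
        also have "norm \<dots> \<le> (\<integral>x. \<bar>u t x - u t0 x\<bar> \<partial>lborel)"
          by (rule norm_fourier_le[OF in_L1k_integrable[OF d k]])
        also have "\<dots> \<le> L1k_norm k (\<lambda>x. u t x - u t0 x)"
          by (rule integral_abs_le_L1k_norm[OF d k])
        finally show ?thesis .
      qed
      then show "\<forall>\<^sub>F t in at t0 within {0..}. norm (fourier (u t) (exp t *\<^sub>R \<xi>0) - fourier (u t0) (exp t *\<^sub>R \<xi>0)) \<le> L1k_norm k (\<lambda>x. u t x - u t0 x)"
        by (auto simp: eventually_at_filter intro!: always_eventually)
    qed
    have "continuous_on {0..} (\<lambda>t. fourier (u t0) (exp t *\<^sub>R \<xi>0))"
      using t0 by (intro continuous_intros continuous_on_compose2[OF fourier_continuous[OF ui, of _ UNIV]]) auto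
    then have 2: "((\<lambda>t. fourier (u t0) (exp t *\<^sub>R \<xi>0)) \<longlongrightarrow> fourier (u t0) (exp t0 *\<^sub>R \<xi>0)) (at t0 within {0..})"
      using t0 by (auto simp: continuous_on_def)
    from tendsto_add[OF 1 2] show "(y \<longlongrightarrow> y t0) (at t0 within {0..})"
      unfolding y_def[abs_def] by simp
  qed
  have gy: "continuous_on {0..t} (\<lambda>\<tau>. g \<tau> * y \<tau>)" for t
    by (intro continuous_on_mult continuous_on_subset[OF g] continuous_on_subset[OF y]) auto
  have "y T = fourier u0 \<xi>0 * exp (integral {0..T} g)"
  proof (rule linear_volterra[OF y g _ T])
    fix t :: real assume t: "0 \<le> t"
    have e: "exp (\<tau> - t) *\<^sub>R exp t *\<^sub>R \<xi>0 = exp \<tau> *\<^sub>R \<xi>0" for \<tau>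
      by (simp add: exp_add[symmetric])
    have "y t = fourier u0 \<xi>0 + (\<integral>\<tau>\<in>{0..t}. g \<tau> * y \<tau> \<partial>lborel)"
      unfolding y_def duhamel[OF t] e by (simp add: g_def mult_ac exp_minus)
    also have "(\<integral>\<tau>\<in>{0..t}. g \<tau> * y \<tau> \<partial>lborel) = integral {0..t} (\<lambda>\<tau>. g \<tau> * y \<tau>)"
      by (intro set_borel_integral_eq_integral borel_integrable_atLeastAtMost' gy)
    finally show "y t = fourier u0 \<xi>0 + integral {0..t} (\<lambda>\<tau>. g \<tau> * y \<tau>)" .
  qed
  \<comment> \<open>Reversing time, \<tau> to T - \<tau>, turns the orbit that leaves
    \<open>\<xi>0\<close> into the contracting orbit of \<xi>.\<close>
  moreover have "integral {0..T} g = - exponent K a T \<xi>"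
  proof -
    have "integral {0..T} g = (\<integral>\<tau>\<in>{0..T}. g \<tau> \<partial>lborel)"
      by (intro set_borel_integral_eq_integral(2)[symmetric] borel_integrable_atLeastAtMost' continuous_on_subset[OF g]) auto
    also have "\<dots> = (\<integral>\<tau>. indicator {0..T} (T + (- 1) * \<tau>) *\<^sub>R g (T + (- 1) * \<tau>) \<partial>lborel)"
      unfolding set_lebesgue_integral_def
      by (subst lborel_integral_real_affine[where c="-1" and t=T]) auto
    also have "\<dots> = (\<integral>\<tau>. - (indicator {0..T} \<tau> *\<^sub>R (complex_of_real a * (1 - fourier K (exp (- \<tau>) *\<^sub>R \<xi>)))) \<partial>lborel)"
    proof (intro Bochner_Integration.integral_cong refl)
      fix \<tau> :: real
      have "exp (T - \<tau>) *\<^sub>R \<xi>0 = exp (- \<tau>) *\<^sub>R \<xi>" by (simp add: \<xi>0_def exp_add[symmetric])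
      then show "indicator {0..T} (T + (- 1) * \<tau>) *\<^sub>R g (T + (- 1) * \<tau>)
        = - (indicator {0..T} \<tau> *\<^sub>R (complex_of_real a * (1 - fourier K (exp (- \<tau>) *\<^sub>R \<xi>))))"
        by (auto simp: g_def indicator_def algebra_simps)
    qed
    also have "\<dots> = - exponent K a T \<xi>"
      unfolding exponent_def set_lebesgue_integral_def by simp
    finally show ?thesis .
  qed
  ultimately show ?thesis
    by (simp add: y_def \<xi>0_def exp_add[symmetric])
qed

section \<open>Compound Poisson laws\<close>

text \<open>The sign convention is that of \<open>fourier\<close>, so that a law with a density has
  the transform of its density.\<close>

definition charf :: "'a::euclidean_space measure \<Rightarrow> 'a \<Rightarrow> complex" where
  "charf M \<xi> = (\<integral>x. cis (- (x \<bullet> \<xi>)) \<partial>M)"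

lemma (in prob_space) cis_integrable:
  "f \<in> borel_measurable M \<Longrightarrow> integrable M (\<lambda>x. cis (f x))"
  by (rule integrable_const_bound[of _ 1]) auto

lemma norm_charf_le_1:
  assumes "prob_space M" "sets M = sets borel" shows "cmod (charf M \<xi>) \<le> 1"
proof -
  interpret prob_space M by fact
  note [measurable_cong] = assms(2)
  have "cmod (charf M \<xi>) \<le> (\<integral>x. cmod (cis (- (x \<bullet> \<xi>))) \<partial>M)"
    unfolding charf_def by (rule integral_norm_bound)
  then show ?thesis by (simp add: prob_space)
qed

text \<open>The n-fold convolution power: the law of a sum of n independent jumps.\<close>

primrec cpow :: "'a::euclidean_space measure \<Rightarrow> nat \<Rightarrow> 'a measure" where
  "cpow M 0 = return borel 0"
| "cpow M (Suc n) = distr (cpow M n \<Otimes>\<^sub>M M) borel (\<lambda>(x, y). x + y)"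

lemma sets_cpow [simp, measurable_cong]: "sets (cpow M n) = sets borel"
  by (cases n) auto

lemma prob_space_cpow:
  assumes "prob_space M" and s [measurable_cong]: "sets M = sets borel"
  shows "prob_space (cpow M n)"
proof (induction n)
  case 0
  show ?case by (simp add: prob_space_return)
next
  case (Suc n)
  have "prob_space (cpow M n \<Otimes>\<^sub>M M)" by (rule prob_space_pair[OF Suc assms(1)])
  then show ?case by (simp, intro prob_space.prob_space_distr) (auto simp: case_prod_unfold)
qed

lemma charf_cpow:
  assumes M: "prob_space M" and s [measurable_cong]: "sets M = sets borel"
  shows "charf (cpow M n) \<xi> = charf M \<xi> ^ n"
proof (induction n)
  case 0
  show ?case by (simp add: charf_def integral_return)
next
  case (Suc n)
  interpret M: prob_space M by fact
  interpret C: prob_space "cpow M n" by (rule prob_space_cpow[OF M s])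
  interpret P: pair_prob_space "cpow M n" M ..
  have "charf (cpow M (Suc n)) \<xi> = (\<integral>p. cis (- ((fst p + snd p) \<bullet> \<xi>)) \<partial>(cpow M n \<Otimes>\<^sub>M M))"
    unfolding charf_def cpow.simps by (subst integral_distr) (auto simp: case_prod_unfold)
  also have "\<dots> = (\<integral>x. (\<integral>y. cis (- ((x + y) \<bullet> \<xi>)) \<partial>M) \<partial>cpow M n)"
    by (subst P.integral_fst'[symmetric]) (auto intro!: P.cis_integrable)
  also have "\<dots> = (\<integral>x. (\<integral>y. cis (- (x \<bullet> \<xi>)) * cis (- (y \<bullet> \<xi>)) \<partial>M) \<partial>cpow M n)"
    by (simp add: cis_mult inner_add_left)
  also have "\<dots> = charf (cpow M n) \<xi> * charf M \<xi>"
    by (simp add: charf_def)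
  finally show ?case by (simp add: Suc)
qed

definition compound_poisson :: "real \<Rightarrow> 'a::euclidean_space measure \<Rightarrow> 'a measure" where
  "compound_poisson r M = measure_pmf (poisson_pmf r) \<bind> cpow M"

lemma compound_poisson_kernel:
  assumes "prob_space M" "sets M = sets borel"
  shows "cpow M \<in> measure_pmf (poisson_pmf r) \<rightarrow>\<^sub>M prob_algebra borel"
    and "cpow M \<in> measure_pmf (poisson_pmf r) \<rightarrow>\<^sub>M subprob_algebra borel"
proof -
  show "cpow M \<in> measure_pmf (poisson_pmf r) \<rightarrow>\<^sub>M prob_algebra borel"
    using prob_space_cpow[OF assms] by (auto simp: space_prob_algebra)
  then show "cpow M \<in> measure_pmf (poisson_pmf r) \<rightarrow>\<^sub>M subprob_algebra borel"
    by (rule measurable_prob_algebraD)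
qed

lemma prob_space_compound_poisson:
  assumes "prob_space M" "sets M = sets borel"
  shows "prob_space (compound_poisson r M)" "sets (compound_poisson r M) = sets borel"
proof -
  have "measure_pmf (poisson_pmf r) \<in> space (prob_algebra (measure_pmf (poisson_pmf r)))"
    by (simp add: space_prob_algebra measure_pmf.prob_space_axioms)
  from prob_space_bind'[OF this compound_poisson_kernel(1)[OF assms]]
  show "prob_space (compound_poisson r M)" by (simp add: compound_poisson_def)
  show "sets (compound_poisson r M) = sets borel"
    unfolding compound_poisson_def by (subst sets_bind) auto
qed

lemma integral_compound_poisson:
  fixes f :: "'a::euclidean_space \<Rightarrow> real"
  assumes M: "prob_space M" "sets M = sets borel" and [measurable]: "f \<in> borel_measurable borel" and B: "\<And>x. \<bar>f x\<bar> \<le> B"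
  shows "integral\<^sup>L (compound_poisson r M) f = (\<integral>n. integral\<^sup>L (cpow M n) f \<partial>poisson_pmf r)"
proof -
  note K = compound_poisson_kernel(2)[OF M, of r]
  have ne: "space (measure_pmf (poisson_pmf r)) \<noteq> {}" by simp
  have "integral\<^sup>L (compound_poisson r M) f = integral\<^sup>L (join (distr (poisson_pmf r) (subprob_algebra borel) (cpow M))) f"
    unfolding compound_poisson_def by (subst bind_nonempty''[OF K ne]) simp
  also have "\<dots> = (\<integral>M'. integral\<^sup>L M' f \<partial>distr (poisson_pmf r) (subprob_algebra borel) (cpow M))"
  proof (rule integral_join[where N=borel and B=B and B'=1])
    show "finite_measure (distr (measure_pmf (poisson_pmf r)) (subprob_algebra borel) (cpow M))"
      by (intro finite_measure.finite_measure_distr K measure_pmf.finite_measure_axioms)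
    show "AE M' in distr (measure_pmf (poisson_pmf r)) (subprob_algebra borel) (cpow M). emeasure M' (space M') \<le> ennreal 1"
      by (subst AE_distr_iff[OF K]) (auto intro!: AE_I2 simp: prob_space.emeasure_space_1[OF prob_space_cpow[OF M]])
  qed (auto simp: B)
  also have "\<dots> = (\<integral>n. integral\<^sup>L (cpow M n) f \<partial>poisson_pmf r)"
    by (rule integral_distr[OF K]) simp
  finally show ?thesis .
qed

text \<open>Conditioning on the number of jumps yields the generating function of the Poisson law at
  the point \<open>charf M \<xi>\<close>, which lies in the closed unit disc.\<close>

lemma charf_compound_poisson:
  assumes M: "prob_space M" "sets M = sets borel" and r: "0 < r"
  shows "charf (compound_poisson r M) \<xi> = exp (complex_of_real r * (charf M \<xi> - 1))"
proof -
  note [measurable_cong] = prob_space_compound_poisson(2)[OF M]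
  interpret C: prob_space "compound_poisson r M" by (rule prob_space_compound_poisson[OF M])
  have P: "prob_space (cpow M n)" for n by (rule prob_space_cpow[OF M])
  let ?z = "charf M \<xi>"
  have i: "integrable (cpow M n) (\<lambda>x. cis (- (x \<bullet> \<xi>)))" for n
    by (rule prob_space.cis_integrable[OF P]) simp
  have iC: "integrable (compound_poisson r M) (\<lambda>x. cis (- (x \<bullet> \<xi>)))"
    by (rule C.cis_integrable) simp
  have z1: "cmod (?z ^ n) \<le> 1" for n
    using norm_charf_le_1[OF M] by (simp add: norm_power power_le_one)
  have zi: "integrable (measure_pmf (poisson_pmf r)) (\<lambda>n. ?z ^ n)"
    by (rule measure_pmf.integrable_const_bound[where B=1]) (use z1 in auto)
  \<comment> \<open>\<open>integral_compound_poisson\<close> concerns real integrands, so real and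
    imaginary parts are treated one after the other.\<close>
  have "Re (charf (compound_poisson r M) \<xi>) = (\<integral>n. (\<integral>x. Re (cis (- (x \<bullet> \<xi>))) \<partial>cpow M n) \<partial>poisson_pmf r)"
    unfolding charf_def integral_Re[OF iC, symmetric]
    by (rule integral_compound_poisson[OF M, where B=1]) auto
  also have "\<dots> = (\<integral>n. Re (?z ^ n) \<partial>poisson_pmf r)"
    by (simp only: integral_Re[OF i] charf_def[symmetric] charf_cpow[OF M])
  also have "\<dots> = Re (\<integral>n. ?z ^ n \<partial>poisson_pmf r)" by (rule integral_Re[OF zi])
  finally have re: "Re (charf (compound_poisson r M) \<xi>) = Re (\<integral>n. ?z ^ n \<partial>poisson_pmf r)" .
  have "Im (charf (compound_poisson r M) \<xi>) = (\<integral>n. (\<integral>x. Im (cis (- (x \<bullet> \<xi>))) \<partial>cpow M n) \<partial>poisson_pmf r)"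
    unfolding charf_def integral_Im[OF iC, symmetric]
    by (rule integral_compound_poisson[OF M, where B=1]) auto
  also have "\<dots> = (\<integral>n. Im (?z ^ n) \<partial>poisson_pmf r)"
    by (simp only: integral_Im[OF i] charf_def[symmetric] charf_cpow[OF M])
  also have "\<dots> = Im (\<integral>n. ?z ^ n \<partial>poisson_pmf r)" by (rule integral_Im[OF zi])
  finally have im: "Im (charf (compound_poisson r M) \<xi>) = Im (\<integral>n. ?z ^ n \<partial>poisson_pmf r)" .
  have "charf (compound_poisson r M) \<xi> = (\<integral>n. ?z ^ n \<partial>poisson_pmf r)"
    using re im by (rule complex_eqI)
  also have "\<dots> = (\<integral>n. pmf (poisson_pmf r) n *\<^sub>R ?z ^ n \<partial>count_space UNIV)"
    unfolding measure_pmf_eq_density by (subst integral_density) auto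
  also have "\<dots> = exp (complex_of_real r * (?z - 1))"
  proof -
    have "integrable (count_space UNIV) (\<lambda>n. pmf (poisson_pmf r) n *\<^sub>R ?z ^ n)"
      using zi unfolding measure_pmf_eq_density by (subst (asm) integrable_density) auto
    then have 1: "(\<lambda>n. pmf (poisson_pmf r) n *\<^sub>R ?z ^ n) sums (\<integral>n. pmf (poisson_pmf r) n *\<^sub>R ?z ^ n \<partial>count_space UNIV)"
      by (rule sums_integral_count_space_nat)
    have "(\<lambda>n. complex_of_real (exp (- r)) * ((complex_of_real r * ?z) ^ n /\<^sub>R fact n)) sums (complex_of_real (exp (- r)) * exp (complex_of_real r * ?z))"
      by (intro sums_mult exp_converges)
    also have "(\<lambda>n. complex_of_real (exp (- r)) * ((complex_of_real r * ?z) ^ n /\<^sub>R fact n)) = (\<lambda>n. pmf (poisson_pmf r) n *\<^sub>R ?z ^ n)"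
      using r by (auto simp: fun_eq_iff scaleR_conv_of_real power_mult_distrib field_simps)
    also have "complex_of_real (exp (- r)) * exp (complex_of_real r * ?z) = exp (complex_of_real r * (?z - 1))"
      by (simp add: exp_of_real[symmetric] exp_add[symmetric] algebra_simps)
    finally show ?thesis using 1 sums_unique2 by blast
  qed
  finally show ?thesis .
qed

text \<open>A jump with density \<open>K\<close> that takes place at a uniformly distributed time
  and is then contracted by the drift for the time \<tau> that remains.\<close>

definition jump_law :: "('a::euclidean_space \<Rightarrow> real) \<Rightarrow> real \<Rightarrow> 'a measure" where
  "jump_law K t = distr (density lborel (\<lambda>\<tau>. ennreal (indicator {0..t} \<tau> / t)) \<Otimes>\<^sub>M density lborel (\<lambda>x. ennreal (K x)))
     borel (\<lambda>(\<tau>, x). exp (- \<tau>) *\<^sub>R x)"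

lemma prob_space_prob_density:
  assumes "prob_density K" shows "prob_space (density lborel (\<lambda>x. ennreal (K x)))"
proof (rule prob_spaceI)
  have [measurable]: "K \<in> borel_measurable borel" using assms by (auto simp: prob_density_def)
  show "emeasure (density lborel (\<lambda>x. ennreal (K x))) (space (density lborel (\<lambda>x. ennreal (K x)))) = 1"
    using assms by (simp add: emeasure_density prob_density_def nn_integral_eq_integral)
qed

lemma prob_space_uniform:
  fixes t :: real assumes "0 < t" shows "prob_space (density lborel (\<lambda>\<tau>. ennreal (indicator {0..t} \<tau> / t)))"
proof (rule prob_spaceI)
  have "(\<integral>\<^sup>+\<tau>. ennreal (indicator {0..t} \<tau> / t) \<partial>lborel) = (\<integral>\<^sup>+\<tau>. ennreal (1 / t) * indicator {0..t} \<tau> \<partial>lborel)"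
    by (intro nn_integral_cong) (auto simp: indicator_def)
  also have "\<dots> = ennreal (1 / t) * ennreal t"
    using assms by (subst nn_integral_cmult_indicator) (auto simp: emeasure_lborel_Icc_eq)
  also have "\<dots> = 1" using assms by (simp add: ennreal_mult'[symmetric])
  finally show "emeasure (density lborel (\<lambda>\<tau>. ennreal (indicator {0..t} \<tau> / t))) (space (density lborel (\<lambda>\<tau>. ennreal (indicator {0..t} \<tau> / t)))) = 1"
    by (simp add: emeasure_density)
qed

lemma jump_law:
  assumes K: "prob_density K" and t: "0 < t"
  shows "prob_space (jump_law K t)" "sets (jump_law K t) = sets borel"
    and "complex_of_real t * charf (jump_law K t) \<xi> = (\<integral>\<tau>\<in>{0..t}. fourier K (exp (- \<tau>) *\<^sub>R \<xi>) \<partial>lborel)"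
proof -
  have [measurable]: "K \<in> borel_measurable borel" using assms by (auto simp: prob_density_def)
  let ?U = "density lborel (\<lambda>\<tau>. ennreal (indicator {0..t} \<tau> / t))"
  let ?K = "density lborel (\<lambda>x. ennreal (K x))"
  interpret U: prob_space ?U by (rule prob_space_uniform[OF t])
  interpret K: prob_space ?K by (rule prob_space_prob_density[OF K])
  interpret P: pair_prob_space ?U ?K ..
  show "prob_space (jump_law K t)" unfolding jump_law_def by (rule P.prob_space_distr) measurable
  show "sets (jump_law K t) = sets borel" by (simp add: jump_law_def)
  have "charf (jump_law K t) \<xi> = (\<integral>p. cis (- ((exp (- fst p) *\<^sub>R snd p) \<bullet> \<xi>)) \<partial>(?U \<Otimes>\<^sub>M ?K))"
    unfolding charf_def jump_law_def by (subst integral_distr) (auto simp: case_prod_unfold)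
  also have "\<dots> = (\<integral>\<tau>. (\<integral>x. cis (- ((exp (- \<tau>) *\<^sub>R x) \<bullet> \<xi>)) \<partial>?K) \<partial>?U)"
    by (subst P.integral_fst'[symmetric]) (auto intro!: P.cis_integrable)
  also have "\<dots> = (\<integral>\<tau>. fourier K (exp (- \<tau>) *\<^sub>R \<xi>) \<partial>?U)"
  proof (intro Bochner_Integration.integral_cong refl)
    fix \<tau>
    show "(\<integral>x. cis (- ((exp (- \<tau>) *\<^sub>R x) \<bullet> \<xi>)) \<partial>?K) = fourier K (exp (- \<tau>) *\<^sub>R \<xi>)"
      unfolding fourier_def using K
      by (subst integral_density) (auto simp: prob_density_def scaleR_conv_of_real mult.commute)
  qed
  also have "\<dots> = (\<integral>\<tau>. (indicator {0..t} \<tau> / t) *\<^sub>R fourier K (exp (- \<tau>) *\<^sub>R \<xi>) \<partial>lborel)"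
    using t by (intro integral_density) auto
  finally have e: "charf (jump_law K t) \<xi> = (\<integral>\<tau>. (indicator {0..t} \<tau> / t) *\<^sub>R fourier K (exp (- \<tau>) *\<^sub>R \<xi>) \<partial>lborel)" .
  show "complex_of_real t * charf (jump_law K t) \<xi> = (\<integral>\<tau>\<in>{0..t}. fourier K (exp (- \<tau>) *\<^sub>R \<xi>) \<partial>lborel)"
    unfolding e set_lebesgue_integral_def integral_mult_right_zero[symmetric]
    using t by (intro Bochner_Integration.integral_cong) (auto simp: scaleR_conv_of_real)
qed

lemma fourier_dilated_set_integrable:
  assumes K: "integrable lborel K"
  shows "set_integrable lborel {0..t} (\<lambda>\<tau>. fourier K (exp (- \<tau>) *\<^sub>R \<xi>))"
  by (intro borel_integrable_atLeastAtMost' continuous_on_compose2[OF fourier_continuous[OF K, of UNIV]] continuous_intros) auto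

text \<open>The exponent equals \<open>a * t\<close> times one minus the characteristic function of
  the contracted jump, which is the form taken by a compound Poisson law with expected number of
  jumps \<open>a * t\<close>.\<close>

theorem exponent_charf:
  assumes K: "prob_density K" and a: "0 < a" and t: "0 < t"
  shows "\<exists>\<mu>. prob_space \<mu> \<and> sets \<mu> = sets borel \<and> (\<forall>\<xi>. charf \<mu> \<xi> = exp (- exponent K a t \<xi>))"
proof (intro exI conjI allI)
  note J = jump_law[OF K t]
  show "prob_space (compound_poisson (a * t) (jump_law K t))" "sets (compound_poisson (a * t) (jump_law K t)) = sets borel"
    by (rule prob_space_compound_poisson[OF J(1,2)])+
  fix \<xi>
  have i: "set_integrable lborel {0..t} (\<lambda>\<tau>. fourier K (exp (- \<tau>) *\<^sub>R \<xi>))"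
    using K by (intro fourier_dilated_set_integrable) (simp add: prob_density_def)
  have c: "set_integrable lborel {0..t} (\<lambda>\<tau>. 1 :: complex)" by (intro borel_integrable_atLeastAtMost') auto
  have "exponent K a t \<xi> = complex_of_real a * (\<integral>\<tau>\<in>{0..t}. 1 - fourier K (exp (- \<tau>) *\<^sub>R \<xi>) \<partial>lborel)"
    unfolding exponent_def by simp
  also have "(\<integral>\<tau>\<in>{0..t}. 1 - fourier K (exp (- \<tau>) *\<^sub>R \<xi>) \<partial>lborel) = (\<integral>\<tau>\<in>{0..t}. 1 \<partial>lborel) - (\<integral>\<tau>\<in>{0..t}. fourier K (exp (- \<tau>) *\<^sub>R \<xi>) \<partial>lborel)"
    by (rule set_integral_diff(2)[OF c i])
  also have "(\<integral>\<tau>\<in>{0..t}. 1 \<partial>lborel) = complex_of_real t"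
    using t by (simp add: set_lebesgue_integral_def scaleR_conv_of_real)
  finally have E: "exponent K a t \<xi> = complex_of_real a * (complex_of_real t - complex_of_real t * charf (jump_law K t) \<xi>)"
    unfolding J(3) .
  show "charf (compound_poisson (a * t) (jump_law K t)) \<xi> = exp (- exponent K a t \<xi>)"
    unfolding E using a t by (subst charf_compound_poisson[OF J(1,2)]) (auto simp: algebra_simps)
qed

section \<open>Evolution as a convolution, and fractional moments\<close>

text \<open>If \<open>f\<close> is the density of Z and Y is independent of Z with law \<mu>, this
  is the density of e^(-t) Z + Y. The law is kept as a measure because compound Poisson laws have an
  atom at the origin.\<close>

definition evolve :: "'a::euclidean_space measure \<Rightarrow> real \<Rightarrow> ('a \<Rightarrow> real) \<Rightarrow> 'a \<Rightarrow> real" where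
  "evolve \<mu> t f x = (\<integral>y. exp (real DIM('a) * t) * f (exp t *\<^sub>R (x - y)) \<partial>\<mu>)"

lemma pair_sigma_finite_prob_lborel:
  assumes "prob_space \<mu>" shows "pair_sigma_finite \<mu> lborel"
proof -
  interpret prob_space \<mu> by fact
  show ?thesis by unfold_locales
qed

lemma evolve_measurable:
  fixes f :: "'a::euclidean_space \<Rightarrow> real"
  assumes "prob_space \<mu>" and [measurable_cong]: "sets \<mu> = sets borel" and [measurable]: "f \<in> borel_measurable borel"
  shows "evolve \<mu> t f \<in> borel_measurable borel"
proof -
  interpret prob_space \<mu> by fact
  show ?thesis unfolding evolve_def[abs_def] by measurable
qed

text \<open>The substitution x = e^(-t) z + y undoes the dilation and the translation at
  once.\<close>

lemma nn_integral_evolve_kernel: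
  fixes f :: "'a::euclidean_space \<Rightarrow> real" and \<phi> :: "'a \<Rightarrow> ennreal"
  assumes [measurable]: "f \<in> borel_measurable borel" "\<phi> \<in> borel_measurable borel"
  shows "(\<integral>\<^sup>+x. \<phi> x * ennreal \<bar>exp (real DIM('a) * t) * f (exp t *\<^sub>R (x - y))\<bar> \<partial>lborel)
    = (\<integral>\<^sup>+z. \<phi> (exp (- t) *\<^sub>R z + y) * ennreal \<bar>f z\<bar> \<partial>lborel)"
proof -
  have "(\<integral>\<^sup>+x. \<phi> x * ennreal \<bar>exp (real DIM('a) * t) * f (exp t *\<^sub>R (x - y))\<bar> \<partial>lborel)
    = ennreal (\<bar>exp (- t)\<bar> ^ DIM('a)) * (\<integral>\<^sup>+z. \<phi> (y + exp (- t) *\<^sub>R z) *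
        ennreal \<bar>exp (real DIM('a) * t) * f (exp t *\<^sub>R (y + exp (- t) *\<^sub>R z - y))\<bar> \<partial>lborel)"
    by (rule nn_integral_affine) auto
  also have "\<dots> = (\<integral>\<^sup>+z. \<phi> (exp (- t) *\<^sub>R z + y) * ennreal \<bar>f z\<bar> \<partial>lborel)"
    unfolding nn_integral_cmult[symmetric, of _ lborel] 
  proof (subst nn_integral_cmult[symmetric], measurable, intro nn_integral_cong)
    fix z :: 'a
    have "exp t *\<^sub>R (y + exp (- t) *\<^sub>R z - y) = z" by (simp add: exp_add[symmetric])
    moreover have "ennreal (\<bar>exp (- t)\<bar> ^ DIM('a)) * ennreal \<bar>exp (real DIM('a) * t) * f z\<bar> = ennreal \<bar>f z\<bar>"
      by (simp add: ennreal_mult'[symmetric] abs_mult exp_of_DIM_mult power_mult_distrib[symmetric]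
          mult.assoc[symmetric] exp_add[symmetric])
    ultimately show "ennreal (\<bar>exp (- t)\<bar> ^ DIM('a)) * (\<phi> (y + exp (- t) *\<^sub>R z) *
        ennreal \<bar>exp (real DIM('a) * t) * f (exp t *\<^sub>R (y + exp (- t) *\<^sub>R z - y))\<bar>) = \<phi> (exp (- t) *\<^sub>R z + y) * ennreal \<bar>f z\<bar>"
      by (metis (no_types, opaque_lifting) add.commute mult.left_commute)
  qed
  finally show ?thesis .
qed

lemma nn_integral_evolve_le:
  fixes f :: "'a::euclidean_space \<Rightarrow> real" and \<phi> :: "'a \<Rightarrow> ennreal"
  assumes "prob_space \<mu>" and [measurable_cong]: "sets \<mu> = sets borel"
    and [measurable]: "f \<in> borel_measurable borel" "\<phi> \<in> borel_measurable borel"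
  shows "(\<integral>\<^sup>+x. \<phi> x * ennreal \<bar>evolve \<mu> t f x\<bar> \<partial>lborel)
    \<le> (\<integral>\<^sup>+y. \<integral>\<^sup>+z. \<phi> (exp (- t) *\<^sub>R z + y) * ennreal \<bar>f z\<bar> \<partial>lborel \<partial>\<mu>)"
proof -
  interpret pair_sigma_finite \<mu> lborel by (rule pair_sigma_finite_prob_lborel) fact
  have "(\<integral>\<^sup>+x. \<phi> x * ennreal \<bar>evolve \<mu> t f x\<bar> \<partial>lborel)
    \<le> (\<integral>\<^sup>+x. \<phi> x * (\<integral>\<^sup>+y. ennreal \<bar>exp (real DIM('a) * t) * f (exp t *\<^sub>R (x - y))\<bar> \<partial>\<mu>) \<partial>lborel)"
    unfolding evolve_def
    by (intro nn_integral_mono mult_left_mono ennreal_norm_integral_le[where 'b=real, unfolded real_norm_def]) simp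
  also have "\<dots> = (\<integral>\<^sup>+x. (\<integral>\<^sup>+y. \<phi> x * ennreal \<bar>exp (real DIM('a) * t) * f (exp t *\<^sub>R (x - y))\<bar> \<partial>\<mu>) \<partial>lborel)"
    by (intro nn_integral_cong nn_integral_cmult[symmetric]) measurable
  also have "\<dots> = (\<integral>\<^sup>+y. (\<integral>\<^sup>+x. \<phi> x * ennreal \<bar>exp (real DIM('a) * t) * f (exp t *\<^sub>R (x - y))\<bar> \<partial>lborel) \<partial>\<mu>)"
    by (rule Fubini') measurable
  finally show ?thesis
    by (simp only: nn_integral_evolve_kernel[OF assms(3,4)])
qed

lemma bracket_add_le: "bracket (x + y) \<le> 2 * bracket x * bracket y"
proof -
  have "(norm (x + y))\<^sup>2 \<le> (norm x + norm y)\<^sup>2" by (intro power_mono norm_triangle_ineq) simp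
  also have "\<dots> \<le> 2 * (norm x)\<^sup>2 + 2 * (norm y)\<^sup>2"
    using sum_squares_bound[of "norm x" "norm y"] by (simp add: power2_sum)
  finally have "1 + (norm (x + y))\<^sup>2 \<le> 4 * ((1 + (norm x)\<^sup>2) * (1 + (norm y)\<^sup>2))"
    by (simp add: algebra_simps) (smt (verit) mult_nonneg_nonneg zero_le_power2)
  then have "bracket (x + y) \<le> sqrt (4 * ((1 + (norm x)\<^sup>2) * (1 + (norm y)\<^sup>2)))"
    unfolding bracket_def by (rule real_sqrt_le_mono)
  then show ?thesis by (simp add: bracket_def real_sqrt_mult)
qed

lemma bracket_powr_add_le:
  assumes "0 \<le> k" shows "bracket (x + y) powr k \<le> 2 powr k * bracket x powr k * bracket y powr k"
proof -
  have "bracket (x + y) powr k \<le> (2 * bracket x * bracket y) powr k"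
    using bracket_pos[of "x + y"] by (intro powr_mono2 assms bracket_add_le) simp
  then show ?thesis
    using bracket_pos[of x] bracket_pos[of y] by (simp add: powr_mult)
qed

lemma bracket_contract_le: "0 \<le> t \<Longrightarrow> bracket (exp (- t) *\<^sub>R z) \<le> bracket z"
  unfolding bracket_def by (intro real_sqrt_le_mono add_left_mono power_mono) (auto simp: mult_left_le_one_le)

text \<open>The weight is submultiplicative up to the factor \<open>2 powr k\<close>, so the norm
  splits into a moment of \<mu> and a norm of the contracted datum. The latter is kept as it is,
  since for large t it is close to the plain L^1 norm of \<open>f\<close>, however large the L^1_k
  norm may be.\<close>

lemma evolve_in_L1k:
  fixes f :: "'a::euclidean_space \<Rightarrow> real"
  assumes \<mu>: "prob_space \<mu>" "sets \<mu> = sets borel" and f: "in_L1k k f" and k: "0 \<le> k" and t: "0 \<le> t"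
    and B: "(\<integral>\<^sup>+y. ennreal (bracket y powr k) \<partial>\<mu>) \<le> ennreal B" "0 \<le> B"
  shows "in_L1k k (evolve \<mu> t f)"
    and "L1k_norm k (evolve \<mu> t f) \<le> 2 powr k * B * (\<integral>z. bracket (exp (- t) *\<^sub>R z) powr k * \<bar>f z\<bar> \<partial>lborel)"
proof -
  note [measurable_cong] = \<mu>(2)
  have fk: "integrable lborel (\<lambda>x. bracket x powr k * \<bar>f x\<bar>)" and [measurable]: "f \<in> borel_measurable borel"
    using f by (auto simp: in_L1k_def)
  note [measurable] = evolve_measurable[OF \<mu>, of f t]
  let ?F = "\<integral>z. bracket (exp (- t) *\<^sub>R z) powr k * \<bar>f z\<bar> \<partial>lborel"
  have ft: "integrable lborel (\<lambda>z. bracket (exp (- t) *\<^sub>R z) powr k * \<bar>f z\<bar>)"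
  proof (rule Bochner_Integration.integrable_bound[OF fk])
    have "bracket (exp (- t) *\<^sub>R z) powr k \<le> bracket z powr k" for z :: 'a
      using bracket_pos[of "exp (- t) *\<^sub>R z"] by (intro powr_mono2 k bracket_contract_le t) simp
    then show "AE z in lborel. norm (bracket (exp (- t) *\<^sub>R z) powr k * \<bar>f z\<bar>) \<le> norm (bracket z powr k * \<bar>f z\<bar>)"
      by (intro AE_I2) (auto simp: abs_mult intro!: mult_right_mono)
  qed measurable
  have "(\<integral>\<^sup>+x. ennreal (bracket x powr k * \<bar>evolve \<mu> t f x\<bar>) \<partial>lborel) = (\<integral>\<^sup>+x. ennreal (bracket x powr k) * ennreal \<bar>evolve \<mu> t f x\<bar> \<partial>lborel)"
    by (simp add: ennreal_mult)
  also have "\<dots> \<le> (\<integral>\<^sup>+y. \<integral>\<^sup>+z. ennreal (bracket (exp (- t) *\<^sub>R z + y) powr k) * ennreal \<bar>f z\<bar> \<partial>lborel \<partial>\<mu>)"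
    by (rule nn_integral_evolve_le[OF \<mu>]) auto
  also have "\<dots> \<le> (\<integral>\<^sup>+y. \<integral>\<^sup>+z. ennreal (2 powr k * bracket y powr k) * ennreal (bracket (exp (- t) *\<^sub>R z) powr k * \<bar>f z\<bar>) \<partial>lborel \<partial>\<mu>)"
  proof (intro nn_integral_mono)
    fix y z :: 'a
    have "bracket (exp (- t) *\<^sub>R z + y) powr k * \<bar>f z\<bar> \<le> 2 powr k * bracket (exp (- t) *\<^sub>R z) powr k * bracket y powr k * \<bar>f z\<bar>"
      by (intro mult_right_mono bracket_powr_add_le k) simp
    then have "bracket (exp (- t) *\<^sub>R z + y) powr k * \<bar>f z\<bar> \<le> (2 powr k * bracket y powr k) * (bracket (exp (- t) *\<^sub>R z) powr k * \<bar>f z\<bar>)"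
      by (simp only: mult_ac)
    then show "ennreal (bracket (exp (- t) *\<^sub>R z + y) powr k) * ennreal \<bar>f z\<bar> \<le> ennreal (2 powr k * bracket y powr k) * ennreal (bracket (exp (- t) *\<^sub>R z) powr k * \<bar>f z\<bar>)"
      by (simp add: ennreal_mult[symmetric] ennreal_leI)
  qed
  also have "\<dots> = (\<integral>\<^sup>+y. ennreal (2 powr k) * ennreal (bracket y powr k) * ennreal ?F \<partial>\<mu>)"
  proof (rule nn_integral_cong)
    fix y :: 'a
    have h: "(\<integral>\<^sup>+z. ennreal (bracket (exp (- t) *\<^sub>R z) powr k * \<bar>f z\<bar>) \<partial>lborel) = ennreal ?F"
      by (rule nn_integral_eq_integral[OF ft]) simp
    show "(\<integral>\<^sup>+z. ennreal (2 powr k * bracket y powr k) * ennreal (bracket (exp (- t) *\<^sub>R z) powr k * \<bar>f z\<bar>) \<partial>lborel)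
      = ennreal (2 powr k) * ennreal (bracket y powr k) * ennreal ?F"
      by (subst nn_integral_cmult, measurable, subst h) (simp add: ennreal_mult)
  qed
  also have "\<dots> = ennreal (2 powr k) * (\<integral>\<^sup>+y. ennreal (bracket y powr k) \<partial>\<mu>) * ennreal ?F"
    by (simp add: nn_integral_cmult nn_integral_multc)
  also have "\<dots> \<le> ennreal (2 powr k) * ennreal B * ennreal ?F"
    by (intro mult_left_mono mult_right_mono B) auto
  also have "\<dots> = ennreal (2 powr k * B * ?F)"
    using B by (simp add: ennreal_mult'[symmetric])
  finally have le: "(\<integral>\<^sup>+x. ennreal (bracket x powr k * \<bar>evolve \<mu> t f x\<bar>) \<partial>lborel) \<le> ennreal (2 powr k * B * ?F)" .
  then have i: "integrable lborel (\<lambda>x. bracket x powr k * \<bar>evolve \<mu> t f x\<bar>)"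
    by (intro integrableI_bounded) (auto simp: abs_mult order.strict_trans1 ennreal_less_top)
  then show "in_L1k k (evolve \<mu> t f)" by (simp add: in_L1k_def)
  have F0: "0 \<le> ?F" by (intro integral_nonneg_AE) auto
  show "L1k_norm k (evolve \<mu> t f) \<le> 2 powr k * B * ?F"
    using le unfolding L1k_norm_def
    by (subst (asm) nn_integral_eq_integral[OF i]) (use B F0 in \<open>auto simp: ennreal_le_iff\<close>)
qed

lemma evolve_integrable:
  fixes f :: "'a::euclidean_space \<Rightarrow> real"
  assumes \<mu>: "prob_space \<mu>" "sets \<mu> = sets borel" and f: "integrable lborel f" and t: "0 \<le> t"
  shows "integrable lborel (evolve \<mu> t f)"
proof -
  have "0 < bracket x" for x :: 'a by (rule bracket_pos)
  then have nz: "bracket x \<noteq> 0" for x :: 'a by (metis less_irrefl)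
  \<comment> \<open>For exponent 0 the weight is 1, and its integral against the probability \<mu>
    is 1.\<close>
  have "in_L1k 0 (evolve \<mu> t f)"
    by (rule evolve_in_L1k(1)[OF \<mu> _ _ t, where B=1])
       (use f nz in \<open>auto simp: in_L1k_def prob_space.emeasure_space_1[OF \<mu>(1)]\<close>)
  then show ?thesis by (rule in_L1k_integrable) simp
qed

lemma fourier_evolve:
  fixes f :: "'a::euclidean_space \<Rightarrow> real"
  assumes \<mu>: "prob_space \<mu>" and [measurable_cong]: "sets \<mu> = sets borel" and f: "integrable lborel f"
  shows "fourier (evolve \<mu> t f) \<xi> = fourier f (exp (- t) *\<^sub>R \<xi>) * charf \<mu> \<xi>"
proof -
  interpret M: prob_space \<mu> by fact
  interpret P: pair_sigma_finite \<mu> lborel by (rule pair_sigma_finite_prob_lborel) fact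
  have [measurable]: "f \<in> borel_measurable borel" using f by auto
  let ?g = "\<lambda>x. exp (real DIM('a) * t) * f (exp t *\<^sub>R x)"
  let ?F = "\<lambda>y x. cis (- (x \<bullet> \<xi>)) * complex_of_real (?g (x - y))"
  have gi: "integrable lborel ?g" by (rule dilate_integrable[OF f])
  have sh: "integrable lborel (\<lambda>x. ?g (x - y))" for y
    using integrable_affine[OF gi, of 1 "- y"] by simp
  have "(\<integral>x. \<bar>?g (x - y)\<bar> \<partial>lborel) = (\<integral>x. \<bar>?g x\<bar> \<partial>lborel)" for y
    by (subst (2) integral_affine[where c=1 and t="- y"]) auto
  then have n: "(\<integral>x. norm (?F y x) \<partial>lborel) = (\<integral>x. \<bar>?g x\<bar> \<partial>lborel)" for y
    by (simp only: norm_mult[of "cis _"] norm_cis mult_1_left norm_of_real)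
  have int: "integrable (\<mu> \<Otimes>\<^sub>M lborel) (case_prod ?F)"
  proof (rule P.Fubini_integrable)
    show "integrable \<mu> (\<lambda>y. \<integral>x. norm (case (y, x) of (y, x) \<Rightarrow> ?F y x) \<partial>lborel)"
      unfolding prod.case n by simp
    show "AE y in \<mu>. integrable lborel (\<lambda>x. case (y, x) of (y, x) \<Rightarrow> ?F y x)"
      unfolding prod.case by (intro AE_I2 fourier_integrand_integrable sh)
  qed measurable
  have "fourier (evolve \<mu> t f) \<xi> = (\<integral>x. \<integral>y. ?F y x \<partial>\<mu> \<partial>lborel)"
    unfolding fourier_def evolve_def integral_complex_of_real[symmetric] integral_mult_right_zero[symmetric] ..
  also have "\<dots> = (\<integral>y. \<integral>x. ?F y x \<partial>lborel \<partial>\<mu>)" by (rule P.Fubini_integral[OF int])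
  also have "\<dots> = (\<integral>y. fourier ?g \<xi> * cis (- (y \<bullet> \<xi>)) \<partial>\<mu>)"
  proof (intro Bochner_Integration.integral_cong refl)
    fix y
    have "(\<integral>x. ?F y x \<partial>lborel) = (\<integral>x. ?F y (y + 1 *\<^sub>R x) \<partial>lborel)"
      by (subst integral_affine[where c=1 and t=y]) auto
    also have "\<dots> = (\<integral>x. cis (- (x \<bullet> \<xi>)) * complex_of_real (?g x) * cis (- (y \<bullet> \<xi>)) \<partial>lborel)"
    proof (intro Bochner_Integration.integral_cong refl)
      fix x
      have "cis (- ((y + 1 *\<^sub>R x) \<bullet> \<xi>)) = cis (- (x \<bullet> \<xi>)) * cis (- (y \<bullet> \<xi>))"
        by (simp add: cis_mult inner_add_left algebra_simps)
      then show "?F y (y + 1 *\<^sub>R x) = cis (- (x \<bullet> \<xi>)) * complex_of_real (?g x) * cis (- (y \<bullet> \<xi>))"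
        by simp
    qed
    also have "\<dots> = fourier ?g \<xi> * cis (- (y \<bullet> \<xi>))"
      unfolding fourier_def by (rule integral_mult_left_zero)
    finally show "(\<integral>x. ?F y x \<partial>lborel) = fourier ?g \<xi> * cis (- (y \<bullet> \<xi>))" .
  qed
  also have "\<dots> = fourier ?g \<xi> * charf \<mu> \<xi>"
    unfolding charf_def by (rule integral_mult_right_zero)
  also have "fourier ?g \<xi> = fourier f (exp (- t) *\<^sub>R \<xi>)" by (rule fourier_dilate[OF f])
  finally show ?thesis .
qed

section \<open>Fractional moments from the behaviour of a characteristic function at 0\<close>

lemma one_minus_cos_pos: "0 < 1 - cos (1::real)"
  using cos_monotone_0_pi[of 0 1] pi_gt3 by simp

text \<open>By scaling, the integral on the right is a constant multiple of |z|^m. For a lower bound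
  it suffices to keep r between 1/|z| and 2/|z|, where r |z| lies in [1, 2] and the cosine is at
  most cos 1. The factor 1/4 is a lower bound for 2^(-1-m), valid as m < 1.\<close>

lemma powr_le_one_minus_cos_integral:
  fixes z m :: real
  assumes m: "0 < m" "m < 1"
  shows "ennreal ((1 - cos 1) / 4 * \<bar>z\<bar> powr m)
    \<le> (\<integral>\<^sup>+r. ennreal (indicator {0<..} r * ((1 - cos (r * z)) * r powr (- 1 - m))) \<partial>lborel)"
proof (cases "z = 0")
  case False
  let ?z = "\<bar>z\<bar>"
  have z: "0 < ?z" using False by simp
  have "ennreal ((1 - cos 1) / 4 * ?z powr m) \<le> ennreal ((1 - cos 1) * (2 / ?z) powr (- 1 - m) * (1 / ?z))"
  proof (rule ennreal_leI)
    have "(2 / ?z) powr (- 1 - m) = 2 powr (- 1 - m) * ?z powr (1 + m)"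
      using z powr_minus_divide[of ?z "1 + m"] by (simp add: powr_divide)
    then have "(2 / ?z) powr (- 1 - m) * (1 / ?z) = 2 powr (- 1 - m) * (?z powr (1 + m) * ?z powr (- 1))"
      using z by (simp only: powr_neg_one mult.assoc)
    also have "?z powr (1 + m) * ?z powr (- 1) = ?z powr m"
      by (simp only: powr_add[symmetric]) simp
    finally have e: "(2 / ?z) powr (- 1 - m) * (1 / ?z) = 2 powr (- 1 - m) * ?z powr m" .
    have "(2::real) powr (- 2) \<le> 2 powr (- 1 - m)" using m by (intro powr_mono) auto
    then have "1 / 4 \<le> (2::real) powr (- 1 - m)" by (simp add: powr_minus)
    then have "1 / 4 * ?z powr m \<le> 2 powr (- 1 - m) * ?z powr m" by (intro mult_right_mono) auto
    then have "(1 - cos 1) * (1 / 4 * ?z powr m) \<le> (1 - cos 1) * (2 powr (- 1 - m) * ?z powr m)"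
      using one_minus_cos_pos by (intro mult_left_mono) auto
    then show "(1 - cos 1) / 4 * ?z powr m \<le> (1 - cos 1) * (2 / ?z) powr (- 1 - m) * (1 / ?z)"
      unfolding mult.assoc e by simp
  qed
  also have "\<dots> = (\<integral>\<^sup>+r. ennreal ((1 - cos 1) * (2 / ?z) powr (- 1 - m)) * indicator {1 / ?z..2 / ?z} r \<partial>lborel)"
    using z one_minus_cos_pos
    by (subst nn_integral_cmult_indicator) (auto simp: emeasure_lborel_Icc_eq divide_right_mono ennreal_mult'[symmetric] diff_divide_distrib[symmetric])
  also have "\<dots> \<le> (\<integral>\<^sup>+r. ennreal (indicator {0<..} r * ((1 - cos (r * z)) * r powr (- 1 - m))) \<partial>lborel)"
  proof (rule nn_integral_mono)
    fix r :: real
    show "ennreal ((1 - cos 1) * (2 / ?z) powr (- 1 - m)) * indicator {1 / ?z..2 / ?z} r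
       \<le> ennreal (indicator {0<..} r * ((1 - cos (r * z)) * r powr (- 1 - m)))"
    proof (cases "r \<in> {1 / ?z..2 / ?z}")
      case True
      then have r: "1 / ?z \<le> r" "r \<le> 2 / ?z" by auto
      have r0: "0 < r" using r(1) z by (meson divide_pos_pos less_le_trans zero_less_one)
      have 1: "1 \<le> r * ?z" "r * ?z \<le> 2" using r z by (auto simp: field_simps)
      have "cos (r * z) = cos (r * ?z)" by (cases "0 \<le> z") (auto simp: abs_if)
      also have "\<dots> \<le> cos 1" using 1 pi_gt3 by (intro cos_monotone_0_pi_le) auto
      finally have c: "1 - cos 1 \<le> 1 - cos (r * z)" by simp
      have p: "(2 / ?z) powr (- 1 - m) \<le> r powr (- 1 - m)" using r r0 m by (intro powr_mono2') auto
      have "(1 - cos 1) * (2 / ?z) powr (- 1 - m) \<le> (1 - cos (r * z)) * r powr (- 1 - m)"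
        using c p one_minus_cos_pos by (intro mult_mono) auto
      then show ?thesis using True r0 by (simp add: ennreal_leI)
    qed simp
  qed
  finally show ?thesis .
qed simp

lemma one_minus_charf_integral:
  assumes \<mu>: "prob_space \<mu>" and [measurable_cong]: "sets \<mu> = sets borel"
  shows "integrable \<mu> (\<lambda>y. 1 - cos (y \<bullet> \<xi>))" "(\<integral>y. 1 - cos (y \<bullet> \<xi>) \<partial>\<mu>) = 1 - Re (charf \<mu> \<xi>)"
proof -
  interpret M: prob_space \<mu> by fact
  have i: "integrable \<mu> (\<lambda>y. cis (- (y \<bullet> \<xi>)))" by (rule M.cis_integrable) simp
  have c: "integrable \<mu> (\<lambda>y. cos (y \<bullet> \<xi>))" using integrable_Re[OF i] by simp
  then show "integrable \<mu> (\<lambda>y. 1 - cos (y \<bullet> \<xi>))" by simp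
  show "(\<integral>y. 1 - cos (y \<bullet> \<xi>) \<partial>\<mu>) = 1 - Re (charf \<mu> \<xi>)"
    unfolding charf_def integral_Re[OF i, symmetric] using c by (simp add: M.prob_space)
qed

text \<open>Integrating the previous inequality against \<mu> and exchanging the integrals bounds
  the moment by the integral of 1 - Re \<open>charf \<mu> (r *\<^sub>R b)\<close> against r^(-1-m).
  For r < 1 the linear bound B r leaves the integrable power r^(-m) and gives B/(1 - m); for r \<ge>
  1 the trivial bound 2 gives 2/m. This is where moments of order 1 are out of reach.\<close>

lemma component_moment_bound:
  fixes \<mu> :: "'a::euclidean_space measure"
  assumes \<mu>: "prob_space \<mu>" and s [measurable_cong]: "sets \<mu> = sets borel" and m: "0 < m" "m < 1"
    and B: "\<And>\<xi>. norm \<xi> \<le> 1 \<Longrightarrow> cmod (1 - charf \<mu> \<xi>) \<le> B * norm \<xi>" "0 \<le> B" and b: "b \<in> Basis"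
  shows "(\<integral>\<^sup>+y. ennreal (\<bar>y \<bullet> b\<bar> powr m) \<partial>\<mu>) \<le> ennreal (4 / (1 - cos 1) * (B / (1 - m) + 2 / m))"
proof -
  interpret M: prob_space \<mu> by fact
  interpret P: pair_sigma_finite \<mu> lborel by (rule pair_sigma_finite_prob_lborel) fact
  have nb: "norm b = 1" using b by simp
  have K: "0 < 1 - cos (1::real)" by (rule one_minus_cos_pos)
  let ?w = "\<lambda>r. indicator {0<..} r * r powr (- 1 - m) :: real"
  have I0: "(\<integral>\<^sup>+r. ennreal (B * r powr (- m)) * indicator {0..1} r \<partial>lborel) = ennreal (B / (1 - m))"
  proof -
    have "((\<lambda>r. B * r powr (- m)) has_integral (B * (1 powr (- m + 1) / (- m + 1)))) {0..1}"
      using m by (intro has_integral_mult_right has_integral_powr_from_0) auto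
    then show ?thesis
      using B(2) by (subst nn_integral_has_integral_lebesgue'[of "{0..1}" "\<lambda>r. B * r powr (- m)" "B / (1 - m)"]) auto
  qed
  have I1: "(\<integral>\<^sup>+r. ennreal (2 * r powr (- 1 - m)) * indicator {1..} r \<partial>lborel) = ennreal (2 / m)"
  proof -
    have "((\<lambda>r. 2 * r powr (- 1 - m)) has_integral (2 * (- (1 powr (- 1 - m + 1)) / (- 1 - m + 1)))) {1..}"
      using m by (intro has_integral_mult_right has_integral_powr_to_inf) auto
    then show ?thesis
      by (subst nn_integral_has_integral_lebesgue'[of "{1..}" "\<lambda>r. 2 * r powr (- 1 - m)" "2 / m"]) auto
  qed
  have "ennreal ((1 - cos 1) / 4) * (\<integral>\<^sup>+y. ennreal (\<bar>y \<bullet> b\<bar> powr m) \<partial>\<mu>)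
    = (\<integral>\<^sup>+y. ennreal ((1 - cos 1) / 4 * \<bar>y \<bullet> b\<bar> powr m) \<partial>\<mu>)"
    using K by (subst nn_integral_cmult[symmetric]) (auto simp: ennreal_mult'[symmetric])
  also have "\<dots> \<le> (\<integral>\<^sup>+y. (\<integral>\<^sup>+r. ennreal (indicator {0<..} r * ((1 - cos (r * (y \<bullet> b))) * r powr (- 1 - m))) \<partial>lborel) \<partial>\<mu>)"
    by (intro nn_integral_mono powr_le_one_minus_cos_integral m)
  also have "\<dots> = (\<integral>\<^sup>+r. (\<integral>\<^sup>+y. ennreal (indicator {0<..} r * ((1 - cos (r * (y \<bullet> b))) * r powr (- 1 - m))) \<partial>\<mu>) \<partial>lborel)"
    by (rule P.Fubini'[symmetric]) measurable
  also have "\<dots> = (\<integral>\<^sup>+r. ennreal (?w r * (1 - Re (charf \<mu> (r *\<^sub>R b)))) \<partial>lborel)"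
  proof (rule nn_integral_cong)
    fix r :: real
    have "(\<integral>\<^sup>+y. ennreal (indicator {0<..} r * ((1 - cos (r * (y \<bullet> b))) * r powr (- 1 - m))) \<partial>\<mu>)
       = (\<integral>\<^sup>+y. ennreal (?w r) * ennreal (1 - cos (y \<bullet> (r *\<^sub>R b))) \<partial>\<mu>)"
      by (intro nn_integral_cong) (auto simp: ennreal_mult'[symmetric] mult_ac)
    also have "\<dots> = ennreal (?w r) * ennreal (1 - Re (charf \<mu> (r *\<^sub>R b)))"
    proof -
      have "(\<integral>\<^sup>+y. ennreal (1 - cos (y \<bullet> (r *\<^sub>R b))) \<partial>\<mu>) = ennreal (\<integral>y. 1 - cos (y \<bullet> (r *\<^sub>R b)) \<partial>\<mu>)"
        by (rule nn_integral_eq_integral[OF one_minus_charf_integral(1)[OF \<mu> s]]) simp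
      then show ?thesis
        by (subst nn_integral_cmult, measurable) (simp only: one_minus_charf_integral(2)[OF \<mu> s])
    qed
    finally show "(\<integral>\<^sup>+y. ennreal (indicator {0<..} r * ((1 - cos (r * (y \<bullet> b))) * r powr (- 1 - m))) \<partial>\<mu>) = ennreal (?w r * (1 - Re (charf \<mu> (r *\<^sub>R b))))"
      by (simp add: ennreal_mult')
  qed
  also have "\<dots> \<le> (\<integral>\<^sup>+r. ennreal (B * r powr (- m)) * indicator {0..1} r + ennreal (2 * r powr (- 1 - m)) * indicator {1..} r \<partial>lborel)"
  proof (rule nn_integral_mono)
    fix r :: real
    have re: "1 - Re (charf \<mu> (r *\<^sub>R b)) \<le> cmod (1 - charf \<mu> (r *\<^sub>R b))"
      using complex_Re_le_cmod[of "1 - charf \<mu> (r *\<^sub>R b)"] by simp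
    consider "r \<le> 0" | "0 < r" "r < 1" | "1 \<le> r" by linarith
    then show "ennreal (?w r * (1 - Re (charf \<mu> (r *\<^sub>R b)))) \<le> ennreal (B * r powr (- m)) * indicator {0..1} r + ennreal (2 * r powr (- 1 - m)) * indicator {1..} r"
    proof cases
      case 2
      have "1 - Re (charf \<mu> (r *\<^sub>R b)) \<le> B * r"
        using order_trans[OF re B(1)[of "r *\<^sub>R b"]] 2 nb by simp
      then have "r powr (- 1 - m) * (1 - Re (charf \<mu> (r *\<^sub>R b))) \<le> r powr (- 1 - m) * (B * r)" by (intro mult_left_mono) auto
      also have "\<dots> = B * (r powr (- 1 - m) * r powr 1)" using 2 by simp
      also have "\<dots> = B * r powr (- m)" unfolding powr_add[symmetric] by simp
      finally show ?thesis using 2 by (simp add: ennreal_leI)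
    next
      case 3
      have "cmod (1 - charf \<mu> (r *\<^sub>R b)) \<le> 2"
        using norm_triangle_ineq4[of 1 "charf \<mu> (r *\<^sub>R b)"] norm_charf_le_1[OF \<mu> s, of "r *\<^sub>R b"] by simp
      then have "1 - Re (charf \<mu> (r *\<^sub>R b)) \<le> 2" using re by linarith
      then have "r powr (- 1 - m) * (1 - Re (charf \<mu> (r *\<^sub>R b))) \<le> r powr (- 1 - m) * 2" by (intro mult_left_mono) auto
      then have "ennreal (?w r * (1 - Re (charf \<mu> (r *\<^sub>R b)))) \<le> ennreal (2 * r powr (- 1 - m)) * indicator {1..} r"
        using 3 by (simp add: ennreal_leI mult.commute)
      then show ?thesis by (rule order_trans) simp
    qed simp
  qed
  also have "\<dots> = ennreal (B / (1 - m)) + ennreal (2 / m)"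
    by (subst nn_integral_add) (auto simp: I0 I1)
  also have "\<dots> = ennreal (B / (1 - m) + 2 / m)" using m B(2) by (simp add: ennreal_plus)
  finally have fin: "ennreal ((1 - cos 1) / 4) * (\<integral>\<^sup>+y. ennreal (\<bar>y \<bullet> b\<bar> powr m) \<partial>\<mu>) \<le> ennreal (B / (1 - m) + 2 / m)" .
  have "(\<integral>\<^sup>+y. ennreal (\<bar>y \<bullet> b\<bar> powr m) \<partial>\<mu>) = ennreal (4 / (1 - cos 1)) * (ennreal ((1 - cos 1) / 4) * (\<integral>\<^sup>+y. ennreal (\<bar>y \<bullet> b\<bar> powr m) \<partial>\<mu>))"
  proof -
    have "4 / \<kappa> * (\<kappa> / 4) = 1" if "0 < \<kappa>" for \<kappa> :: real using that by simp
    from this[OF K] have "ennreal (4 / (1 - cos 1)) * ennreal ((1 - cos 1) / 4) = 1"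
      using K by (subst ennreal_mult'[symmetric]) simp_all
    then show ?thesis by (simp only: mult.assoc[symmetric] mult_1_left)
  qed
  also have "\<dots> \<le> ennreal (4 / (1 - cos 1)) * ennreal (B / (1 - m) + 2 / m)"
    by (intro mult_left_mono fin) simp
  also have "\<dots> = ennreal (4 / (1 - cos 1) * (B / (1 - m) + 2 / m))"
    using K m B(2) by (intro ennreal_mult'[symmetric]) auto
  finally show ?thesis .
qed

definition moment_const :: "'a::euclidean_space itself \<Rightarrow> real \<Rightarrow> real \<Rightarrow> real" where
  "moment_const _ m B = (1 + real DIM('a)) powr m * (1 + real DIM('a) * (4 / (1 - cos 1) * (B / (1 - m) + 2 / m)))"

lemma bracket_powr_le_components:
  fixes y :: "'a::euclidean_space"
  assumes "0 < m" shows "bracket y powr m \<le> (1 + real DIM('a)) powr m * (1 + (\<Sum>b\<in>Basis. \<bar>y \<bullet> b\<bar> powr m))"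
proof -
  \<comment> \<open>A coordinate of largest modulus; the norm is at most d times this
    modulus.\<close>
  obtain c :: 'a where c: "c \<in> Basis" "\<And>b. b \<in> Basis \<Longrightarrow> \<bar>y \<bullet> b\<bar> \<le> \<bar>y \<bullet> c\<bar>"
  proof -
    have "Max ((\<lambda>b. \<bar>y \<bullet> b\<bar>) ` Basis) \<in> (\<lambda>b. \<bar>y \<bullet> b\<bar>) ` Basis" by (rule Max_in) auto
    then obtain c where "c \<in> Basis" "Max ((\<lambda>b. \<bar>y \<bullet> b\<bar>) ` Basis) = \<bar>y \<bullet> c\<bar>" by blast
    moreover have "\<bar>y \<bullet> b\<bar> \<le> Max ((\<lambda>b. \<bar>y \<bullet> b\<bar>) ` Basis)" if "b \<in> Basis" for b
      using that by (intro Max_ge) auto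
    ultimately show ?thesis using that by metis
  qed
  have "norm y \<le> (\<Sum>b\<in>Basis. \<bar>y \<bullet> b\<bar>)" by (rule norm_le_l1)
  also have "\<dots> \<le> (\<Sum>b\<in>(Basis::'a set). \<bar>y \<bullet> c\<bar>)" by (intro sum_mono c)
  finally have n: "bracket y \<le> 1 + real DIM('a) * \<bar>y \<bullet> c\<bar>" using bracket_le[of y] by simp
  also have "\<dots> \<le> (1 + real DIM('a)) * max 1 \<bar>y \<bullet> c\<bar>"
    unfolding distrib_right by (intro add_mono mult_left_mono) auto
  finally have "bracket y powr m \<le> ((1 + real DIM('a)) * max 1 \<bar>y \<bullet> c\<bar>) powr m"
    using bracket_pos[of y] assms by (intro powr_mono2) auto
  also have "\<dots> = (1 + real DIM('a)) powr m * (max 1 \<bar>y \<bullet> c\<bar>) powr m" by (subst powr_mult) auto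
  also have "\<dots> \<le> (1 + real DIM('a)) powr m * (1 + (\<Sum>b\<in>Basis. \<bar>y \<bullet> b\<bar> powr m))"
  proof (rule mult_left_mono)
    have "\<bar>y \<bullet> c\<bar> powr m \<le> (\<Sum>b\<in>Basis. \<bar>y \<bullet> b\<bar> powr m)"
      using c(1) by (intro member_le_sum) auto
    moreover have "(max 1 \<bar>y \<bullet> c\<bar>) powr m \<le> 1 + \<bar>y \<bullet> c\<bar> powr m" by (auto simp: max_def)
    ultimately show "(max 1 \<bar>y \<bullet> c\<bar>) powr m \<le> 1 + (\<Sum>b\<in>Basis. \<bar>y \<bullet> b\<bar> powr m)" by linarith
  qed simp
  finally show ?thesis .
qed

theorem moment_bound:
  fixes \<mu> :: "'a::euclidean_space measure"
  assumes \<mu>: "prob_space \<mu>" and s [measurable_cong]: "sets \<mu> = sets borel" and m: "0 < m" "m < 1"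
    and B: "\<And>\<xi>. norm \<xi> \<le> 1 \<Longrightarrow> cmod (1 - charf \<mu> \<xi>) \<le> B * norm \<xi>" "0 \<le> B"
  shows "(\<integral>\<^sup>+y. ennreal (bracket y powr m) \<partial>\<mu>) \<le> ennreal (moment_const TYPE('a) m B)"
proof -
  interpret M: prob_space \<mu> by fact
  define C where "C = 4 / (1 - cos 1) * (B / (1 - m) + 2 / m)"
  have C0: "0 \<le> C" unfolding C_def using m B(2) one_minus_cos_pos by (intro mult_nonneg_nonneg add_nonneg_nonneg divide_nonneg_nonneg) auto
  have "(\<integral>\<^sup>+y. ennreal (bracket y powr m) \<partial>\<mu>)
    \<le> (\<integral>\<^sup>+y. ennreal ((1 + real DIM('a)) powr m) * (1 + (\<Sum>b\<in>Basis. ennreal (\<bar>y \<bullet> b\<bar> powr m))) \<partial>\<mu>)"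
  proof (rule nn_integral_mono)
    fix y :: 'a
    have "ennreal (bracket y powr m) \<le> ennreal ((1 + real DIM('a)) powr m * (1 + (\<Sum>b\<in>Basis. \<bar>y \<bullet> b\<bar> powr m)))"
      by (intro ennreal_leI bracket_powr_le_components m)
    also have "\<dots> = ennreal ((1 + real DIM('a)) powr m) * (1 + (\<Sum>b\<in>Basis. ennreal (\<bar>y \<bullet> b\<bar> powr m)))"
      by (simp add: ennreal_mult' sum_ennreal sum_nonneg)
    finally show "ennreal (bracket y powr m) \<le> ennreal ((1 + real DIM('a)) powr m) * (1 + (\<Sum>b\<in>Basis. ennreal (\<bar>y \<bullet> b\<bar> powr m)))" .
  qed
  also have "\<dots> = ennreal ((1 + real DIM('a)) powr m) * (1 + (\<Sum>b\<in>Basis. \<integral>\<^sup>+y. ennreal (\<bar>y \<bullet> b\<bar> powr m) \<partial>\<mu>))"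
    by (simp add: nn_integral_cmult nn_integral_add nn_integral_sum M.emeasure_space_1 del: sum_ennreal)
  also have "\<dots> \<le> ennreal ((1 + real DIM('a)) powr m) * (1 + (\<Sum>b\<in>(Basis::'a set). ennreal C))"
    by (intro mult_left_mono add_left_mono sum_mono component_moment_bound[OF \<mu> s m B, folded C_def]) auto
  also have "(\<Sum>b\<in>(Basis::'a set). ennreal C) = ennreal (real DIM('a) * C)"
    using C0 by (subst sum_ennreal) auto
  also have "ennreal ((1 + real DIM('a)) powr m) * (1 + ennreal (real DIM('a) * C)) = ennreal (moment_const TYPE('a) m B)"
    unfolding moment_const_def C_def[symmetric] ennreal_1[symmetric] using C0
    by (subst ennreal_plus[symmetric]) (auto simp: ennreal_mult'[symmetric] simp del: ennreal_1 ennreal_plus)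
  finally show ?thesis .
qed

section \<open>Exponents of stable-like kernels\<close>

text \<open>Rescaling by \<epsilon> is the drift dilation at time \<open>- ln \<epsilon>\<close>, so
  mass and transform follow from the lemmas on dilations.\<close>

lemma prob_density_rescale:
  fixes J :: "'a::euclidean_space \<Rightarrow> real"
  assumes J: "prob_density J" and e: "0 < \<epsilon>"
  shows "prob_density (rescale J \<epsilon>)" and "fourier (rescale J \<epsilon>) \<xi> = fourier J (\<epsilon> *\<^sub>R \<xi>)"
proof -
  have [measurable]: "J \<in> borel_measurable borel" and Ji: "integrable lborel J" and J1: "integral\<^sup>L lborel J = 1"
    and J0: "AE x in lborel. 0 \<le> J x"
    using J by (auto simp: prob_density_def)
  define r where "r = - ln \<epsilon>"
  have er: "exp r = 1 / \<epsilon>" using e by (simp add: r_def exp_minus field_simps)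
  have c: "\<epsilon> powr (- real DIM('a)) = exp (real DIM('a) * r)"
    using e by (simp add: powr_def r_def)
  have res: "rescale J \<epsilon> = (\<lambda>x. exp (real DIM('a) * r) * J (exp r *\<^sub>R x))"
    by (simp add: rescale_def fun_eq_iff c er)
  have AE: "AE x in lborel. 0 \<le> J (exp r *\<^sub>R x)"
  proof -
    have "AE x in distr lborel borel (\<lambda>x. 0 + exp r *\<^sub>R x). 0 \<le> J x"
    proof -
      have "AE x in density (distr lborel borel (\<lambda>x. 0 + exp r *\<^sub>R x)) (\<lambda>_. ennreal (\<bar>exp r\<bar> ^ DIM('a))). 0 \<le> J x"
        using J0 by (subst (asm) lborel_affine[of "exp r" 0]) (auto simp: ennreal_power)
      then show ?thesis by (subst (asm) AE_density) (auto simp: ennreal_power[symmetric])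
    qed
    then show ?thesis by (subst (asm) AE_distr_iff) auto
  qed
  show "prob_density (rescale J \<epsilon>)"
    unfolding prob_density_def res using AE dilate_integrable[OF Ji, of r] dilate_integral[OF Ji, of r] J1
    by auto
  show "fourier (rescale J \<epsilon>) \<xi> = fourier J (\<epsilon> *\<^sub>R \<xi>)"
    unfolding res using e by (subst fourier_dilate[OF Ji]) (simp add: r_def)
qed

lemma charf_density:
  assumes "prob_density J"
  shows "charf (density lborel (\<lambda>x. ennreal (J x))) \<xi> = fourier J \<xi>"
  unfolding charf_def fourier_def using assms
  by (subst integral_density) (auto simp: prob_density_def scaleR_conv_of_real mult.commute)

lemma norm_fourier_prob_density:
  assumes "prob_density J" shows "cmod (fourier J \<xi>) \<le> 1"
  unfolding charf_density[OF assms, symmetric]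
  by (rule norm_charf_le_1[OF prob_space_prob_density[OF assms]]) simp

definition stable_kernel :: "real \<Rightarrow> real \<Rightarrow> real \<Rightarrow> ('a::euclidean_space \<Rightarrow> real) \<Rightarrow> bool" where
  "stable_kernel C0 \<delta> s J \<longleftrightarrow> prob_density J \<and> 0 < C0 \<and> 0 < \<delta> \<and> 1/2 < s \<and> s \<le> 1 \<and>
     (\<forall>\<xi>. norm \<xi> \<le> 1 \<longrightarrow> cmod (fourier J \<xi> - (1 - complex_of_real (norm \<xi> powr (2 * s)))) \<le> C0 * norm \<xi> powr (2 * s + \<delta>))"

text \<open>The symbol of the rescaled jump operator. Integrated along the contracting orbit of
  \<xi> it gives \<open>finexp\<close>, the exponent of the law at time t, and
  \<open>limexp\<close>, the exponent of the equilibrium.\<close>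

definition symb :: "('a::euclidean_space \<Rightarrow> real) \<Rightarrow> real \<Rightarrow> real \<Rightarrow> 'a \<Rightarrow> complex" where
  "symb J s \<epsilon> \<eta> = complex_of_real (\<epsilon> powr (- 2 * s)) * (1 - fourier J (\<epsilon> *\<^sub>R \<eta>))"

definition finexp :: "('a::euclidean_space \<Rightarrow> real) \<Rightarrow> real \<Rightarrow> real \<Rightarrow> real \<Rightarrow> 'a \<Rightarrow> complex" where
  "finexp J s \<epsilon> t \<xi> = (\<integral>\<tau>\<in>{0..t}. symb J s \<epsilon> (exp (- \<tau>) *\<^sub>R \<xi>) \<partial>lborel)"

definition limexp :: "('a::euclidean_space \<Rightarrow> real) \<Rightarrow> real \<Rightarrow> real \<Rightarrow> 'a \<Rightarrow> complex" where
  "limexp J s \<epsilon> \<xi> = (\<integral>\<tau>\<in>{0..}. symb J s \<epsilon> (exp (- \<tau>) *\<^sub>R \<xi>) \<partial>lborel)"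

lemma exponent_eq_finexp:
  "prob_density J \<Longrightarrow> 0 < \<epsilon> \<Longrightarrow> exponent (rescale J \<epsilon>) (\<epsilon> powr (- 2 * s)) t \<xi> = finexp J s \<epsilon> t \<xi>"
  by (simp add: exponent_def finexp_def symb_def prob_density_rescale)

context
  fixes C0 \<delta> s :: real and J :: "'a::euclidean_space \<Rightarrow> real"
  assumes J: "stable_kernel C0 \<delta> s J"
begin

lemma stable_kernel_facts:
  "prob_density J" "0 < C0" "0 < \<delta>" "1/2 < s" "s \<le> 1" "integrable lborel J" "J \<in> borel_measurable borel"
  using J by (auto simp: stable_kernel_def prob_density_def)

text \<open>Inside the unit ball the expansion gives the factor C0 + 1, outside it the trivial bound
  gives 2; \<open>C0 + 2\<close> covers both.\<close>

lemma one_minus_fourier_le: "cmod (1 - fourier J \<xi>) \<le> (C0 + 2) * norm \<xi> powr (2 * s)"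
proof (cases "norm \<xi> \<le> 1")
  case True
  have "cmod (1 - fourier J \<xi>) \<le> cmod (fourier J \<xi> - (1 - complex_of_real (norm \<xi> powr (2 * s)))) + cmod (complex_of_real (norm \<xi> powr (2 * s)))"
    using norm_triangle_ineq4[of "complex_of_real (norm \<xi> powr (2 * s))" "fourier J \<xi> - (1 - complex_of_real (norm \<xi> powr (2 * s)))"]
    by (simp add: algebra_simps)
  also have "\<dots> \<le> C0 * norm \<xi> powr (2 * s + \<delta>) + norm \<xi> powr (2 * s)"
    using J True by (auto simp: stable_kernel_def)
  also have "\<dots> \<le> C0 * norm \<xi> powr (2 * s) + norm \<xi> powr (2 * s)"
    using stable_kernel_facts True by (intro add_right_mono mult_left_mono powr_mono') auto
  also have "\<dots> \<le> (C0 + 2) * norm \<xi> powr (2 * s)" by (simp add: distrib_right)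
  finally show ?thesis .
next
  case False
  have "cmod (1 - fourier J \<xi>) \<le> 2"
    using norm_triangle_ineq4[of 1 "fourier J \<xi>"] norm_fourier_prob_density[OF stable_kernel_facts(1), of \<xi>] by simp
  also have "\<dots> \<le> 2 * norm \<xi> powr (2 * s)"
    using False stable_kernel_facts by (simp add: ge_one_powr_ge_zero)
  also have "\<dots> \<le> (C0 + 2) * norm \<xi> powr (2 * s)"
    using stable_kernel_facts by (intro mult_right_mono) auto
  finally show ?thesis .
qed

text \<open>The bound is homogeneous of degree 2 s, so \<epsilon> cancels against the rate and the
  estimate is uniform in \<epsilon>.\<close>

lemma norm_symb_le:
  assumes e: "0 < \<epsilon>" shows "cmod (symb J s \<epsilon> \<eta>) \<le> (C0 + 2) * norm \<eta> powr (2 * s)"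
proof -
  have "cmod (symb J s \<epsilon> \<eta>) = \<epsilon> powr (- 2 * s) * cmod (1 - fourier J (\<epsilon> *\<^sub>R \<eta>))"
    by (simp add: symb_def norm_mult)
  also have "\<dots> \<le> \<epsilon> powr (- 2 * s) * ((C0 + 2) * norm (\<epsilon> *\<^sub>R \<eta>) powr (2 * s))"
    by (intro mult_left_mono one_minus_fourier_le) auto
  also have "\<dots> = \<epsilon> powr (- 2 * s) * \<epsilon> powr (2 * s) * ((C0 + 2) * norm \<eta> powr (2 * s))"
    using e by (simp add: powr_mult)
  also have "\<epsilon> powr (- 2 * s) * \<epsilon> powr (2 * s) = 1"
    using e by (simp add: powr_add[symmetric])
  finally show ?thesis by simp
qed

lemma Re_symb_nonneg: "0 \<le> Re (symb J s \<epsilon> \<eta>)"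
proof -
  have "Re (fourier J (\<epsilon> *\<^sub>R \<eta>)) \<le> 1"
    using complex_Re_le_cmod norm_fourier_prob_density[OF stable_kernel_facts(1)] by (rule order_trans)
  then show ?thesis by (simp add: symb_def)
qed

lemma symb_measurable [measurable]: "symb J s \<epsilon> \<in> borel_measurable borel"
  using stable_kernel_facts(7) unfolding symb_def[abs_def] by measurable

text \<open>The radius \<open>r0\<close> is such that, for scaled frequencies below it, the
  remainder of the expansion is at most half of the leading term.\<close>

lemma Re_symb_ge:
  assumes e: "0 < \<epsilon>" and r: "r0 \<le> 1" "C0 * r0 powr \<delta> \<le> 1/2" "\<epsilon> * norm \<eta> \<le> r0"
  shows "norm \<eta> powr (2 * s) / 2 \<le> Re (symb J s \<epsilon> \<eta>)"
proof -
  let ?x = "\<epsilon> * norm \<eta>"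
  have x: "0 \<le> ?x" "?x \<le> 1" using assms by auto
  have n: "norm (\<epsilon> *\<^sub>R \<eta>) = ?x" using e by simp
  have "cmod (fourier J (\<epsilon> *\<^sub>R \<eta>) - (1 - complex_of_real (?x powr (2 * s)))) \<le> C0 * ?x powr (2 * s + \<delta>)"
    using J x unfolding stable_kernel_def n[symmetric] by blast
  also have "\<dots> = (C0 * ?x powr \<delta>) * ?x powr (2 * s)" by (simp add: powr_add)
  also have "\<dots> \<le> 1/2 * ?x powr (2 * s)"
  proof (rule mult_right_mono)
    have "C0 * ?x powr \<delta> \<le> C0 * r0 powr \<delta>"
      using stable_kernel_facts r(3) x by (intro mult_left_mono powr_mono2) auto
    then show "C0 * ?x powr \<delta> \<le> 1/2" using r(2) by linarith
  qed simp
  finally have "\<bar>Re (fourier J (\<epsilon> *\<^sub>R \<eta>) - (1 - complex_of_real (?x powr (2 * s))))\<bar> \<le> 1/2 * ?x powr (2 * s)"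
    by (rule order_trans[OF abs_Re_le_cmod])
  moreover have "Re (fourier J (\<epsilon> *\<^sub>R \<eta>) - (1 - complex_of_real (?x powr (2 * s)))) = Re (fourier J (\<epsilon> *\<^sub>R \<eta>)) - (1 - ?x powr (2 * s))"
    by simp
  ultimately have "1/2 * ?x powr (2 * s) \<le> 1 - Re (fourier J (\<epsilon> *\<^sub>R \<eta>))" by linarith
  then have "\<epsilon> powr (- 2 * s) * (1/2 * ?x powr (2 * s)) \<le> \<epsilon> powr (- 2 * s) * (1 - Re (fourier J (\<epsilon> *\<^sub>R \<eta>)))"
    by (intro mult_left_mono) auto
  also have "\<epsilon> powr (- 2 * s) * (1/2 * ?x powr (2 * s)) = (\<epsilon> powr (- 2 * s) * \<epsilon> powr (2 * s)) * (norm \<eta> powr (2 * s) / 2)"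
    using e by (simp add: powr_mult)
  also have "\<epsilon> powr (- 2 * s) * \<epsilon> powr (2 * s) = 1" using e by (simp add: powr_add[symmetric])
  finally show ?thesis by (simp add: symb_def)
qed

end

section \<open>Symbols integrated along the drift\<close>

lemma exp_decay_integral:
  fixes b c :: real assumes b: "0 < b"
  shows "set_integrable lborel {c..} (\<lambda>\<tau>. exp (- (b * \<tau>)))"
    and "(\<integral>\<tau>\<in>{c..}. exp (- (b * \<tau>)) \<partial>lborel) = exp (- (b * c)) / b"
proof -
  have "((\<lambda>\<tau>. exp (- b * \<tau>)) has_integral exp (- b * c) / b) {c..}"
    by (rule has_integral_exp_minus_to_infinity[OF b])
  then have n: "(\<integral>\<^sup>+\<tau>. ennreal (indicator {c..} \<tau> * exp (- (b * \<tau>))) \<partial>lborel) = ennreal (exp (- (b * c)) / b)"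
    by (subst nn_integral_has_integral_lebesgue[of "{c..}" "\<lambda>\<tau>. exp (- (b * \<tau>))"]) auto
  show "set_integrable lborel {c..} (\<lambda>\<tau>. exp (- (b * \<tau>)))"
    unfolding set_integrable_def by (rule integrableI_nonneg) (auto simp: n)
  show "(\<integral>\<tau>\<in>{c..}. exp (- (b * \<tau>)) \<partial>lborel) = exp (- (b * c)) / b"
    unfolding set_lebesgue_integral_def
    by (subst integral_eq_nn_integral) (use b in \<open>auto simp: n\<close>)
qed

context
  fixes C0 \<delta> s \<epsilon> :: real and J :: "'a::euclidean_space \<Rightarrow> real"
  assumes J: "stable_kernel C0 \<delta> s J" and e: "0 < \<epsilon>"
begin

lemma norm_symb_dilated_le:
  "cmod (symb J s \<epsilon> (exp (- \<tau>) *\<^sub>R \<xi>)) \<le> (C0 + 2) * norm \<xi> powr (2 * s) * exp (- (2 * s * \<tau>))"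
proof -
  have "norm (exp (- \<tau>) *\<^sub>R \<xi>) powr (2 * s) = norm \<xi> powr (2 * s) * exp (- (2 * s * \<tau>))"
    by (simp add: powr_mult) (simp add: powr_def mult_ac)
  then show ?thesis using norm_symb_le[OF J e, of "exp (- \<tau>) *\<^sub>R \<xi>"] by (simp add: mult.assoc)
qed

text \<open>Along the drift the symbol decays like exp(-2 s \<tau>). A general time set
  \<open>A\<close> serves bounded intervals, tails and the half line alike; the factor 1/(2 s) left
  by the integral is below 1.\<close>

lemma symb_dilated_integrable:
  assumes "A \<in> sets borel" "A \<subseteq> {c..}"
  shows "set_integrable lborel A (\<lambda>\<tau>. symb J s \<epsilon> (exp (- \<tau>) *\<^sub>R \<xi>))"
    and "cmod (\<integral>\<tau>\<in>A. symb J s \<epsilon> (exp (- \<tau>) *\<^sub>R \<xi>) \<partial>lborel) \<le> (C0 + 2) * norm \<xi> powr (2 * s) * exp (- (2 * s * c))"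
proof -
  note F = stable_kernel_facts[OF J]
  note [measurable] = symb_measurable[OF J] assms(1)
  let ?B = "(C0 + 2) * norm \<xi> powr (2 * s)"
  have B0: "0 \<le> ?B" using F by simp
  have E: "set_integrable lborel {c..} (\<lambda>\<tau>. ?B * exp (- (2 * s * \<tau>)))"
    using F by (intro set_integrable_mult_right exp_decay_integral(1)) auto
  have le: "norm (indicator A \<tau> *\<^sub>R symb J s \<epsilon> (exp (- \<tau>) *\<^sub>R \<xi>)) \<le> indicator {c..} \<tau> *\<^sub>R (?B * exp (- (2 * s * \<tau>)))" for \<tau>
    using assms(2) norm_symb_dilated_le[of \<tau> \<xi>] B0 by (auto simp: indicator_def subset_eq)
  show i: "set_integrable lborel A (\<lambda>\<tau>. symb J s \<epsilon> (exp (- \<tau>) *\<^sub>R \<xi>))"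
    unfolding set_integrable_def
    by (rule Bochner_Integration.integrable_bound[OF E[unfolded set_integrable_def]])
       (use order_trans[OF le abs_ge_self] in auto)
  have "cmod (\<integral>\<tau>\<in>A. symb J s \<epsilon> (exp (- \<tau>) *\<^sub>R \<xi>) \<partial>lborel) \<le> (\<integral>\<tau>\<in>{c..}. ?B * exp (- (2 * s * \<tau>)) \<partial>lborel)"
    unfolding set_lebesgue_integral_def
    by (rule Bochner_Integration.integral_norm_bound_integral[OF i[unfolded set_integrable_def] E[unfolded set_integrable_def] le])
  also have "\<dots> = ?B * (exp (- (2 * s * c)) / (2 * s))"
    using F by (subst set_integral_mult_right) (subst exp_decay_integral(2), auto)
  also have "\<dots> \<le> ?B * exp (- (2 * s * c))"
    using F B0 by (intro mult_left_mono) (auto simp: divide_le_eq)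
  finally show "cmod (\<integral>\<tau>\<in>A. symb J s \<epsilon> (exp (- \<tau>) *\<^sub>R \<xi>) \<partial>lborel) \<le> ?B * exp (- (2 * s * c))" .
qed

lemma norm_finexp_le: "cmod (finexp J s \<epsilon> t \<xi>) \<le> (C0 + 2) * norm \<xi> powr (2 * s)"
  using symb_dilated_integrable(2)[of "{0..t}" 0] by (auto simp: finexp_def)

lemma norm_limexp_minus_finexp_le:
  assumes "0 \<le> t"
  shows "cmod (limexp J s \<epsilon> \<xi> - finexp J s \<epsilon> t \<xi>) \<le> (C0 + 2) * norm \<xi> powr (2 * s) * exp (- (2 * s * t))"
proof -
  have u: "{0..} = {0..t} \<union> {t<..}" using assms by auto
  have "limexp J s \<epsilon> \<xi> = finexp J s \<epsilon> t \<xi> + (\<integral>\<tau>\<in>{t<..}. symb J s \<epsilon> (exp (- \<tau>) *\<^sub>R \<xi>) \<partial>lborel)"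
    unfolding limexp_def finexp_def u
    by (rule set_integral_Un) (use assms in \<open>auto intro!: symb_dilated_integrable(1)[where c=0]\<close>)
  moreover have "{t<..} \<subseteq> {t..}" by auto
  ultimately show ?thesis using symb_dilated_integrable(2)[of "{t<..}" t \<xi>] by simp
qed

text \<open>The symbol has nonnegative real part, so a lower bound for an exponent may be taken from
  any part of the time axis.\<close>

lemma Re_finexp_mono:
  assumes A: "A \<in> sets borel" "A \<subseteq> {0..}" and B: "B \<in> sets borel" "B \<subseteq> A"
  shows "Re (\<integral>\<tau>\<in>B. symb J s \<epsilon> (exp (- \<tau>) *\<^sub>R \<xi>) \<partial>lborel) \<le> Re (\<integral>\<tau>\<in>A. symb J s \<epsilon> (exp (- \<tau>) *\<^sub>R \<xi>) \<partial>lborel)"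
proof -
  have iA: "set_integrable lborel A (\<lambda>\<tau>. symb J s \<epsilon> (exp (- \<tau>) *\<^sub>R \<xi>))"
    and iB: "set_integrable lborel B (\<lambda>\<tau>. symb J s \<epsilon> (exp (- \<tau>) *\<^sub>R \<xi>))"
    using symb_dilated_integrable(1)[of A 0] symb_dilated_integrable(1)[of B 0] A B by auto
  show ?thesis
    unfolding set_lebesgue_integral_def
      integral_Re[OF iA[unfolded set_integrable_def], symmetric] integral_Re[OF iB[unfolded set_integrable_def], symmetric]
    by (intro integral_mono integrable_Re iA[unfolded set_integrable_def] iB[unfolded set_integrable_def])
       (use B Re_symb_nonneg[OF J] in \<open>auto simp: indicator_def\<close>)
qed

lemma Re_finexp_nonneg: "0 \<le> Re (finexp J s \<epsilon> t \<xi>)" and Re_limexp_nonneg: "0 \<le> Re (limexp J s \<epsilon> \<xi>)"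
  using Re_finexp_mono[of "{0..t}" "{}"] Re_finexp_mono[of "{0..}" "{}"]
  by (auto simp: finexp_def limexp_def set_lebesgue_integral_def)

lemma Re_finexp_le_limexp: "Re (finexp J s \<epsilon> t \<xi>) \<le> Re (limexp J s \<epsilon> \<xi>)"
  unfolding finexp_def limexp_def by (rule Re_finexp_mono) auto

text \<open>Only the times after \<open>c\<close> are used: by then the drift has brought the scaled
  frequency below \<open>r0\<close>, where the symbol is comparable to its leading term. One factor
  1/2 stems from \<open>Re_symb_ge\<close>, the other from 1/(2 s) \<ge> 1/2.\<close>

lemma Re_limexp_ge:
  assumes r: "r0 \<le> 1" "C0 * r0 powr \<delta> \<le> 1/2" and c: "0 \<le> c" "\<epsilon> * (exp (- c) * norm \<xi>) \<le> r0"
  shows "(exp (- c) * norm \<xi>) powr (2 * s) / 4 \<le> Re (limexp J s \<epsilon> \<xi>)"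
proof -
  note F = stable_kernel_facts[OF J]
  have i: "set_integrable lborel {c..} (\<lambda>\<tau>. symb J s \<epsilon> (exp (- \<tau>) *\<^sub>R \<xi>))"
    by (rule symb_dilated_integrable(1)) auto
  have E: "set_integrable lborel {c..} (\<lambda>\<tau>. norm \<xi> powr (2 * s) / 2 * exp (- (2 * s * \<tau>)))"
    using F by (intro set_integrable_mult_right exp_decay_integral(1)) auto
  have le: "norm \<xi> powr (2 * s) / 2 * exp (- (2 * s * \<tau>)) \<le> Re (symb J s \<epsilon> (exp (- \<tau>) *\<^sub>R \<xi>))" if "c \<le> \<tau>" for \<tau>
  proof -
    have "\<epsilon> * (exp (- \<tau>) * norm \<xi>) \<le> \<epsilon> * (exp (- c) * norm \<xi>)"
      using that e by (intro mult_left_mono mult_right_mono) auto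
    then have "\<epsilon> * norm (exp (- \<tau>) *\<^sub>R \<xi>) \<le> r0" using c(2) by simp
    from Re_symb_ge[OF J e r this] have "norm (exp (- \<tau>) *\<^sub>R \<xi>) powr (2 * s) / 2 \<le> Re (symb J s \<epsilon> (exp (- \<tau>) *\<^sub>R \<xi>))" .
    moreover have "norm (exp (- \<tau>) *\<^sub>R \<xi>) powr (2 * s) = norm \<xi> powr (2 * s) * exp (- (2 * s * \<tau>))"
      by (simp add: powr_mult) (simp add: powr_def mult_ac)
    ultimately show ?thesis by simp
  qed
  have "(exp (- c) * norm \<xi>) powr (2 * s) = norm \<xi> powr (2 * s) * exp (- (2 * s * c))"
    by (simp add: powr_mult) (simp add: powr_def mult_ac)
  then have "(exp (- c) * norm \<xi>) powr (2 * s) / 4 = norm \<xi> powr (2 * s) / 2 * (exp (- (2 * s * c)) / 2)" by simp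
  also have "\<dots> \<le> norm \<xi> powr (2 * s) / 2 * (exp (- (2 * s * c)) / (2 * s))"
    using F by (intro mult_left_mono divide_left_mono) auto
  also have "\<dots> = (\<integral>\<tau>\<in>{c..}. norm \<xi> powr (2 * s) / 2 * exp (- (2 * s * \<tau>)) \<partial>lborel)"
    using F by (subst set_integral_mult_right) (subst exp_decay_integral(2), auto)
  also have "\<dots> \<le> Re (\<integral>\<tau>\<in>{c..}. symb J s \<epsilon> (exp (- \<tau>) *\<^sub>R \<xi>) \<partial>lborel)"
    unfolding set_lebesgue_integral_def integral_Re[OF i[unfolded set_integrable_def], symmetric]
    by (intro integral_mono integrable_Re i[unfolded set_integrable_def] E[unfolded set_integrable_def])
       (use le in \<open>simp add: indicator_def\<close>)
  also have "\<dots> \<le> Re (limexp J s \<epsilon> \<xi>)"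
    unfolding limexp_def by (rule Re_finexp_mono) (use c in auto)
  finally show ?thesis .
qed

end

text \<open>With r = e^(-\<tau>) |z| the integrand becomes (1 - cos r)/r, whose integral grows
  logarithmically because the cosine part converges by oscillation. This logarithm is the only
  source of decay at high frequency.\<close>

lemma log_cosine_integral_ge:
  fixes z :: real
  assumes T: "0 \<le> T" "T \<le> t" "exp T \<le> \<bar>z\<bar>"
  shows "T - 3 \<le> (\<integral>\<tau>\<in>{0..t}. 1 - cos (exp (- \<tau>) * z) \<partial>lborel)"
proof -
  define w where "w = \<bar>z\<bar>"
  have w: "exp T \<le> w" "1 \<le> w" "0 < w" using T unfolding w_def by (auto intro: order_trans[of 1 "exp T"] simp: one_le_exp_iff)
  have cw: "cos (exp (- \<tau>) * z) = cos (exp (- \<tau>) * w)" for \<tau>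
    by (cases "0 \<le> z") (auto simp: w_def)
  \<comment> \<open>The sine term integrates the cosine by parts. Subtracting
    \<open>exp \<tau> / w\<close> makes the leftover of the derivative,
    \<open>exp \<tau> / w * (sin (exp (- \<tau>) * w) - 1)\<close>, nonpositive, so the derivative
    of \<open>G\<close> stays below the integrand.\<close>
  define G where "G \<tau> = \<tau> + exp \<tau> / w * sin (exp (- \<tau>) * w) - exp \<tau> / w" for \<tau>
  define g where "g \<tau> = 1 - cos (exp (- \<tau>) * w) + exp \<tau> / w * (sin (exp (- \<tau>) * w) - 1)" for \<tau>
  have G': "(G has_real_derivative g \<tau>) (at \<tau>)" for \<tau>
  proof -
    have "exp \<tau> / w * (cos (exp (- \<tau>) * w) * (- exp (- \<tau>) * w)) = - cos (exp (- \<tau>) * w)"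
      using w by (simp add: field_simps exp_minus)
    then show ?thesis
      unfolding G_def[abs_def] g_def
      using w by (auto intro!: derivative_eq_intros simp: algebra_simps diff_divide_distrib)
  qed
  have I: "(g has_integral (G T - G 0)) {0..T}"
    by (rule fundamental_theorem_of_calculus[OF T(1)])
       (use G' in \<open>auto simp: has_real_derivative_iff_has_vector_derivative[symmetric] intro: has_field_derivative_at_within\<close>)
  have ci: "set_integrable lborel {0..T'} (\<lambda>\<tau>. 1 - cos (exp (- \<tau>) * z))" for T'
    by (intro borel_integrable_atLeastAtMost' continuous_intros)
  have "G T - G 0 \<le> integral {0..T} (\<lambda>\<tau>. 1 - cos (exp (- \<tau>) * z))"
  proof (rule has_integral_le[OF I])
    show "((\<lambda>\<tau>. 1 - cos (exp (- \<tau>) * z)) has_integral integral {0..T} (\<lambda>\<tau>. 1 - cos (exp (- \<tau>) * z))) {0..T}"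
      by (rule integrable_integral[OF set_borel_integral_eq_integral(1)[OF ci]])
    fix \<tau>
    have "exp \<tau> / w * (sin (exp (- \<tau>) * w) - 1) \<le> 0" using w by (intro mult_nonneg_nonpos) auto
    then show "g \<tau> \<le> 1 - cos (exp (- \<tau>) * z)" unfolding g_def cw by linarith
  qed
  also have "\<dots> = (\<integral>\<tau>\<in>{0..T}. 1 - cos (exp (- \<tau>) * z) \<partial>lborel)"
    by (rule set_borel_integral_eq_integral(2)[OF ci, symmetric])
  also have "\<dots> \<le> (\<integral>\<tau>\<in>{0..t}. 1 - cos (exp (- \<tau>) * z) \<partial>lborel)"
    unfolding set_lebesgue_integral_def
    by (intro integral_mono ci[unfolded set_integrable_def]) (use T in \<open>auto simp: indicator_def\<close>)
  finally have le: "G T - G 0 \<le> (\<integral>\<tau>\<in>{0..t}. 1 - cos (exp (- \<tau>) * z) \<partial>lborel)" .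
  \<comment> \<open>Since e^T \<le> |z|, the coefficients of all boundary terms are at most 1;
    together these terms cost no more than 3.\<close>
  have a: "exp T / w \<le> 1" "0 \<le> exp T / w" "1 / w \<le> 1" "0 \<le> 1 / w" using w by auto
  have "- (exp T / w) \<le> exp T / w * sin (exp (- T) * w)"
    using mult_left_mono[OF sin_ge_minus_one a(2), of "exp (- T) * w"] by simp
  moreover have "1 / w * sin w \<le> 1 / w"
    using mult_left_mono[OF sin_le_one a(4), of w] by simp
  moreover have "G T - G 0 = T + exp T / w * sin (exp (- T) * w) - exp T / w - 1 / w * sin w + 1 / w"
    by (simp add: G_def)
  ultimately have "T - 3 \<le> G T - G 0" using a by linarith
  then show ?thesis using le by linarith
qed

text \<open>Fubini turns the exponent into the average over the jumps x of a cosine integral in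
  time. Outside the slab the phase is at least e^T and the cosine integral at least T - 3; inside it
  the integral is merely nonnegative. So a slab of mass \<theta> costs the share \<theta> of the
  logarithm.\<close>

lemma Re_finexp_ge_log:
  fixes J :: "'a::euclidean_space \<Rightarrow> real"
  assumes J: "stable_kernel C0 \<delta> s J" and e: "0 < \<epsilon>"
    and slab: "measure (density lborel (\<lambda>x. ennreal (J x))) {x. \<bar>x \<bullet> \<xi>\<bar> < h * norm \<xi>} \<le> \<theta>"
    and T: "0 \<le> T" "T \<le> t" "exp T \<le> \<epsilon> * (h * norm \<xi>)"
  shows "\<epsilon> powr (- 2 * s) * ((1 - \<theta>) * T - 3) \<le> Re (finexp J s \<epsilon> t \<xi>)"
proof -
  note F = stable_kernel_facts[OF J]
  let ?M = "density lborel (\<lambda>x. ennreal (J x))"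
  note [measurable] = F(7)
  interpret M: prob_space ?M by (rule prob_space_prob_density[OF F(1)])
  interpret P: pair_sigma_finite lborel ?M ..
  let ?g = "\<lambda>\<tau> x. indicator {0..t} \<tau> * (1 - cos (exp (- \<tau>) * (\<epsilon> * (x \<bullet> \<xi>))))"
  have g0: "0 \<le> ?g \<tau> x" "?g \<tau> x \<le> 2 * indicator {0..t} \<tau>" for \<tau> x
    using cos_ge_minus_one[of "exp (- \<tau>) * (\<epsilon> * (x \<bullet> \<xi>))"] by (auto simp: indicator_def)
  have gi: "integrable ?M (?g \<tau>)" for \<tau>
    by (rule M.integrable_const_bound[where B=2]) (use g0 in \<open>auto simp: indicator_def abs_le_iff\<close>)
  have gint: "(\<integral>x. ?g \<tau> x \<partial>?M) = indicator {0..t} \<tau> * (1 - Re (fourier J (\<epsilon> *\<^sub>R (exp (- \<tau>) *\<^sub>R \<xi>))))" for \<tau>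
  proof -
    have "(\<integral>x. ?g \<tau> x \<partial>?M) = indicator {0..t} \<tau> * (\<integral>x. 1 - cos (x \<bullet> (\<epsilon> *\<^sub>R (exp (- \<tau>) *\<^sub>R \<xi>))) \<partial>?M)"
      by (simp only: integral_mult_right_zero inner_scaleR_right mult.left_commute[of "exp (- \<tau>)"])
    also have "(\<integral>x. 1 - cos (x \<bullet> (\<epsilon> *\<^sub>R (exp (- \<tau>) *\<^sub>R \<xi>))) \<partial>?M) = 1 - Re (fourier J (\<epsilon> *\<^sub>R (exp (- \<tau>) *\<^sub>R \<xi>)))"
      using one_minus_charf_integral(2)[OF M.prob_space_axioms, of "\<epsilon> *\<^sub>R (exp (- \<tau>) *\<^sub>R \<xi>)"] charf_density[OF F(1)] by simp
    finally show ?thesis .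
  qed
  have int: "integrable (lborel \<Otimes>\<^sub>M ?M) (\<lambda>(\<tau>, x). ?g \<tau> x)"
  proof (rule P.Fubini_integrable)
    have "integrable lborel (\<lambda>\<tau>. 2 * indicator {0..t} \<tau> :: real)"
      by (intro integrable_mult_right integrable_real_indicator) (auto simp: emeasure_lborel_Icc_eq)
    then show "integrable lborel (\<lambda>\<tau>. \<integral>x. norm (case (\<tau>, x) of (\<tau>, x) \<Rightarrow> ?g \<tau> x) \<partial>?M)"
    proof (rule Bochner_Integration.integrable_bound)
      have "(\<integral>x. norm (?g \<tau> x) \<partial>?M) = (\<integral>x. ?g \<tau> x \<partial>?M)" for \<tau>
        using g0 by (intro Bochner_Integration.integral_cong) (auto simp: abs_of_nonneg)
      moreover have "0 \<le> (\<integral>x. ?g \<tau> x \<partial>?M)" for \<tau> using g0 by (intro integral_nonneg_AE) auto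
      moreover have "(\<integral>x. ?g \<tau> x \<partial>?M) \<le> 2 * indicator {0..t} \<tau>" for \<tau>
        by (rule M.integral_le_const[OF gi]) (use g0 in auto)
      ultimately show "AE \<tau> in lborel. norm (\<integral>x. norm (case (\<tau>, x) of (\<tau>, x) \<Rightarrow> ?g \<tau> x) \<partial>?M) \<le> norm (2 * indicator {0..t} \<tau> :: real)"
        by (intro AE_I2) (simp add: abs_of_nonneg)
    qed measurable
    show "AE \<tau> in lborel. integrable ?M (\<lambda>x. case (\<tau>, x) of (\<tau>, x) \<Rightarrow> ?g \<tau> x)" using gi by simp
  qed measurable
  have i: "set_integrable lborel {0..t} (\<lambda>\<tau>. symb J s \<epsilon> (exp (- \<tau>) *\<^sub>R \<xi>))"
    by (rule symb_dilated_integrable(1)[OF J e, where c=0]) auto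
  have "Re (finexp J s \<epsilon> t \<xi>) = (\<integral>\<tau>. Re (indicator {0..t} \<tau> *\<^sub>R symb J s \<epsilon> (exp (- \<tau>) *\<^sub>R \<xi>)) \<partial>lborel)"
    unfolding finexp_def set_lebesgue_integral_def by (rule integral_Re[OF i[unfolded set_integrable_def], symmetric])
  also have "\<dots> = (\<integral>\<tau>. \<epsilon> powr (- 2 * s) * (\<integral>x. ?g \<tau> x \<partial>?M) \<partial>lborel)"
    unfolding gint by (intro Bochner_Integration.integral_cong) (auto simp: symb_def)
  also have "\<dots> = \<epsilon> powr (- 2 * s) * (\<integral>\<tau>. (\<integral>x. ?g \<tau> x \<partial>?M) \<partial>lborel)" by (rule integral_mult_right_zero)
  also have "(\<integral>\<tau>. (\<integral>x. ?g \<tau> x \<partial>?M) \<partial>lborel) = (\<integral>x. (\<integral>\<tau>. ?g \<tau> x \<partial>lborel) \<partial>?M)"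
    by (rule P.Fubini_integral[OF int, symmetric])
  finally have eq: "Re (finexp J s \<epsilon> t \<xi>) = \<epsilon> powr (- 2 * s) * (\<integral>x. (\<integral>\<tau>. ?g \<tau> x \<partial>lborel) \<partial>?M)" .
  let ?S = "{x. \<bar>x \<bullet> \<xi>\<bar> < h * norm \<xi>}"
  have Sm [measurable]: "?S \<in> sets borel" by measurable
  have indi: "integrable ?M (\<lambda>x. T * indicator ?S x)"
    by (intro integrable_mult_right integrable_real_indicator) (auto simp: M.emeasure_finite less_top[symmetric])
  have "(1 - \<theta>) * T - 3 \<le> (1 - measure ?M ?S) * T - 3"
    using slab T by (intro diff_right_mono mult_right_mono) auto
  also have "\<dots> = (\<integral>x. (T - 3) - T * indicator ?S x \<partial>?M)"
    by (subst Bochner_Integration.integral_diff[OF M.integrable_const indi]) (use M.prob_space in \<open>simp add: algebra_simps\<close>)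
  also have "\<dots> \<le> (\<integral>x. (\<integral>\<tau>. ?g \<tau> x \<partial>lborel) \<partial>?M)"
  proof (rule integral_mono)
    show "integrable ?M (\<lambda>x. \<integral>\<tau>. ?g \<tau> x \<partial>lborel)" by (rule P.integrable_snd[OF int])
    show "integrable ?M (\<lambda>x. (T - 3) - T * indicator ?S x)"
      by (intro Bochner_Integration.integrable_diff indi M.integrable_const)
    fix x
    have g_eq: "(\<integral>\<tau>. ?g \<tau> x \<partial>lborel) = (\<integral>\<tau>\<in>{0..t}. 1 - cos (exp (- \<tau>) * (\<epsilon> * (x \<bullet> \<xi>))) \<partial>lborel)"
      by (simp add: set_lebesgue_integral_def)
    show "(T - 3) - T * indicator ?S x \<le> (\<integral>\<tau>. ?g \<tau> x \<partial>lborel)"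
    proof (cases "x \<in> ?S")
      case True
      have "0 \<le> (\<integral>\<tau>. ?g \<tau> x \<partial>lborel)" using g0 by (intro integral_nonneg_AE) auto
      moreover have "(T - 3) - T * indicator ?S x = - 3" using True by simp
      ultimately show ?thesis by linarith
    next
      case False
      then have "h * norm \<xi> \<le> \<bar>x \<bullet> \<xi>\<bar>" by simp
      then have "\<epsilon> * (h * norm \<xi>) \<le> \<bar>\<epsilon> * (x \<bullet> \<xi>)\<bar>" using e by (simp add: abs_mult)
      then have "T - 3 \<le> (\<integral>\<tau>. ?g \<tau> x \<partial>lborel)"
        unfolding g_eq using T by (intro log_cosine_integral_ge) auto
      then show ?thesis using False by simp
    qed
  qed
  finally show ?thesis unfolding eq by (intro mult_left_mono) auto
qed

section \<open>Comparison of symbols and small-ball estimates\<close>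

lemma ln_le_linear:
  fixes y c p :: real assumes "0 < y" "0 < c" "0 < p"
  shows "p * ln y \<le> c * y + p * ln (p / c)"
proof -
  have "ln (c * y / p) \<le> c * y / p - 1" using assms by (intro ln_le_minus_one) auto
  then have "p * ln (c * y / p) \<le> p * (c * y / p)" using assms by (intro mult_left_mono) auto
  moreover have "ln (c * y / p) = ln y - ln (p / c)"
    using assms by (simp add: ln_div ln_mult)
  ultimately show ?thesis using assms by (simp add: right_diff_distrib)
qed

lemma ln_le_powr_div:
  fixes y c :: real assumes "1 \<le> y" "0 < c"
  shows "ln y \<le> y powr c / c"
proof -
  have "ln (y powr c) \<le> y powr c" using ln_le_minus_one[of "y powr c"] assms by simp
  then show ?thesis using assms by (simp add: ln_powr field_simps)
qed

lemma powr_between: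
  fixes x a b c :: real assumes "0 \<le> x" "a \<le> b" "b \<le> c"
  shows "x powr b \<le> x powr a + x powr c"
proof (cases "x \<le> 1")
  case True
  then have "x powr b \<le> x powr a" using assms by (intro powr_mono') auto
  then show ?thesis by (simp add: add_increasing2)
next
  case False
  then have "x powr b \<le> x powr c" using assms by (intro powr_mono) auto
  then show ?thesis by (simp add: add_increasing)
qed

lemma abs_exp_diff_le:
  fixes a b :: real shows "\<bar>exp a - exp b\<bar> \<le> \<bar>a - b\<bar> * max (exp a) (exp b)"
proof -
  have *: "exp a - exp b \<le> (a - b) * exp a" if "b \<le> a" for a b :: real
  proof -
    have "1 + (b - a) \<le> exp (b - a)" by (rule exp_ge_add_one_self)
    then have "exp a * (1 + (b - a)) \<le> exp a * exp (b - a)" by (intro mult_left_mono) auto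
    then show ?thesis by (simp add: exp_add[symmetric] algebra_simps)
  qed
  show ?thesis
    using *[of b a] *[of a b] by (cases "b \<le> a") (auto simp: max_def abs_if)
qed

text \<open>The logarithm of hypothesis (H2) is absorbed at the origin by z^\<delta> and at infinity
  by an additional power \<kappa>. In the application z = \<epsilon> |\<eta>| and x = |\<eta>|, so a
  bound in terms of \<open>x\<close> is uniform in \<epsilon> \<le> 1.\<close>

lemma powr_log_weight_le:
  fixes z x \<delta> \<kappa> :: real
  assumes z: "0 < z" "z \<le> x" and d: "0 < \<delta>" "0 < \<kappa>"
  shows "z powr \<delta> * max 1 \<bar>ln z\<bar> \<le> (1 + 1/\<delta> + 1/\<kappa>) * (1 + x powr (\<delta> + \<kappa>))"
proof (cases "z \<le> 1")
  case True
  have "\<bar>ln z\<bar> = ln (1 / z)" using z True by (simp add: ln_div)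
  also have "\<dots> \<le> (1 / z) powr \<delta> / \<delta>" using z True d by (intro ln_le_powr_div) auto
  finally have "z powr \<delta> * \<bar>ln z\<bar> \<le> z powr \<delta> * ((1 / z) powr \<delta> / \<delta>)" by (intro mult_left_mono) auto
  also have "\<dots> = 1 / \<delta>" using z by (simp add: powr_divide)
  finally have 1: "z powr \<delta> * \<bar>ln z\<bar> \<le> 1 / \<delta>" .
  have 2: "z powr \<delta> * 1 \<le> 1" using z True d by (simp add: powr_le1)
  have c0: "0 \<le> 1/\<delta>" "0 \<le> 1/\<kappa>" using d by auto
  have "z powr \<delta> * max 1 \<bar>ln z\<bar> \<le> 1 + 1/\<delta> + 1/\<kappa>"
  proof (cases "\<bar>ln z\<bar> \<le> 1")
    case True
    then have "max 1 \<bar>ln z\<bar> = 1" by simp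
    then show ?thesis using 2 c0 by (simp only:)
  next
    case False
    then have "max 1 \<bar>ln z\<bar> = \<bar>ln z\<bar>" by simp
    then show ?thesis using 1 c0 by (simp only:)
  qed
  also have "\<dots> \<le> (1 + 1/\<delta> + 1/\<kappa>) * (1 + x powr (\<delta> + \<kappa>))"
    using mult_left_mono[of 1 "1 + x powr (\<delta> + \<kappa>)" "1 + 1/\<delta> + 1/\<kappa>", OF _ add_nonneg_nonneg[OF add_nonneg_nonneg[OF zero_le_one c0(1)] c0(2)]] by simp
  finally show ?thesis .
next
  case False
  have "max 1 \<bar>ln z\<bar> \<le> (1 + 1/\<kappa>) * z powr \<kappa>"
  proof -
    have "1 \<le> z powr \<kappa>" using False d by (intro ge_one_powr_ge_zero) auto
    moreover have "\<bar>ln z\<bar> \<le> z powr \<kappa> / \<kappa>" using False d ln_le_powr_div[of z \<kappa>] by simp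
    moreover have "0 \<le> z powr \<kappa> / \<kappa>" using d by simp
    ultimately show ?thesis by (simp add: distrib_right)
  qed
  then have "z powr \<delta> * max 1 \<bar>ln z\<bar> \<le> z powr \<delta> * ((1 + 1/\<kappa>) * z powr \<kappa>)" by (intro mult_left_mono) auto
  also have "\<dots> = (1 + 1/\<kappa>) * z powr (\<delta> + \<kappa>)" by (simp add: powr_add)
  also have "\<dots> \<le> (1 + 1/\<delta> + 1/\<kappa>) * (1 + x powr (\<delta> + \<kappa>))"
  proof (rule mult_mono)
    have "z powr (\<delta> + \<kappa>) \<le> x powr (\<delta> + \<kappa>)" using z d by (intro powr_mono2) auto
    then show "z powr (\<delta> + \<kappa>) \<le> 1 + x powr (\<delta> + \<kappa>)" by linarith
  qed (use d in auto)
  finally show ?thesis .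
qed

text \<open>The mean value inequality in the exponent produces 2 (1 - s) |ln x|. For small x the
  logarithm is absorbed by half of the power x, which bounds x^(2s) since 2 s > 1; for large x it is
  absorbed by x^\<kappa>.\<close>

lemma powr_exponent_diff_le:
  fixes x s \<kappa> :: real
  assumes x: "0 < x" and s: "1/2 < s" "s < 1" and k: "0 < \<kappa>"
  shows "\<bar>x powr (2 * s) - x powr 2\<bar> \<le> (1 - s) * ((4 + 2/\<kappa>) * (x powr (1/2) + x powr (2 + \<kappa>)))"
proof -
  have "\<bar>x powr (2 * s) - x powr 2\<bar> \<le> \<bar>2 * s * ln x - 2 * ln x\<bar> * max (x powr (2 * s)) (x powr 2)"
    using abs_exp_diff_le[of "2 * s * ln x" "2 * ln x"] x by (simp add: powr_def)
  also have "\<bar>2 * s * ln x - 2 * ln x\<bar> = 2 * (1 - s) * \<bar>ln x\<bar>"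
  proof -
    have "2 * s * ln x - 2 * ln x = - (2 * (1 - s)) * ln x" by (simp add: algebra_simps)
    then show ?thesis using s by (simp add: abs_mult)
  qed
  also have "2 * (1 - s) * \<bar>ln x\<bar> * max (x powr (2 * s)) (x powr 2) = (1 - s) * (2 * (\<bar>ln x\<bar> * max (x powr (2 * s)) (x powr 2)))" by simp
  also have "\<dots> \<le> (1 - s) * ((4 + 2/\<kappa>) * (x powr (1/2) + x powr (2 + \<kappa>)))"
  proof (rule mult_left_mono)
    show "2 * (\<bar>ln x\<bar> * max (x powr (2 * s)) (x powr 2)) \<le> (4 + 2/\<kappa>) * (x powr (1/2) + x powr (2 + \<kappa>))"
    proof (cases "x \<le> 1")
      case True
      have "max (x powr (2 * s)) (x powr 2) \<le> x powr 1" 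
        using powr_mono'[of 1 "2 * s" x] powr_mono'[of 1 2 x] True x s by simp
      then have "\<bar>ln x\<bar> * max (x powr (2 * s)) (x powr 2) \<le> \<bar>ln x\<bar> * x powr 1" by (intro mult_left_mono) auto
      also have "\<dots> = ln (1 / x) * x powr 1" using x True by (simp add: ln_div)
      also have "\<dots> \<le> ((1 / x) powr (1/2) / (1/2)) * x powr 1"
        using x True by (intro mult_right_mono ln_le_powr_div) auto
      also have "\<dots> = 2 * (x powr 1 / x powr (1/2))" using x by (simp add: powr_divide)
      also have "x powr 1 / x powr (1/2) = x powr (1/2)" unfolding powr_diff[symmetric] by simp
      finally have "2 * (\<bar>ln x\<bar> * max (x powr (2 * s)) (x powr 2)) \<le> 4 * x powr (1/2)" by simp
      also have "\<dots> \<le> (4 + 2/\<kappa>) * (x powr (1/2) + x powr (2 + \<kappa>))" using k by (intro mult_mono) auto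
      finally show ?thesis .
    next
      case False
      have "max (x powr (2 * s)) (x powr 2) \<le> x powr 2" 
        using powr_mono[of "2 * s" 2 x] False s by simp
      then have "\<bar>ln x\<bar> * max (x powr (2 * s)) (x powr 2) \<le> (x powr \<kappa> / \<kappa>) * x powr 2"
        using False k ln_le_powr_div[of x \<kappa>] by (intro mult_mono) (auto simp: le_max_iff_disj)
      also have "\<dots> = x powr (2 + \<kappa>) / \<kappa>" by (simp add: powr_add)
      finally have "2 * (\<bar>ln x\<bar> * max (x powr (2 * s)) (x powr 2)) \<le> (2/\<kappa>) * x powr (2 + \<kappa>)" by simp
      also have "\<dots> \<le> (4 + 2/\<kappa>) * (x powr (1/2) + x powr (2 + \<kappa>))" using k by (intro mult_mono) auto
      finally show ?thesis .
    qed
  qed (use s in simp)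
  finally show ?thesis .
qed

definition close_kernels :: "real \<Rightarrow> real \<Rightarrow> real \<Rightarrow> ('a::euclidean_space \<Rightarrow> real) \<Rightarrow> ('a \<Rightarrow> real) \<Rightarrow> bool" where
  "close_kernels CC \<delta> s J J1 \<longleftrightarrow> 0 < CC \<and> 1/2 < s \<and> s < 1 \<and> (\<forall>\<xi>. \<xi> \<noteq> 0 \<longrightarrow>
       cmod ((1 - fourier J \<xi>) / complex_of_real (norm \<xi> powr (2 * s))
             - (1 - fourier J1 \<xi>) / complex_of_real ((norm \<xi>)\<^sup>2))
         \<le> CC * (1 - s) * norm \<xi> powr \<delta> * max 1 \<bar>ln (norm \<xi>)\<bar>)"

definition symb_const :: "real \<Rightarrow> real \<Rightarrow> real \<Rightarrow> real \<Rightarrow> real" where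
  "symb_const C0 \<delta> CC \<kappa> = 2 * CC * (1 + 1/\<delta> + 1/\<kappa>) + 2 * (4 + 2/\<kappa>) * (C0 + 2)"

text \<open>The symbols are |\<eta>|^(2s) A and |\<eta>|^2 A1, where A and A1 are the quotients
  compared in (H2). Their difference is |\<eta>|^(2s) (A - A1) + (|\<eta>|^(2s) - |\<eta>|^2) A1,
  and either term contains the factor 1 - s; the two summands of \<open>symb_const\<close> belong to
  these terms. The positive power at the origin keeps the bound integrable along the drift.\<close>

lemma symb_diff_le:
  fixes J J1 :: "'a::euclidean_space \<Rightarrow> real"
  assumes cl: "close_kernels CC \<delta> s J J1" and J1: "stable_kernel C0 \<delta> 1 J1"
    and J: "prob_density J" and e: "0 < \<epsilon>" "\<epsilon> \<le> 1" and k: "0 < \<kappa>"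
  shows "cmod (symb J s \<epsilon> \<eta> - symb J1 1 \<epsilon> \<eta>)
    \<le> symb_const C0 \<delta> CC \<kappa> * (1 - s) * (norm \<eta> powr (1/2) + norm \<eta> powr (2 + \<delta> + \<kappa>))"
proof (cases "\<eta> = 0")
  case True
  have "fourier J 0 = 1" "fourier J1 0 = 1"
    using J stable_kernel_facts(1)[OF J1] by (simp_all add: fourier_def prob_density_def)
  then show ?thesis using True by (simp add: symb_def)
next
  case False
  note d = stable_kernel_facts[OF J1]
  have s: "1/2 < s" "s < 1" and CC: "0 < CC" using cl by (auto simp: close_kernels_def)
  define x where "x = norm \<eta>"
  have x: "0 < x" using False by (simp add: x_def)
  define z where "z = \<epsilon> * x"
  have z: "0 < z" "z \<le> x" using x e by (auto simp: z_def)
  have n: "norm (\<epsilon> *\<^sub>R \<eta>) = z" using e by (simp add: x_def z_def)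
  define A where "A = (1 - fourier J (\<epsilon> *\<^sub>R \<eta>)) / complex_of_real (z powr (2 * s))"
  define A1 where "A1 = (1 - fourier J1 (\<epsilon> *\<^sub>R \<eta>)) / complex_of_real (z\<^sup>2)"
  have diff: "cmod (A - A1) \<le> CC * (1 - s) * z powr \<delta> * max 1 \<bar>ln z\<bar>"
  proof -
    have "\<epsilon> *\<^sub>R \<eta> \<noteq> 0" using e False by simp
    then show ?thesis using cl unfolding close_kernels_def A_def A1_def n[symmetric] by blast
  qed
  have z2: "z powr 2 = z\<^sup>2" using z by simp
  have e2: "\<epsilon> powr (- 2 * s) * z powr (2 * s) = x powr (2 * s)" for s
  proof -
    have "\<epsilon> powr (- 2 * s) * z powr (2 * s) = (\<epsilon> powr (- 2 * s) * \<epsilon> powr (2 * s)) * x powr (2 * s)"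
      using e x by (simp add: powr_mult z_def)
    then show ?thesis using e by (simp add: powr_add[symmetric])
  qed
  have "1 - fourier J (\<epsilon> *\<^sub>R \<eta>) = complex_of_real (z powr (2 * s)) * A" using z by (simp add: A_def)
  then have S: "symb J s \<epsilon> \<eta> = complex_of_real (x powr (2 * s)) * A"
    unfolding symb_def e2[symmetric] by simp
  have "1 - fourier J1 (\<epsilon> *\<^sub>R \<eta>) = complex_of_real (z powr (2 * 1)) * A1" using z z2 by (simp add: A1_def)
  then have S1: "symb J1 1 \<epsilon> \<eta> = complex_of_real (x powr 2) * A1"
    unfolding symb_def using e2[of 1] by (simp only: of_real_mult[symmetric] mult.assoc[symmetric]) simp
  have "cmod (1 - fourier J1 (\<epsilon> *\<^sub>R \<eta>)) \<le> (C0 + 2) * z\<^sup>2"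
    using one_minus_fourier_le[OF J1, of "\<epsilon> *\<^sub>R \<eta>"] z2 unfolding n by simp
  then have A1: "cmod A1 \<le> C0 + 2"
    using z by (simp add: A1_def norm_divide divide_le_eq norm_power)
  define P where "P = x powr (1/2) + x powr (2 + \<delta> + \<kappa>)"
  define c1 where "c1 = 1 + 1/\<delta> + 1/\<kappa>"
  define c2 where "c2 = 4 + 2/\<kappa>"
  have c: "0 \<le> c1" "0 \<le> c2" and P0: "0 \<le> P" using d k by (auto simp: c1_def c2_def P_def)
  have 1: "cmod (complex_of_real (x powr (2 * s)) * (A - A1)) \<le> (1 - s) * (2 * CC * c1 * P)"
  proof -
    have "cmod (complex_of_real (x powr (2 * s)) * (A - A1)) \<le> x powr (2 * s) * (CC * (1 - s) * (z powr \<delta> * max 1 \<bar>ln z\<bar>))"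
      using diff by (simp add: norm_mult mult.assoc mult_left_mono)
    also have "\<dots> \<le> x powr (2 * s) * (CC * (1 - s) * (c1 * (1 + x powr (\<delta> + \<kappa>))))"
      unfolding c1_def using CC s by (intro mult_left_mono powr_log_weight_le z d k) auto
    also have "\<dots> = (1 - s) * (CC * c1 * (x powr (2 * s) + x powr (2 * s + \<delta> + \<kappa>)))"
      by (simp add: powr_add algebra_simps)
    also have "\<dots> \<le> (1 - s) * (CC * c1 * (P + P))"
      unfolding P_def using CC s d k x c by (intro mult_left_mono add_mono powr_between) auto
    finally show ?thesis by (simp add: algebra_simps)
  qed
  have 2: "cmod (complex_of_real (x powr (2 * s) - x powr 2) * A1) \<le> (1 - s) * (2 * c2 * (C0 + 2) * P)"
  proof -
    have "cmod (complex_of_real (x powr (2 * s) - x powr 2) * A1) \<le> (1 - s) * (c2 * (x powr (1/2) + x powr (2 + \<kappa>))) * (C0 + 2)"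
      unfolding norm_mult norm_of_real c2_def using s k d x
      by (intro mult_mono powr_exponent_diff_le A1 mult_nonneg_nonneg add_nonneg_nonneg) auto
    also have "\<dots> \<le> (1 - s) * (c2 * (P + P)) * (C0 + 2)"
      unfolding P_def using s d k x c by (intro mult_left_mono mult_right_mono add_mono powr_between) auto
    finally show ?thesis by (simp add: algebra_simps)
  qed
  have "symb J s \<epsilon> \<eta> - symb J1 1 \<epsilon> \<eta> = complex_of_real (x powr (2 * s)) * (A - A1) + complex_of_real (x powr (2 * s) - x powr 2) * A1"
    unfolding S S1 by (simp add: algebra_simps)
  then have "cmod (symb J s \<epsilon> \<eta> - symb J1 1 \<epsilon> \<eta>) \<le> (1 - s) * (2 * CC * c1 * P) + (1 - s) * (2 * c2 * (C0 + 2) * P)"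
    using norm_triangle_le[OF add_mono[OF 1 2]] by simp
  also have "\<dots> = symb_const C0 \<delta> CC \<kappa> * (1 - s) * P"
  proof -
    have "symb_const C0 \<delta> CC \<kappa> = 2 * CC * c1 + 2 * c2 * (C0 + 2)" by (simp only: symb_const_def c1_def c2_def)
    then show ?thesis by (simp add: algebra_simps)
  qed
  finally show ?thesis by (simp add: x_def P_def)
qed

lemma symb_const_nonneg: "0 < C0 \<Longrightarrow> 0 < \<delta> \<Longrightarrow> 0 < CC \<Longrightarrow> 0 < \<kappa> \<Longrightarrow> 0 \<le> symb_const C0 \<delta> CC \<kappa>"
  unfolding symb_const_def by (intro add_nonneg_nonneg mult_nonneg_nonneg divide_nonneg_nonneg) auto

lemma exp_decay_mult_integral:
  fixes b c :: real assumes "0 < b"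
  shows "(\<integral>\<tau>\<in>{0..}. c * exp (- (b * \<tau>)) \<partial>lborel) = c * (1 / b)"
  unfolding set_integral_mult_right exp_decay_integral(2)[OF assms] by simp

text \<open>Along the drift the powers 1/2 and 2 + \<delta> + \<kappa> acquire the factors 2 and at
  most 1, which add up to 3.\<close>

lemma limexp_diff_le:
  fixes J J1 :: "'a::euclidean_space \<Rightarrow> real"
  assumes cl: "close_kernels CC \<delta> s J J1" and J1: "stable_kernel C0 \<delta> 1 J1" and J: "stable_kernel C0 \<delta> s J"
    and e: "0 < \<epsilon>" "\<epsilon> \<le> 1" and k: "0 < \<kappa>"
  shows "cmod (limexp J s \<epsilon> \<xi> - limexp J1 1 \<epsilon> \<xi>)
    \<le> 3 * symb_const C0 \<delta> CC \<kappa> * (1 - s) * max 1 (norm \<xi>) powr (2 + \<delta> + \<kappa>)"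
proof -
  note F = stable_kernel_facts[OF J1]
  have s: "1/2 < s" "s < 1" and CC: "0 < CC" using cl by (auto simp: close_kernels_def)
  define N where "N = 2 + \<delta> + \<kappa>"
  define K where "K = symb_const C0 \<delta> CC \<kappa> * (1 - s)"
  define x where "x = norm \<xi>"
  have N: "2 \<le> N" using F k by (simp add: N_def)
  have K0: "0 \<le> K" using F k CC s by (simp add: K_def symb_const_nonneg)
  have x0: "0 \<le> x" by (simp add: x_def)
  have i: "set_integrable lborel {0..} (\<lambda>\<tau>. symb J s \<epsilon> (exp (- \<tau>) *\<^sub>R \<xi>))"
    "set_integrable lborel {0..} (\<lambda>\<tau>. symb J1 1 \<epsilon> (exp (- \<tau>) *\<^sub>R \<xi>))"
    by (rule symb_dilated_integrable(1)[OF J e(1), where c=0] symb_dilated_integrable(1)[OF J1 e(1), where c=0]; simp)+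
  have i': "set_integrable lborel {0..} (\<lambda>\<tau>. symb J s \<epsilon> (exp (- \<tau>) *\<^sub>R \<xi>) - symb J1 1 \<epsilon> (exp (- \<tau>) *\<^sub>R \<xi>))"
    by (rule set_integral_diff(1)[OF i])
  have E: "set_integrable lborel {0..} (\<lambda>\<tau>. K * x powr (1/2) * exp (- (1/2 * \<tau>)))"
    "set_integrable lborel {0..} (\<lambda>\<tau>. K * x powr N * exp (- (N * \<tau>)))"
    using N by (intro set_integrable_mult_right exp_decay_integral(1); simp)+
  have le: "cmod (symb J s \<epsilon> (exp (- \<tau>) *\<^sub>R \<xi>) - symb J1 1 \<epsilon> (exp (- \<tau>) *\<^sub>R \<xi>))
     \<le> K * x powr (1/2) * exp (- (1/2 * \<tau>)) + K * x powr N * exp (- (N * \<tau>))" for \<tau>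
  proof -
    have p: "norm (exp (- \<tau>) *\<^sub>R \<xi>) powr q = x powr q * exp (- (q * \<tau>))" for q
      by (simp add: powr_mult x_def) (simp add: powr_def)
    show ?thesis
      using symb_diff_le[OF cl J1 stable_kernel_facts(1)[OF J] e k, of "exp (- \<tau>) *\<^sub>R \<xi>"]
      unfolding p N_def[symmetric] K_def[symmetric] by (simp add: distrib_left mult.assoc)
  qed
  have eq: "limexp J s \<epsilon> \<xi> - limexp J1 1 \<epsilon> \<xi> = (\<integral>\<tau>\<in>{0..}. symb J s \<epsilon> (exp (- \<tau>) *\<^sub>R \<xi>) - symb J1 1 \<epsilon> (exp (- \<tau>) *\<^sub>R \<xi>) \<partial>lborel)"
    unfolding limexp_def by (rule set_integral_diff(2)[OF i, symmetric])
  have "cmod (limexp J s \<epsilon> \<xi> - limexp J1 1 \<epsilon> \<xi>) \<le> (\<integral>\<tau>\<in>{0..}. K * x powr (1/2) * exp (- (1/2 * \<tau>)) + K * x powr N * exp (- (N * \<tau>)) \<partial>lborel)"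
    unfolding eq set_lebesgue_integral_def
  proof (rule Bochner_Integration.integral_norm_bound_integral[OF i'[unfolded set_integrable_def] set_integral_add(1)[OF E, unfolded set_integrable_def]])
    fix \<tau> :: real
    show "norm (indicator {0..} \<tau> *\<^sub>R (symb J s \<epsilon> (exp (- \<tau>) *\<^sub>R \<xi>) - symb J1 1 \<epsilon> (exp (- \<tau>) *\<^sub>R \<xi>)))
      \<le> indicator {0..} \<tau> *\<^sub>R (K * x powr (1/2) * exp (- (1/2 * \<tau>)) + K * x powr N * exp (- (N * \<tau>)))"
      using le[of \<tau>] by (cases "0 \<le> \<tau>") (simp_all only: indicator_simps atLeast_iff scaleR_one scaleR_zero_left norm_zero order_refl not_False_eq_True not_le)
  qed
  also have "\<dots> = (\<integral>\<tau>\<in>{0..}. K * x powr (1/2) * exp (- (1/2 * \<tau>)) \<partial>lborel) + (\<integral>\<tau>\<in>{0..}. K * x powr N * exp (- (N * \<tau>)) \<partial>lborel)"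
    by (rule set_integral_add(2)[OF E])
  also have "(\<integral>\<tau>\<in>{0..}. K * x powr (1/2) * exp (- (1/2 * \<tau>)) \<partial>lborel) = K * x powr (1/2) * (1 / (1/2))"
    by (rule exp_decay_mult_integral) simp
  also have "(\<integral>\<tau>\<in>{0..}. K * x powr N * exp (- (N * \<tau>)) \<partial>lborel) = K * x powr N * (1 / N)"
    using N by (intro exp_decay_mult_integral) simp
  also have "K * x powr (1/2) * (1 / (1/2)) + K * x powr N * (1 / N) \<le> K * max 1 x powr N * 2 + K * max 1 x powr N * 1"
  proof (intro add_mono mult_mono mult_left_mono)
    have "x powr (1/2) \<le> max 1 x powr (1/2)" using x0 by (intro powr_mono2) auto
    also have "\<dots> \<le> max 1 x powr N" using N by (intro powr_mono) auto
    finally show "x powr (1/2) \<le> max 1 x powr N" .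
    show "x powr N \<le> max 1 x powr N" using x0 N by (intro powr_mono2) auto
  qed (use K0 N in auto)
  also have "\<dots> = 3 * K * max 1 x powr N" by simp
  finally show ?thesis by (simp add: K_def x_def N_def mult.assoc)
qed

section \<open>Mass of thin slabs, uniformly in the direction and in s\<close>

lemma gauss_integrable_1d: "0 < \<sigma> \<Longrightarrow> integrable lborel (\<lambda>t::real. exp (- (\<sigma>\<^sup>2 * t\<^sup>2 / 2)))"
  using integrable_norm[OF fourier_gauss_1d(1)[of \<sigma> 0]] by (simp add: norm_mult)

lemma abs_powr_gauss_integrable:
  fixes p h :: real
  assumes p: "0 < p" and h: "0 < h"
  shows "integrable lborel (\<lambda>t. \<bar>t\<bar> powr p * exp (- (h\<^sup>2 * t\<^sup>2 / 2)))"
proof -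
  \<comment> \<open>Half of the Gaussian exponent, corresponding to this \<sigma>, is kept for
    integrability; the other half absorbs the power.\<close>
  define \<sigma> where "\<sigma> = h / sqrt 2"
  have \<sigma>: "0 < \<sigma>" "\<sigma>\<^sup>2 = h\<^sup>2 / 2" using h by (auto simp: \<sigma>_def power_divide)
  let ?K = "exp (p / 2 * ln (p / 2 / (h\<^sup>2 / 4)))"
  show ?thesis
  proof (rule Bochner_Integration.integrable_bound[OF integrable_mult_right[OF gauss_integrable_1d[OF \<sigma>(1)], of ?K]])
    have "\<bar>t\<bar> powr p * exp (- (h\<^sup>2 * t\<^sup>2 / 2)) \<le> ?K * exp (- (\<sigma>\<^sup>2 * t\<^sup>2 / 2))" for t
    proof (cases "t = 0")
      case False
      have "p / 2 * ln (t\<^sup>2) \<le> h\<^sup>2 / 4 * t\<^sup>2 + p / 2 * ln (p / 2 / (h\<^sup>2 / 4))"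
        using False h p by (intro ln_le_linear) auto
      moreover have "p / 2 * ln (t\<^sup>2) = p * ln \<bar>t\<bar>"
        using False ln_realpow[of "\<bar>t\<bar>" 2] by simp
      ultimately have calculation: "p * ln \<bar>t\<bar> \<le> h\<^sup>2 / 4 * t\<^sup>2 + p / 2 * ln (p / 2 / (h\<^sup>2 / 4))" by linarith
      have "p * ln \<bar>t\<bar> - h\<^sup>2 * t\<^sup>2 / 2 \<le> p / 2 * ln (p / 2 / (h\<^sup>2 / 4)) - \<sigma>\<^sup>2 * t\<^sup>2 / 2"
      proof -
        have "h\<^sup>2 / 4 * t\<^sup>2 = (h\<^sup>2 * t\<^sup>2) / 4" "h\<^sup>2 / 2 * t\<^sup>2 / 2 = (h\<^sup>2 * t\<^sup>2) / 4" by simp_all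
        then show ?thesis using calculation unfolding \<sigma>(2) by linarith
      qed
      then have "exp (p * ln \<bar>t\<bar> - h\<^sup>2 * t\<^sup>2 / 2) \<le> exp (p / 2 * ln (p / 2 / (h\<^sup>2 / 4)) - \<sigma>\<^sup>2 * t\<^sup>2 / 2)" by simp
      moreover have "\<bar>t\<bar> powr p * exp (- (h\<^sup>2 * t\<^sup>2 / 2)) = exp (p * ln \<bar>t\<bar> - h\<^sup>2 * t\<^sup>2 / 2)"
        using False by (simp only: powr_def mult_exp_exp abs_eq_0_iff if_False add_uminus_conv_diff)
      moreover have "?K * exp (- (\<sigma>\<^sup>2 * t\<^sup>2 / 2)) = exp (p / 2 * ln (p / 2 / (h\<^sup>2 / 4)) - \<sigma>\<^sup>2 * t\<^sup>2 / 2)"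
        by (simp only: mult_exp_exp add_uminus_conv_diff)
      ultimately show ?thesis by (simp only:)
    qed simp
    then show "AE t in lborel. norm (\<bar>t\<bar> powr p * exp (- (h\<^sup>2 * t\<^sup>2 / 2))) \<le> norm (?K * exp (- (\<sigma>\<^sup>2 * t\<^sup>2 / 2)))"
      by (intro AE_I2) simp
  qed measurable
qed

text \<open>A Gaussian profile across the hyperplane orthogonal to \<omega> replaces the indicator
  of a slab. Its mean is an integral of the transform of \<open>J\<close> over a line, hence can be
  compared between different kernels by means of their symbols.\<close>

lemma gaussian_test_fourier:
  fixes J :: "'a::euclidean_space \<Rightarrow> real"
  assumes J: "prob_density J" and h: "0 < h"
  shows "complex_of_real (\<integral>x. exp (- ((x \<bullet> \<omega>)\<^sup>2 / (2 * h\<^sup>2))) \<partial>density lborel (\<lambda>x. ennreal (J x)))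
    = complex_of_real (h / sqrt (2 * pi)) * (\<integral>t. fourier J (t *\<^sub>R \<omega>) * complex_of_real (exp (- (h\<^sup>2 * t\<^sup>2 / 2))) \<partial>lborel)"
proof -
  let ?M = "density lborel (\<lambda>x. ennreal (J x))"
  have [measurable]: "J \<in> borel_measurable borel" using J by (auto simp: prob_density_def)
  interpret M: prob_space ?M by (rule prob_space_prob_density[OF J])
  interpret P: pair_sigma_finite lborel ?M ..
  let ?F = "\<lambda>t x. cis (- ((x \<bullet> \<omega>) * t)) * complex_of_real (exp (- (h\<^sup>2 * t\<^sup>2 / 2)))"
  have int: "integrable (lborel \<Otimes>\<^sub>M ?M) (\<lambda>(t, x). ?F t x)"
  proof (rule P.Fubini_integrable)
    show "integrable lborel (\<lambda>t. \<integral>x. norm (case (t, x) of (t, x) \<Rightarrow> ?F t x) \<partial>?M)"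
      using gauss_integrable_1d[OF h] M.prob_space by (simp add: norm_mult)
    show "AE t in lborel. integrable ?M (\<lambda>x. case (t, x) of (t, x) \<Rightarrow> ?F t x)"
      by (intro AE_I2) (auto intro!: M.cis_integrable)
  qed measurable
  have "(\<integral>t. fourier J (t *\<^sub>R \<omega>) * complex_of_real (exp (- (h\<^sup>2 * t\<^sup>2 / 2))) \<partial>lborel) = (\<integral>t. (\<integral>x. ?F t x \<partial>?M) \<partial>lborel)"
    unfolding charf_density[OF J, symmetric] charf_def by (simp add: mult.commute)
  also have "\<dots> = (\<integral>x. (\<integral>t. ?F t x \<partial>lborel) \<partial>?M)" by (rule P.Fubini_integral[OF int, symmetric])
  also have "\<dots> = (\<integral>x. complex_of_real (sqrt (2 * pi) / h * exp (- ((x \<bullet> \<omega>)\<^sup>2 / (2 * h\<^sup>2)))) \<partial>?M)"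
    by (simp only: fourier_gauss_1d(2)[OF h])
  also have "\<dots> = complex_of_real (sqrt (2 * pi) / h) * complex_of_real (\<integral>x. exp (- ((x \<bullet> \<omega>)\<^sup>2 / (2 * h\<^sup>2))) \<partial>?M)"
    by (simp only: integral_complex_of_real integral_mult_right_zero of_real_mult)
  finally show ?thesis using h by simp
qed

text \<open>Every hyperplane is a null set for a law with a density, so each single direction has a
  suitable width. Compactness of the unit sphere makes the width independent of the
  direction.\<close>

lemma gaussian_test_uniform:
  fixes J :: "'a::euclidean_space \<Rightarrow> real"
  assumes J: "prob_density J" and c: "0 < c"
  shows "\<exists>h>0. \<forall>\<omega>. norm \<omega> = 1 \<longrightarrow> (\<integral>x. exp (- ((x \<bullet> \<omega>)\<^sup>2 / (2 * h\<^sup>2))) \<partial>density lborel (\<lambda>x. ennreal (J x))) \<le> c"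
proof (rule ccontr)
  let ?M = "density lborel (\<lambda>x. ennreal (J x))"
  have [measurable]: "J \<in> borel_measurable borel" using J by (auto simp: prob_density_def)
  interpret M: prob_space ?M by (rule prob_space_prob_density[OF J])
  assume "\<not> ?thesis"
  then have neg: "\<exists>\<omega>. norm \<omega> = 1 \<and> c < (\<integral>x. exp (- ((x \<bullet> \<omega>)\<^sup>2 / (2 * h\<^sup>2))) \<partial>?M)" if "0 < h" for h
    using that by (auto simp: not_le)
  \<comment> \<open>Violating directions for the widths 1/(n + 1). Along a subsequence they converge
    to a unit vector \<open>l\<close>, and off the null hyperplane orthogonal to \<open>l\<close>
    the profiles tend to 0, which contradicts the lower bound \<open>c\<close>.\<close>
  have "\<exists>w. \<forall>n. norm (w n) = 1 \<and> c < (\<integral>x. exp (- ((x \<bullet> w n)\<^sup>2 / (2 * (1 / real (Suc n))\<^sup>2))) \<partial>?M)"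
    by (intro choice allI neg) simp
  then obtain w where w: "\<And>n. norm (w n) = 1" "\<And>n. c < (\<integral>x. exp (- ((x \<bullet> w n)\<^sup>2 / (2 * (1 / real (Suc n))\<^sup>2))) \<partial>?M)"
    by blast
  have "compact (sphere (0::'a) 1)" by simp
  moreover have "\<forall>n. w n \<in> sphere 0 1" using w by simp
  ultimately obtain l r where l: "l \<in> sphere 0 1" and r: "strict_mono r" and lim: "(w \<circ> r) \<longlonglongrightarrow> l"
    unfolding compact_def by metis
  have l0: "l \<noteq> 0" using l by auto
  let ?f = "\<lambda>n x. exp (- ((x \<bullet> w (r n))\<^sup>2 / (2 * (1 / real (Suc (r n)))\<^sup>2)))"
  have "(\<lambda>n. \<integral>x. ?f n x \<partial>?M) \<longlonglongrightarrow> (\<integral>x. 0 \<partial>?M)"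
  proof (rule integral_dominated_convergence[where w="\<lambda>_. 1"])
    have "AE x in lebesgue. x \<notin> {x. l \<bullet> x = 0}"
      using negligible_hyperplane[of l 0] l0 by (intro AE_not_in) (simp add: negligible_iff_null_sets)
    then have "AE x in lborel. l \<bullet> x \<noteq> 0" by (simp add: AE_completion_iff)
    then have "AE x in ?M. l \<bullet> x \<noteq> 0" by (subst AE_density) auto
    then show "AE x in ?M. (\<lambda>n. ?f n x) \<longlonglongrightarrow> 0"
    proof eventually_elim
      case (elim x)
      have "(\<lambda>n. (x \<bullet> w (r n))\<^sup>2 / 2) \<longlonglongrightarrow> (x \<bullet> l)\<^sup>2 / 2"
        using lim by (intro tendsto_intros) (auto simp: o_def)
      moreover have "0 < (x \<bullet> l)\<^sup>2 / 2" using elim by (simp add: inner_commute)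
      moreover have "filterlim (\<lambda>n. (real (Suc (r n)))\<^sup>2) at_top sequentially"
      proof (rule filterlim_at_top_mono[OF filterlim_real_sequentially always_eventually], rule allI)
        fix n
        have "real n \<le> real (Suc (r n))" using seq_suble[OF r, of n] by simp
        also have "\<dots> \<le> (real (Suc (r n)))\<^sup>2" by (rule self_le_power) auto
        finally show "real n \<le> (real (Suc (r n)))\<^sup>2" .
      qed
      ultimately have "filterlim (\<lambda>n. (x \<bullet> w (r n))\<^sup>2 / 2 * (real (Suc (r n)))\<^sup>2) at_top sequentially"
        by (rule filterlim_tendsto_pos_mult_at_top)
      then have "(\<lambda>n. exp (- ((x \<bullet> w (r n))\<^sup>2 / 2 * (real (Suc (r n)))\<^sup>2))) \<longlonglongrightarrow> 0"
        by (intro filterlim_compose[OF exp_at_bot]) (simp add: filterlim_uminus_at_bot)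
      then show ?case by (simp add: power_divide)
    qed
  qed auto
  then have "(\<lambda>n. \<integral>x. ?f n x \<partial>?M) \<longlonglongrightarrow> 0" by simp
  then have "c \<le> 0"
    by (rule LIMSEQ_le_const) (use w(2) in \<open>auto intro!: exI[of _ 0] less_imp_le\<close>)
  then show False using c by simp
qed

text \<open>Chebyshev's inequality: on the slab the profile is at least e^(-1/2), hence at least
  1/2.\<close>

lemma slab_le_gaussian_test:
  fixes J :: "'a::euclidean_space \<Rightarrow> real"
  assumes J: "prob_density J" and h: "0 < h" and c: "\<And>\<omega>. norm \<omega> = 1 \<Longrightarrow> (\<integral>x. exp (- ((x \<bullet> \<omega>)\<^sup>2 / (2 * h\<^sup>2))) \<partial>density lborel (\<lambda>x. ennreal (J x))) \<le> c" "0 \<le> c"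
  shows "measure (density lborel (\<lambda>x. ennreal (J x))) {x. \<bar>x \<bullet> \<xi>\<bar> < h * norm \<xi>} \<le> 2 * c"
proof (cases "\<xi> = 0")
  case False
  let ?M = "density lborel (\<lambda>x. ennreal (J x))"
  have [measurable]: "J \<in> borel_measurable borel" using J by (auto simp: prob_density_def)
  interpret M: prob_space ?M by (rule prob_space_prob_density[OF J])
  define \<omega> where "\<omega> = \<xi> /\<^sub>R norm \<xi>"
  have \<omega>: "norm \<omega> = 1" using False by (simp add: \<omega>_def)
  have xi: "\<xi> = norm \<xi> *\<^sub>R \<omega>" using False by (simp add: \<omega>_def)
  let ?S = "{x. \<bar>x \<bullet> \<xi>\<bar> < h * norm \<xi>}"
  let ?g = "\<lambda>x. exp (- ((x \<bullet> \<omega>)\<^sup>2 / (2 * h\<^sup>2)))"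
  have Sm: "?S \<in> sets ?M" by simp
  have gi: "integrable ?M ?g" by (rule M.integrable_const_bound[where B=1]) auto
  have "measure ?M ?S = (\<integral>x. indicator ?S x \<partial>?M)" using Sm by simp
  also have "\<dots> \<le> (\<integral>x. 2 * ?g x \<partial>?M)"
  proof (rule integral_mono)
    show "integrable ?M (\<lambda>x. indicator ?S x :: real)"
      by (intro integrable_real_indicator Sm) (auto simp: M.emeasure_finite less_top[symmetric])
    show "integrable ?M (\<lambda>x. 2 * ?g x)" using gi by simp
    fix x
    show "indicator ?S x \<le> 2 * ?g x"
    proof (cases "x \<in> ?S")
      case True
      have "norm \<xi> * \<bar>x \<bullet> \<omega>\<bar> < h * norm \<xi>"
        using True by (subst (asm) xi) (simp add: abs_mult \<omega>)
      then have "\<bar>x \<bullet> \<omega>\<bar> < h" using False by (simp add: mult.commute)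
      then have "(x \<bullet> \<omega>)\<^sup>2 \<le> h\<^sup>2" using h by (intro abs_le_square_iff[THEN iffD1]) auto
      then have "(x \<bullet> \<omega>)\<^sup>2 / (2 * h\<^sup>2) \<le> 1/2" using h by (simp add: divide_le_eq)
      then have "exp (- (1/2)) \<le> ?g x" by simp
      moreover have "1 + (- (1/2)) \<le> exp (- (1/2::real))" by (rule exp_ge_add_one_self)
      ultimately have "1 \<le> 2 * ?g x" by linarith
      then show ?thesis using True by simp
    qed simp
  qed
  also have "\<dots> = 2 * (\<integral>x. ?g x \<partial>?M)" by simp
  also have "\<dots> \<le> 2 * c" using c(1)[OF \<omega>] by simp
  finally show ?thesis .
qed (use c in simp)

text \<open>The width \<open>h\<close> is chosen for the limit kernel alone, with a Gaussian test of
  at most \<theta>/4. The comparison of symbols changes the test by O(1 - s), hence by at most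
  another \<theta>/4 for s close to 1, and the passage from the test to the slab doubles \<theta>/2
  to \<theta>.\<close>

lemma slab_uniform:
  fixes J :: "real \<Rightarrow> 'a::euclidean_space \<Rightarrow> real"
  assumes J: "\<And>s. 1/2 < s \<Longrightarrow> s < 1 \<Longrightarrow> prob_density (J s) \<and> close_kernels CC \<delta> s (J s) J1"
    and J1: "stable_kernel C0 \<delta> 1 J1" and th: "0 < \<theta>"
  shows "\<exists>h>0. \<exists>s0<1. (\<forall>\<xi>. measure (density lborel (\<lambda>x. ennreal (J1 x))) {x. \<bar>x \<bullet> \<xi>\<bar> < h * norm \<xi>} \<le> \<theta>) \<and>
    (\<forall>s. 1/2 < s \<longrightarrow> s0 \<le> s \<longrightarrow> s < 1 \<longrightarrow> (\<forall>\<xi>. measure (density lborel (\<lambda>x. ennreal (J s x))) {x. \<bar>x \<bullet> \<xi>\<bar> < h * norm \<xi>} \<le> \<theta>))"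
proof -
  note F = stable_kernel_facts[OF J1]
  obtain h where h: "0 < h" and h1: "\<And>\<omega>. norm \<omega> = 1 \<Longrightarrow> (\<integral>x. exp (- ((x \<bullet> \<omega>)\<^sup>2 / (2 * h\<^sup>2))) \<partial>density lborel (\<lambda>x. ennreal (J1 x))) \<le> \<theta> / 4"
    using gaussian_test_uniform[OF F(1), of "\<theta>/4"] th by auto
  define N where "N = 2 + \<delta> + 1"
  define W where "W t = (\<bar>t\<bar> powr (1/2) + \<bar>t\<bar> powr N) * exp (- (h\<^sup>2 * t\<^sup>2 / 2))" for t :: real
  have Wi: "integrable lborel W"
    unfolding W_def[abs_def] distrib_right using F h
    by (intro Bochner_Integration.integrable_add abs_powr_gauss_integrable) (auto simp: N_def)
  define K where "K = h / sqrt (2 * pi) * (symb_const C0 \<delta> CC 1 * (\<integral>t. W t \<partial>lborel))"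
  have CC: "0 < CC" using J[of "3/4"] by (auto simp: close_kernels_def)
  have K0: "0 \<le> K" unfolding K_def using h F CC
    by (intro mult_nonneg_nonneg divide_nonneg_nonneg symb_const_nonneg integral_nonneg_AE) (auto simp: W_def)
  \<comment> \<open>This makes K (1 - s) at most \<theta>/4 for s \<ge> s0; the denominator
    \<open>K + 1\<close> is positive even if \<open>K\<close> vanishes.\<close>
  define s0 where "s0 = 1 - \<theta> / 4 / (K + 1)"
  have s0: "s0 < 1" using th K0 by (simp add: s0_def divide_pos_pos)
  have main: "(\<integral>x. exp (- ((x \<bullet> \<omega>)\<^sup>2 / (2 * h\<^sup>2))) \<partial>density lborel (\<lambda>x. ennreal (J s x))) \<le> \<theta> / 2"
    if s: "1/2 < s" "s0 \<le> s" "s < 1" and \<omega>: "norm \<omega> = 1" for s \<omega>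
  proof -
    let ?E = "\<lambda>J. \<integral>x. exp (- ((x \<bullet> \<omega>)\<^sup>2 / (2 * h\<^sup>2))) \<partial>density lborel (\<lambda>x. ennreal (J x))"
    have Js: "prob_density (J s)" and cl: "close_kernels CC \<delta> s (J s) J1" using J s by auto
    let ?g = "\<lambda>t. exp (- (h\<^sup>2 * t\<^sup>2 / 2)) :: real"
    have fi: "integrable lborel (\<lambda>t. fourier f (t *\<^sub>R \<omega>) * complex_of_real (?g t))" if f: "prob_density f" for f
    proof (rule Bochner_Integration.integrable_bound[OF gauss_integrable_1d[OF h]])
      have [measurable]: "f \<in> borel_measurable borel" using f by (auto simp: prob_density_def)
      show "(\<lambda>t. fourier f (t *\<^sub>R \<omega>) * complex_of_real (?g t)) \<in> borel_measurable lborel" by measurable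
      show "AE t in lborel. norm (fourier f (t *\<^sub>R \<omega>) * complex_of_real (?g t)) \<le> norm (?g t)"
        using norm_fourier_prob_density[OF f] by (auto simp: norm_mult intro!: mult_left_le_one_le)
    qed
    have le: "cmod (fourier (J s) (t *\<^sub>R \<omega>) * complex_of_real (?g t) - fourier J1 (t *\<^sub>R \<omega>) * complex_of_real (?g t))
       \<le> symb_const C0 \<delta> CC 1 * (1 - s) * W t" for t
    proof -
      \<comment> \<open>At \<epsilon> = 1 the symbol is one minus the transform, so
        \<open>symb_diff_le\<close> compares the transforms themselves.\<close>
      have "cmod (fourier (J s) (t *\<^sub>R \<omega>) - fourier J1 (t *\<^sub>R \<omega>)) = cmod (symb (J s) s 1 (t *\<^sub>R \<omega>) - symb J1 1 1 (t *\<^sub>R \<omega>))"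
        by (simp add: symb_def norm_minus_commute)
      also have "\<dots> \<le> symb_const C0 \<delta> CC 1 * (1 - s) * (\<bar>t\<bar> powr (1/2) + \<bar>t\<bar> powr N)"
        using symb_diff_le[OF cl J1 Js, of 1 1 "t *\<^sub>R \<omega>"] \<omega> by (simp add: N_def)
      finally have "cmod (fourier (J s) (t *\<^sub>R \<omega>) - fourier J1 (t *\<^sub>R \<omega>)) * ?g t \<le> symb_const C0 \<delta> CC 1 * (1 - s) * (\<bar>t\<bar> powr (1/2) + \<bar>t\<bar> powr N) * ?g t"
        by (intro mult_right_mono) auto
      moreover have "fourier (J s) (t *\<^sub>R \<omega>) * complex_of_real (?g t) - fourier J1 (t *\<^sub>R \<omega>) * complex_of_real (?g t)
         = (fourier (J s) (t *\<^sub>R \<omega>) - fourier J1 (t *\<^sub>R \<omega>)) * complex_of_real (?g t)" by (rule left_diff_distrib[symmetric])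
      ultimately show ?thesis by (simp add: norm_mult W_def mult.assoc)
    qed
    have eq: "complex_of_real (?E (J s) - ?E J1) = complex_of_real (h / sqrt (2 * pi)) *
      (\<integral>t. fourier (J s) (t *\<^sub>R \<omega>) * complex_of_real (?g t) - fourier J1 (t *\<^sub>R \<omega>) * complex_of_real (?g t) \<partial>lborel)"
      unfolding of_real_diff gaussian_test_fourier[OF Js h] gaussian_test_fourier[OF F(1) h]
        Bochner_Integration.integral_diff[OF fi[OF Js] fi[OF F(1)]] by (rule right_diff_distrib[symmetric])
    have "\<bar>?E (J s) - ?E J1\<bar> = cmod (complex_of_real (?E (J s) - ?E J1))" by (simp only: norm_of_real)
    also have "\<dots> = h / sqrt (2 * pi) * cmod (\<integral>t. fourier (J s) (t *\<^sub>R \<omega>) * complex_of_real (?g t) - fourier J1 (t *\<^sub>R \<omega>) * complex_of_real (?g t) \<partial>lborel)"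
      unfolding eq norm_mult norm_of_real using h by simp
    also have "\<dots> \<le> h / sqrt (2 * pi) * (\<integral>t. symb_const C0 \<delta> CC 1 * (1 - s) * W t \<partial>lborel)"
      using h by (intro mult_left_mono Bochner_Integration.integral_norm_bound_integral le
          Bochner_Integration.integrable_diff fi Js F(1) integrable_mult_right Wi) auto
    also have "\<dots> = K * (1 - s)" by (simp add: K_def)
    also have "\<dots> \<le> K * (\<theta> / 4 / (K + 1))" using K0 s by (intro mult_left_mono) (auto simp: s0_def)
    also have "\<dots> \<le> \<theta> / 4"
    proof -
      have "K / (K + 1) \<le> 1" using K0 by simp
      then have "K / (K + 1) * (\<theta> / 4) \<le> 1 * (\<theta> / 4)" using th by (intro mult_right_mono) auto
      moreover have "K * (\<theta> / 4 / (K + 1)) = K / (K + 1) * (\<theta> / 4)" by simp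
      ultimately show ?thesis by linarith
    qed
    finally show ?thesis using h1[OF \<omega>] by linarith
  qed
  show ?thesis
  proof (intro exI conjI allI impI)
    show "0 < h" "s0 < 1" by fact+
    show "measure (density lborel (\<lambda>x. ennreal (J1 x))) {x. \<bar>x \<bullet> \<xi>\<bar> < h * norm \<xi>} \<le> \<theta>" for \<xi>
      using slab_le_gaussian_test[OF F(1) h h1, of \<xi>] th by simp
    show "measure (density lborel (\<lambda>x. ennreal (J s x))) {x. \<bar>x \<bullet> \<xi>\<bar> < h * norm \<xi>} \<le> \<theta>" if "1/2 < s" "s0 \<le> s" "s < 1" for s \<xi>
      using slab_le_gaussian_test[OF _ h main, of s \<xi>] that th J by simp
  qed
qed

section \<open>Decay and distance of the equilibria\<close>

definition dec :: "real \<Rightarrow> 'a::real_normed_vector \<Rightarrow> real" where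
  "dec r \<xi> = (if norm \<xi> \<le> 1 then 1 else norm \<xi> powr (- r))"

lemma dec_pos: "0 < dec r \<xi>" by (auto simp: dec_def)

lemma dec_measurable [measurable]: "dec r \<in> borel_measurable borel"
  unfolding dec_def[abs_def] by measurable

lemma dec_eq: "dec r \<xi> = max 1 (norm \<xi>) powr (- r)"
  by (auto simp: dec_def max_def)

lemma nn_integral_dec_1d:
  assumes "1 < r" shows "(\<integral>\<^sup>+t. ennreal (dec r (t::real)) \<partial>lborel) < \<infinity>"
proof -
  have half: "(\<integral>\<^sup>+t. ennreal (t powr (- r)) * indicator {1..} t \<partial>lborel) = ennreal (- (1 powr (- r + 1)) / (- r + 1))"
    by (rule nn_integral_has_integral_lebesgue'[OF _ has_integral_powr_to_inf]) (use assms in auto)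
  have half': "(\<integral>\<^sup>+t. ennreal ((- t) powr (- r)) * indicator {1..} (- t) \<partial>lborel) = ennreal (- (1 powr (- r + 1)) / (- r + 1))"
    unfolding half[symmetric]
    by (subst (2) nn_integral_real_affine[where c="-1" and t=0]) auto
  have "(\<integral>\<^sup>+t. ennreal (dec r (t::real)) \<partial>lborel)
    \<le> (\<integral>\<^sup>+t. indicator {-1..1} t + (ennreal (t powr (- r)) * indicator {1..} t + ennreal ((- t) powr (- r)) * indicator {1..} (- t)) \<partial>lborel)"
    by (intro nn_integral_mono) (auto simp: dec_def indicator_def abs_if)
  also have "\<dots> = ennreal 2 + (ennreal (- (1 powr (- r + 1)) / (- r + 1)) + ennreal (- (1 powr (- r + 1)) / (- r + 1)))"
    by (simp add: nn_integral_add half half')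
  also have "\<dots> < \<infinity>" by simp
  finally show ?thesis .
qed

text \<open>The number max 1 |\<xi>| dominates its analogue for every coordinate. So
  \<open>dec r\<close> is bounded by a product of one-dimensional profiles with exponent r/d > 1,
  each of which is integrable.\<close>

lemma dec_integrable:
  assumes r: "real DIM('a) < r" shows "integrable lborel (dec r :: 'a::euclidean_space \<Rightarrow> real)"
proof -
  let ?r = "r / real DIM('a)"
  have D: "0 < real DIM('a)" by simp
  have r1: "1 < ?r" using r D by (simp add: less_divide_eq)
  have r0: "0 < r" using r D by linarith
  have le: "dec r \<xi> \<le> (\<Prod>b\<in>Basis. dec ?r (\<xi> \<bullet> b))" for \<xi> :: 'a
  proof -
    have "dec r \<xi> = (\<Prod>b\<in>(Basis::'a set). max 1 (norm \<xi>) powr (- ?r))"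
      using D by (simp add: dec_eq powr_realpow[symmetric] powr_powr)
    also have "\<dots> \<le> (\<Prod>b\<in>Basis. dec ?r (\<xi> \<bullet> b))"
    proof (rule prod_mono, intro conjI)
      fix b :: 'a assume "b \<in> Basis"
      then have "max 1 (norm (\<xi> \<bullet> b)) \<le> max 1 (norm \<xi>)" using Basis_le_norm[of b \<xi>] by auto
      then show "max 1 (norm \<xi>) powr (- ?r) \<le> dec ?r (\<xi> \<bullet> b)"
        unfolding dec_eq using r1 by (intro powr_mono2') auto
    qed simp
    finally show ?thesis .
  qed
  have "(\<integral>\<^sup>+\<xi>. ennreal (dec r (\<xi>::'a)) \<partial>lborel) \<le> integral\<^sup>N lborel (\<lambda>\<xi>::'a. \<Prod>b\<in>Basis. ennreal (dec ?r (\<xi> \<bullet> b)))"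
    using le by (intro nn_integral_mono) (simp add: prod_ennreal dec_pos less_imp_le ennreal_leI)
  also have "\<dots> = (\<Prod>b\<in>(Basis::'a set). (\<integral>\<^sup>+t. ennreal (dec ?r (t::real)) \<partial>lborel))"
    by (rule nn_integral_lborel_prod) auto
  also have "\<dots> < \<infinity>"
    using nn_integral_dec_1d[OF r1] by (simp add: power_less_top_ennreal)
  finally show ?thesis
    by (intro integrableI_nonneg) (auto simp: dec_pos less_imp_le)
qed

text \<open>Interpolation between the Lipschitz bound M |a - b|, valid because the modulus of exp on
  the segment does not exceed its values at the ends, and the trivial bound 2 M.\<close>

lemma cmod_exp_diff_le:
  fixes a b :: complex
  assumes "0 \<le> \<beta>" "\<beta> \<le> 1" "cmod (exp a) \<le> M" "cmod (exp b) \<le> M"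
  shows "cmod (exp a - exp b) \<le> 2 * M * cmod (a - b) powr \<beta>"
proof (cases "cmod (a - b) \<le> 1")
  case True
  have M: "0 \<le> M" using assms(3) norm_ge_zero order_trans by blast
  have "convex (closed_segment a b)" by simp
  have bound: "cmod (exp z) \<le> M" if z: "z \<in> closed_segment a b" for z
  proof -
    obtain u where u: "0 \<le> u" "u \<le> 1" "z = (1 - u) *\<^sub>R a + u *\<^sub>R b" using z unfolding in_segment by blast
    have "Re z = (1 - u) * Re a + u * Re b" using u by simp
    also have "\<dots> \<le> max (Re a) (Re b)" using u(1,2) by (intro convex_bound_le) auto
    finally have "cmod (exp z) \<le> exp (max (Re a) (Re b))" by simp
    also have "\<dots> \<le> M" using assms(3,4) by (auto simp: max_def)
    finally show ?thesis .
  qed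
  have "cmod (exp a - exp b) \<le> M * cmod (a - b)"
  proof (rule field_differentiable_bound[of "closed_segment a b" exp exp M])
    show "\<And>z. z \<in> closed_segment a b \<Longrightarrow> (exp has_field_derivative exp z) (at z within closed_segment a b)"
      by (intro DERIV_exp has_field_derivative_at_within)
  qed (use bound in simp_all)
  also have "\<dots> \<le> M * cmod (a - b) powr \<beta>"
  proof (rule mult_left_mono[OF _ M])
    show "cmod (a - b) \<le> cmod (a - b) powr \<beta>"
      using powr_mono'[of \<beta> 1 "cmod (a - b)"] True assms by (cases "a = b") auto
  qed
  also have "\<dots> \<le> 2 * M * cmod (a - b) powr \<beta>" using M by (intro mult_right_mono) auto
  finally show ?thesis .
next
  case False
  have M: "0 \<le> M" using assms(3) norm_ge_zero order_trans by blast
  have "cmod (exp a - exp b) \<le> M + M" by (rule order_trans[OF norm_triangle_ineq4 add_mono[OF assms(3,4)]])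
  also have "\<dots> = 2 * M * 1" by simp
  also have "\<dots> \<le> 2 * M * cmod (a - b) powr \<beta>"
    using False M assms by (intro mult_left_mono ge_one_powr_ge_zero) auto
  finally show ?thesis .
qed

text \<open>The jump rate \<open>\<epsilon> powr (- 2 * s)\<close> turns the logarithmic growth of the exponent into
  polynomial decay. Its excess over \<open>q\<close> absorbs, through the lower bound \<open>r0\<^sup>2 / 4\<close> of the exponent,
  the factor \<open>\<epsilon> powr (- p)\<close> lost by rescaling.\<close>
lemma uniform_decay:
  fixes r0 C0 \<delta> h \<theta> q :: real
  assumes r: "0 < r0" "r0 \<le> 1" "C0 * r0 powr \<delta> \<le> 1/2" and h: "0 < h" and th: "\<theta> < 1" and q: "0 < q"
  shows "\<exists>C\<ge>1. \<forall>(J::'a::euclidean_space \<Rightarrow> real) s \<epsilon>. stable_kernel C0 \<delta> s J \<longrightarrow> 0 < \<epsilon> \<longrightarrow> \<epsilon> \<le> 1 \<longrightarrow> q \<le> \<epsilon> powr (- 2 * s) \<longrightarrow>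
    (\<forall>\<xi>. measure (density lborel (\<lambda>x. ennreal (J x))) {x. \<bar>x \<bullet> \<xi>\<bar> < h * norm \<xi>} \<le> \<theta>) \<longrightarrow>
    (\<forall>\<xi>. cmod (exp (- limexp J s \<epsilon> \<xi>)) \<le> C * dec ((1 - \<theta>) * q) \<xi>)"
proof -
  define p where "p = (1 - \<theta>) * q"
  have p: "0 < p" using th q by (simp add: p_def)
  define c0 where "c0 = r0\<^sup>2 / 4"
  have c0: "0 < c0" using r by (simp add: c0_def)
  define K where "K = \<bar>p * ln (p / (1/4))\<bar> + \<bar>p * ln h\<bar> + 3 * q + q * c0 + \<bar>p * ln (p / c0)\<bar>"
  have K0: "0 \<le> K" using q c0 by (simp add: K_def)
  have main: "p * ln (norm \<xi>) - K \<le> Re (limexp J s \<epsilon> \<xi>)"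
    if J: "stable_kernel C0 \<delta> s J" and e: "0 < \<epsilon>" "\<epsilon> \<le> 1" and a: "q \<le> \<epsilon> powr (- 2 * s)"
      and slab: "measure (density lborel (\<lambda>x. ennreal (J x))) {x. \<bar>x \<bullet> \<xi>\<bar> < h * norm \<xi>} \<le> \<theta>" and x: "1 < norm \<xi>"
    for J :: "'a \<Rightarrow> real" and s \<epsilon> \<xi>
  proof -
    note F = stable_kernel_facts[OF J]
    define a where "a = \<epsilon> powr (- 2 * s)"
    have a0: "0 < a" "q \<le> a" using e a by (auto simp: a_def)
    let ?E = "Re (limexp J s \<epsilon> \<xi>)"
    have x0: "0 < norm \<xi>" using x by linarith
    show ?thesis
    proof (cases "\<epsilon> * norm \<xi> \<le> r0")
      case True
      have "norm \<xi> powr 1 \<le> norm \<xi> powr (2 * s)" using x F by (intro powr_mono) auto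
      moreover have "(exp (- 0) * norm \<xi>) powr (2 * s) / 4 \<le> ?E"
        by (rule Re_limexp_ge[OF J e(1) r(2,3)]) (use True in auto)
      ultimately have "1/4 * norm \<xi> \<le> ?E" using x0 by simp
      moreover have "p * ln (norm \<xi>) \<le> 1/4 * norm \<xi> + p * ln (p / (1/4))"
        using x0 p by (intro ln_le_linear) auto
      moreover have "0 \<le> 3 * q" "0 \<le> q * c0" using q c0 by auto
      ultimately show ?thesis unfolding K_def by linarith
    next
      case False
      \<comment> \<open>The time at which the drift has brought the scaled frequency down to exactly
        \<open>r0\<close>.\<close>
      define c where "c = ln (\<epsilon> * norm \<xi> / r0)"
      have c: "0 \<le> c" "\<epsilon> * (exp (- c) * norm \<xi>) = r0"
        using False r e x0 by (auto simp: c_def exp_minus field_simps)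
      have ec: "exp (- c) * norm \<xi> = r0 / \<epsilon>" using c(2) e by (simp add: field_simps)
      have "(exp (- c) * norm \<xi>) powr (2 * s) / 4 \<le> ?E"
        by (rule Re_limexp_ge[OF J e(1) r(2,3) c(1)]) (use c in auto)
      moreover have "(exp (- c) * norm \<xi>) powr (2 * s) = a * r0 powr (2 * s)"
        unfolding ec a_def using r e by (simp add: powr_divide powr_minus_divide)
      moreover have "a * r0 powr 2 \<le> a * r0 powr (2 * s)" using r F a0 by (intro mult_left_mono powr_mono') auto
      moreover have "r0 powr 2 = r0\<^sup>2" using r by simp
      ultimately have E1: "a * c0 \<le> ?E" by (simp add: c0_def)
      have E2: "a * (p / q * ln (\<epsilon> * (h * norm \<xi>)) - 3) \<le> ?E"
      proof (cases "1 \<le> \<epsilon> * (h * norm \<xi>)")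
        case True
        let ?T = "ln (\<epsilon> * (h * norm \<xi>))"
        have "a * ((1 - \<theta>) * ?T - 3) \<le> Re (finexp J s \<epsilon> ?T \<xi>)"
          unfolding a_def by (rule Re_finexp_ge_log[OF J e(1) slab]) (use True in auto)
        also have "\<dots> \<le> ?E" by (rule Re_finexp_le_limexp[OF J e(1)])
        finally show ?thesis using q by (simp add: p_def)
      next
        case False
        then have "ln (\<epsilon> * (h * norm \<xi>)) \<le> 0" using e h x0 by (subst ln_le_zero_iff) auto
        then have "p / q * ln (\<epsilon> * (h * norm \<xi>)) \<le> 0" using p q by (intro mult_nonneg_nonpos) auto
        then have "p / q * ln (\<epsilon> * (h * norm \<xi>)) - 3 \<le> 0" by linarith
        then have "a * (p / q * ln (\<epsilon> * (h * norm \<xi>)) - 3) \<le> 0" using a0 by (intro mult_nonneg_nonpos) auto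
        also have "0 \<le> ?E" by (rule Re_limexp_nonneg[OF J e(1)])
        finally show ?thesis .
      qed
      have "q / a * (a * (p / q * ln (\<epsilon> * (h * norm \<xi>)) - 3)) + (1 - q / a) * (a * c0) \<le> q / a * ?E + (1 - q / a) * ?E"
        using q a0 by (intro add_mono mult_left_mono E1 E2) auto
      then have "p * ln (\<epsilon> * (h * norm \<xi>)) - 3 * q + (a - q) * c0 \<le> ?E"
        using q a0 by (simp add: algebra_simps)
      moreover have "ln (\<epsilon> * (h * norm \<xi>)) = ln (norm \<xi>) + ln h - ln (1 / \<epsilon>)"
        using e h x0 by (simp add: ln_mult ln_div)
      moreover have "p * ln (1 / \<epsilon>) \<le> c0 * (1 / \<epsilon>) + p * ln (p / c0)"
        using e p c0 by (intro ln_le_linear) auto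
      moreover have "c0 * (1 / \<epsilon>) \<le> c0 * a"
      proof (rule mult_left_mono)
        have "\<epsilon> powr (- 1) \<le> \<epsilon> powr (- 2 * s)" using e F by (intro powr_mono') auto
        then show "1 / \<epsilon> \<le> a" using e by (simp add: a_def powr_minus_divide)
      qed (use c0 in simp)
      ultimately show ?thesis unfolding K_def by (simp add: algebra_simps)
    qed
  qed
  show ?thesis
  proof (intro exI[of _ "exp K"] conjI allI impI)
    show "1 \<le> exp K" using K0 by simp
    fix J :: "'a \<Rightarrow> real" and s \<epsilon> and \<xi> :: 'a
    assume A: "stable_kernel C0 \<delta> s J" "0 < \<epsilon>" "\<epsilon> \<le> 1" "q \<le> \<epsilon> powr (- 2 * s)"
      "\<forall>\<xi>. measure (density lborel (\<lambda>x. ennreal (J x))) {x. \<bar>x \<bullet> \<xi>\<bar> < h * norm \<xi>} \<le> \<theta>"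
    show "cmod (exp (- limexp J s \<epsilon> \<xi>)) \<le> exp K * dec ((1 - \<theta>) * q) \<xi>"
    proof (cases "norm \<xi> \<le> 1")
      case True
      have "cmod (exp (- limexp J s \<epsilon> \<xi>)) \<le> 1" using Re_limexp_nonneg[OF A(1,2)] by simp
      also have "\<dots> \<le> exp K" using K0 by simp
      finally show ?thesis using True by (simp add: dec_def)
    next
      case False
      then have "- Re (limexp J s \<epsilon> \<xi>) \<le> K - p * ln (norm \<xi>)" using main[OF A(1-4), of \<xi>] A(5) by simp
      then have "exp (- Re (limexp J s \<epsilon> \<xi>)) \<le> exp (K - p * ln (norm \<xi>))" by simp
      also have "\<dots> = exp K * norm \<xi> powr (- p)"
      proof -
        have "\<xi> \<noteq> 0" using False by auto
        then show ?thesis by (simp add: powr_def mult_exp_exp)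
      qed
      finally show ?thesis using False by (simp add: dec_def p_def)
    qed
  qed
qed

lemma limexp_measurable [measurable]:
  assumes "stable_kernel C0 \<delta> s J"
  shows "limexp J s \<epsilon> \<in> borel_measurable borel" "finexp J s \<epsilon> t \<in> borel_measurable borel"
  using symb_measurable[OF assms] unfolding limexp_def[abs_def] finexp_def[abs_def] set_lebesgue_integral_def by measurable

text \<open>Interpolating the exponent difference, which is of order \<open>1 - s\<close>, with the trivial bound
  costs a power \<open>\<beta>\<close> but brings the growth down to what the decay of the equilibria allows.\<close>
lemma equilibrium_fourier_diff:
  fixes J J1 :: "'a::euclidean_space \<Rightarrow> real"
  assumes cl: "close_kernels CC \<delta> s J J1" and J1: "stable_kernel C0 \<delta> 1 J1" and J: "stable_kernel C0 \<delta> s J"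
    and e: "0 < \<epsilon>" "\<epsilon> \<le> 1" and k: "0 < \<kappa>" and b: "0 < \<beta>" "\<beta> \<le> 1" and C: "1 \<le> C"
    and d: "\<And>\<xi>. cmod (exp (- limexp J s \<epsilon> \<xi>)) \<le> C * dec p \<xi>" "\<And>\<xi>. cmod (exp (- limexp J1 1 \<epsilon> \<xi>)) \<le> C * dec p \<xi>"
    and p: "\<beta> * (2 + \<delta> + \<kappa>) + real DIM('a) / 2 < p"
  shows "(\<integral>\<^sup>+\<xi>. ennreal ((cmod (exp (- limexp J s \<epsilon> \<xi>) - exp (- limexp J1 1 \<epsilon> \<xi>)))\<^sup>2) \<partial>lborel)
    \<le> ennreal ((2 * C * (3 * symb_const C0 \<delta> CC \<kappa>) powr \<beta> * (1 - s) powr \<beta>)\<^sup>2 *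
        integral\<^sup>L lborel (dec (2 * p - 2 * (\<beta> * (2 + \<delta> + \<kappa>))) :: 'a \<Rightarrow> real))"
proof -
  define N where "N = 2 + \<delta> + \<kappa>"
  have s: "1/2 < s" "s < 1" and CC: "0 < CC" using cl by (auto simp: close_kernels_def)
  have S0: "0 \<le> symb_const C0 \<delta> CC \<kappa>" using stable_kernel_facts[OF J1] CC k by (intro symb_const_nonneg) auto
  let ?K = "2 * C * (3 * symb_const C0 \<delta> CC \<kappa>) powr \<beta> * (1 - s) powr \<beta>"
  have le: "(cmod (exp (- limexp J s \<epsilon> \<xi>) - exp (- limexp J1 1 \<epsilon> \<xi>)))\<^sup>2 \<le> ?K\<^sup>2 * dec (2 * p - 2 * (\<beta> * N)) \<xi>" for \<xi>
  proof -
    let ?m = "max 1 (norm \<xi>)"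
    have "cmod (exp (- limexp J s \<epsilon> \<xi>) - exp (- limexp J1 1 \<epsilon> \<xi>)) \<le> 2 * (C * dec p \<xi>) * cmod (- limexp J s \<epsilon> \<xi> - (- limexp J1 1 \<epsilon> \<xi>)) powr \<beta>"
      using b by (intro cmod_exp_diff_le d) auto
    also have "cmod (- limexp J s \<epsilon> \<xi> - (- limexp J1 1 \<epsilon> \<xi>)) = cmod (limexp J s \<epsilon> \<xi> - limexp J1 1 \<epsilon> \<xi>)"
      by (simp add: norm_minus_commute)
    also have "2 * (C * dec p \<xi>) * cmod (limexp J s \<epsilon> \<xi> - limexp J1 1 \<epsilon> \<xi>) powr \<beta>
      \<le> 2 * (C * dec p \<xi>) * (3 * symb_const C0 \<delta> CC \<kappa> * (1 - s) * ?m powr N) powr \<beta>"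
      using b C dec_pos[of p \<xi>] limexp_diff_le[OF cl J1 J e k, of \<xi>]
      by (intro mult_left_mono powr_mono2) (auto simp: N_def)
    also have "(3 * symb_const C0 \<delta> CC \<kappa> * (1 - s) * ?m powr N) powr \<beta>
       = (3 * symb_const C0 \<delta> CC \<kappa>) powr \<beta> * (1 - s) powr \<beta> * ?m powr (\<beta> * N)"
      using S0 s by (simp add: powr_mult powr_powr mult.commute)
    also have "2 * (C * dec p \<xi>) * ((3 * symb_const C0 \<delta> CC \<kappa>) powr \<beta> * (1 - s) powr \<beta> * ?m powr (\<beta> * N)) = ?K * (dec p \<xi> * ?m powr (\<beta> * N))"
      by simp
    also have "dec p \<xi> * ?m powr (\<beta> * N) = ?m powr (\<beta> * N - p)"
      unfolding dec_eq by (simp add: powr_add[symmetric])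
    finally have "(cmod (exp (- limexp J s \<epsilon> \<xi>) - exp (- limexp J1 1 \<epsilon> \<xi>)))\<^sup>2 \<le> (?K * ?m powr (\<beta> * N - p))\<^sup>2"
      by (intro power_mono) auto
    also have "\<dots> = ?K\<^sup>2 * (?m powr (\<beta> * N - p) * ?m powr (\<beta> * N - p))"
      by (simp only: power_mult_distrib power2_eq_square[of "?m powr (\<beta> * N - p)"])
    also have "?m powr (\<beta> * N - p) * ?m powr (\<beta> * N - p) = dec (2 * p - 2 * (\<beta> * N)) \<xi>"
      unfolding dec_eq by (simp add: powr_add[symmetric] algebra_simps)
    finally show ?thesis .
  qed
  have di: "integrable lborel (dec (2 * p - 2 * (\<beta> * N)) :: 'a \<Rightarrow> real)"
    using p by (intro dec_integrable) (simp add: N_def)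
  have "(\<integral>\<^sup>+\<xi>. ennreal ((cmod (exp (- limexp J s \<epsilon> \<xi>) - exp (- limexp J1 1 \<epsilon> \<xi>)))\<^sup>2) \<partial>lborel)
    \<le> (\<integral>\<^sup>+\<xi>. ennreal (?K\<^sup>2 * dec (2 * p - 2 * (\<beta> * N)) (\<xi>::'a)) \<partial>lborel)"
    by (intro nn_integral_mono ennreal_leI le)
  also have "\<dots> = ennreal (integral\<^sup>L lborel (\<lambda>\<xi>::'a. ?K\<^sup>2 * dec (2 * p - 2 * (\<beta> * N)) \<xi>))"
    by (intro nn_integral_eq_integral integrable_mult_right di AE_I2 mult_nonneg_nonneg) (auto simp: dec_pos less_imp_le)
  finally show ?thesis by (simp add: N_def)
qed

section \<open>From the equilibria back to large finite times\<close>

lemma exp_neg_tendsto_0: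
  fixes b :: real assumes "0 < b" shows "((\<lambda>t. exp (- (b * t))) \<longlongrightarrow> 0) at_top"
proof (rule filterlim_compose[OF exp_at_bot])
  have "filterlim (\<lambda>t. b * t) at_top at_top"
    by (rule filterlim_tendsto_pos_mult_at_top[OF tendsto_const assms filterlim_ident])
  then show "filterlim (\<lambda>t. - (b * t)) at_bot at_top" by (simp add: filterlim_uminus_at_bot)
qed

lemma sum_squares_le_double: "(x + y)\<^sup>2 \<le> 2 * x\<^sup>2 + 2 * (y::real)\<^sup>2"
  using sum_squares_bound[of x y] by (simp add: power2_sum)

text \<open>At time t the logarithm of the exponent saturates at t, so beyond |\<xi>| = e^t there is
  no further decay in \<xi>. But what has been reached there is already exponentially small in t,
  with the exponent p of the equilibrium.\<close>

lemma finexp_tail_decay: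
  fixes J :: "'a::euclidean_space \<Rightarrow> real"
  assumes J: "stable_kernel C0 \<delta> s J" and e: "0 < \<epsilon>" and h: "0 < h" and th: "\<theta> < 1" and q: "0 < q" "q \<le> \<epsilon> powr (- 2 * s)"
    and slab: "\<And>\<xi>. measure (density lborel (\<lambda>x. ennreal (J x))) {x. \<bar>x \<bullet> \<xi>\<bar> < h * norm \<xi>} \<le> \<theta>"
  shows "\<exists>C>0. \<exists>t0. \<forall>t\<ge>t0. \<forall>\<xi>. exp t \<le> norm \<xi> \<longrightarrow> cmod (exp (- finexp J s \<epsilon> t \<xi>)) \<le> C * exp (- ((1 - \<theta>) * q * t))"
proof -
  \<comment> \<open>A delay with e^(-K) \<le> \<epsilon> h, so that T = t - K is admissible in the
    logarithmic lower bound once |\<xi>| \<ge> e^t.\<close>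
  define K where "K = max 0 (- ln (\<epsilon> * h))"
  let ?a = "\<epsilon> powr (- 2 * s)"
  define p where "p = (1 - \<theta>) * q"
  have eh: "0 < \<epsilon> * h" using e h by simp
  have main: "p * t - (p * K + 3 * ?a) \<le> Re (finexp J s \<epsilon> t \<xi>)" if t: "K \<le> t" and x: "exp t \<le> norm \<xi>" for t \<xi>
  proof -
    have "exp (- K) \<le> exp (ln (\<epsilon> * h))" unfolding K_def by simp
    then have "exp (- K) \<le> \<epsilon> * h" using eh by simp
    then have "exp (- K) * exp t \<le> \<epsilon> * h * norm \<xi>" using x eh by (intro mult_mono) auto
    then have T: "exp (t - K) \<le> \<epsilon> * (h * norm \<xi>)" by (simp add: mult_exp_exp mult.assoc)
    have "?a * ((1 - \<theta>) * (t - K) - 3) \<le> Re (finexp J s \<epsilon> t \<xi>)"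
      by (rule Re_finexp_ge_log[OF J e slab _ _ T]) (use t in \<open>auto simp: K_def\<close>)
    moreover have "q * ((1 - \<theta>) * (t - K)) \<le> ?a * ((1 - \<theta>) * (t - K))"
      using th q t by (intro mult_right_mono) auto
    ultimately show ?thesis by (simp add: p_def algebra_simps)
  qed
  show ?thesis
  proof (rule exI[of _ "exp (p * K + 3 * ?a)"], rule conjI, simp, rule exI[of _ K], intro allI impI)
    fix t \<xi> assume "K \<le> t" "exp t \<le> norm (\<xi>::'a)"
    then have "exp (- Re (finexp J s \<epsilon> t \<xi>)) \<le> exp ((p * K + 3 * ?a) + - (p * t))" using main[of t \<xi>] by simp
    then show "cmod (exp (- finexp J s \<epsilon> t \<xi>)) \<le> exp (p * K + 3 * ?a) * exp (- ((1 - \<theta>) * q * t))"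
      unfolding p_def[symmetric] mult_exp_exp by simp
  qed
qed

text \<open>The contracted datum concentrates, and its squared L^2 norm grows like e^(d t). The tail
  bound above has to beat this growth, which is the reason for the condition d/2 < p.\<close>

lemma nn_integral_fourier_dilated:
  fixes f :: "'a::euclidean_space \<Rightarrow> real"
  assumes f: "integrable lborel f" "integrable lborel (\<lambda>x. (f x)\<^sup>2)"
  shows "(\<integral>\<^sup>+\<xi>. ennreal ((cmod (fourier f (exp (- t) *\<^sub>R \<xi>)))\<^sup>2) \<partial>lborel)
    \<le> ennreal (exp (real DIM('a) * t) * ((2 * pi) ^ DIM('a) * (\<integral>x. (f x)\<^sup>2 \<partial>lborel)))"
proof -
  have [measurable]: "f \<in> borel_measurable borel" using f by auto
  have "(\<integral>\<^sup>+\<xi>. ennreal ((cmod (fourier f (exp (- t) *\<^sub>R \<xi>)))\<^sup>2) \<partial>lborel)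
    = ennreal (\<bar>exp t\<bar> ^ DIM('a)) * (\<integral>\<^sup>+\<xi>. ennreal ((cmod (fourier f (exp (- t) *\<^sub>R (0 + exp t *\<^sub>R \<xi>))))\<^sup>2) \<partial>lborel)"
    by (rule nn_integral_affine) auto
  also have "\<dots> = ennreal (exp (real DIM('a) * t)) * (\<integral>\<^sup>+\<xi>. ennreal ((cmod (fourier f \<xi>))\<^sup>2) \<partial>lborel)"
    by (simp add: exp_of_DIM_mult mult_exp_exp)
  also have "\<dots> \<le> ennreal (exp (real DIM('a) * t)) * ennreal ((2 * pi) ^ DIM('a) * (\<integral>x. (f x)\<^sup>2 \<partial>lborel))"
    by (intro mult_left_mono nn_integral_fourier_le f) simp
  finally show ?thesis by (simp add: ennreal_mult'[symmetric])
qed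

text \<open>For |\<xi>| \<le> e^t the orbit has entered the unit ball by time t, so the part of the
  exponent accumulated afterwards is at most \<open>C0 + 2\<close>. The finite-time law then decays
  like the equilibrium up to a fixed factor.\<close>

lemma finexp_low_frequency_bound:
  fixes J :: "'a::euclidean_space \<Rightarrow> real"
  assumes J: "stable_kernel C0 \<delta> s J" and e: "0 < \<epsilon>" and t: "0 \<le> t" "norm \<xi> \<le> exp t"
    and d: "cmod (exp (- limexp J s \<epsilon> \<xi>)) \<le> C * dec p \<xi>"
  shows "cmod (exp (- finexp J s \<epsilon> t \<xi>)) \<le> exp (C0 + 2) * C * dec p \<xi>"
proof -
  note F = stable_kernel_facts[OF J]
  have "cmod (limexp J s \<epsilon> \<xi> - finexp J s \<epsilon> t \<xi>) \<le> (C0 + 2) * norm \<xi> powr (2 * s) * exp (- (2 * s * t))"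
    by (rule norm_limexp_minus_finexp_le[OF J e t(1)])
  also have "\<dots> \<le> (C0 + 2) * exp t powr (2 * s) * exp (- (2 * s * t))"
    using F t by (intro mult_right_mono mult_left_mono powr_mono2) auto
  also have "\<dots> = C0 + 2" by (simp add: powr_def mult.assoc mult_exp_exp)
  finally have "Re (limexp J s \<epsilon> \<xi> - finexp J s \<epsilon> t \<xi>) \<le> C0 + 2"
    using complex_Re_le_cmod order_trans by blast
  then have "cmod (exp (limexp J s \<epsilon> \<xi> - finexp J s \<epsilon> t \<xi>)) \<le> exp (C0 + 2)" by simp
  then have "cmod (exp (limexp J s \<epsilon> \<xi> - finexp J s \<epsilon> t \<xi>)) * cmod (exp (- limexp J s \<epsilon> \<xi>)) \<le> exp (C0 + 2) * (C * dec p \<xi>)"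
    by (intro mult_mono d) auto
  then show ?thesis unfolding norm_mult[symmetric] mult_exp_exp by (simp add: mult.assoc)
qed

lemma finexp_tendsto:
  fixes J :: "'a::euclidean_space \<Rightarrow> real"
  assumes J: "stable_kernel C0 \<delta> s J" and e: "0 < \<epsilon>"
  shows "((\<lambda>t. finexp J s \<epsilon> t \<xi>) \<longlongrightarrow> limexp J s \<epsilon> \<xi>) at_top"
proof -
  note F = stable_kernel_facts[OF J]
  have "((\<lambda>t. exp (- (2 * s * t))) \<longlongrightarrow> 0) at_top"
    using exp_neg_tendsto_0[of "2 * s"] F by simp
  then have l: "((\<lambda>t. (C0 + 2) * norm \<xi> powr (2 * s) * exp (- (2 * s * t))) \<longlongrightarrow> 0) at_top"
    by (rule tendsto_mult_right_zero)
  have "((\<lambda>t. finexp J s \<epsilon> t \<xi> - limexp J s \<epsilon> \<xi>) \<longlongrightarrow> 0) at_top"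
  proof (rule Lim_null_comparison[OF _ l])
    show "\<forall>\<^sub>F t in at_top. norm (finexp J s \<epsilon> t \<xi> - limexp J s \<epsilon> \<xi>) \<le> (C0 + 2) * norm \<xi> powr (2 * s) * exp (- (2 * s * t))"
      using eventually_ge_at_top[of 0]
      by eventually_elim (subst norm_minus_commute, rule norm_limexp_minus_finexp_le[OF J e])
  qed
  then show ?thesis by (simp add: LIM_zero_iff)
qed

text \<open>The frequencies are split at |\<xi>| = e^t. Below, \<open>dec p\<close> dominates and
  its square is integrable as 2 p > d, so the integral converges to that of the equilibria. Above,
  the exponential smallness e^(-2 p t) beats the factor e^(d t) from the contracted data.\<close>

theorem evolution_L2_limit:
  fixes J J1 f g :: "'a::euclidean_space \<Rightarrow> real"
  assumes J: "stable_kernel C0 \<delta> s J" and J1: "stable_kernel C0 \<delta> s1 J1" and e: "0 < \<epsilon>" and h: "0 < h" and th: "\<theta> < 1"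
    and q: "0 < q" "q \<le> \<epsilon> powr (- 2 * s)" "q \<le> \<epsilon> powr (- 2 * s1)"
    and slab: "\<And>\<xi>. measure (density lborel (\<lambda>x. ennreal (J x))) {x. \<bar>x \<bullet> \<xi>\<bar> < h * norm \<xi>} \<le> \<theta>"
      "\<And>\<xi>. measure (density lborel (\<lambda>x. ennreal (J1 x))) {x. \<bar>x \<bullet> \<xi>\<bar> < h * norm \<xi>} \<le> \<theta>"
    and p: "p = (1 - \<theta>) * q" "real DIM('a) / 2 < p"
    and d: "\<And>\<xi>. cmod (exp (- limexp J s \<epsilon> \<xi>)) \<le> C * dec p \<xi>" "\<And>\<xi>. cmod (exp (- limexp J1 s1 \<epsilon> \<xi>)) \<le> C * dec p \<xi>"
    and f: "integrable lborel f" "integrable lborel (\<lambda>x. (f x)\<^sup>2)" "(\<integral>x. f x \<partial>lborel) = 1"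
    and g: "integrable lborel g" "integrable lborel (\<lambda>x. (g x)\<^sup>2)" "(\<integral>x. g x \<partial>lborel) = 1"
    and E: "(\<integral>\<^sup>+\<xi>. ennreal ((cmod (exp (- limexp J s \<epsilon> \<xi>) - exp (- limexp J1 s1 \<epsilon> \<xi>)))\<^sup>2) \<partial>lborel) \<le> ennreal E" "0 \<le> E" and c: "0 < c"
  shows "\<forall>\<^sub>F t in at_top. (\<integral>\<^sup>+\<xi>. ennreal ((cmod (fourier f (exp (- t) *\<^sub>R \<xi>) * exp (- finexp J s \<epsilon> t \<xi>)
     - fourier g (exp (- t) *\<^sub>R \<xi>) * exp (- finexp J1 s1 \<epsilon> t \<xi>)))\<^sup>2) \<partial>lborel) \<le> ennreal (E + c)"
proof -
  note [measurable] = limexp_measurable[OF J] limexp_measurable[OF J1]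
  have [measurable]: "f \<in> borel_measurable borel" "g \<in> borel_measurable borel" using f g by auto
  have C0: "0 \<le> C" using order_trans[OF norm_ge_zero d(1)[of 0]] by (simp add: dec_def)
  define H where "H t \<xi> = fourier f (exp (- t) *\<^sub>R \<xi>) * exp (- finexp J s \<epsilon> t \<xi>)
     - fourier g (exp (- t) *\<^sub>R \<xi>) * exp (- finexp J1 s1 \<epsilon> t \<xi>)" for t \<xi>
  have [measurable]: "H t \<in> borel_measurable borel" for t unfolding H_def by measurable
  define nf where "nf = (\<integral>x. \<bar>f x\<bar> \<partial>lborel)"
  define ng where "ng = (\<integral>x. \<bar>g x\<bar> \<partial>lborel)"
  have nfg: "0 \<le> nf" "0 \<le> ng" by (auto simp: nf_def ng_def)
  define W where "W = (nf + ng) * (exp (C0 + 2) * C)"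
  let ?A = "\<lambda>t \<xi>. indicator {\<xi>. norm \<xi> \<le> exp t} \<xi> * (cmod (H t \<xi>))\<^sup>2 :: real"
  let ?L = "\<lambda>\<xi>. (cmod (exp (- limexp J s \<epsilon> \<xi>) - exp (- limexp J1 s1 \<epsilon> \<xi>)))\<^sup>2"
  have wi: "integrable lborel (\<lambda>\<xi>::'a. W\<^sup>2 * dec (2 * p) \<xi>)"
    using p by (intro integrable_mult_right dec_integrable) auto
  have A_le: "?A t \<xi> \<le> W\<^sup>2 * dec (2 * p) \<xi>" if t: "0 \<le> t" for t \<xi>
  proof (cases "norm \<xi> \<le> exp t")
    case True
    have "cmod (H t \<xi>) \<le> cmod (fourier f (exp (- t) *\<^sub>R \<xi>)) * cmod (exp (- finexp J s \<epsilon> t \<xi>))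
       + cmod (fourier g (exp (- t) *\<^sub>R \<xi>)) * cmod (exp (- finexp J1 s1 \<epsilon> t \<xi>))"
      unfolding H_def norm_mult[symmetric] by (rule norm_triangle_ineq4)
    also have "\<dots> \<le> nf * (exp (C0 + 2) * C * dec p \<xi>) + ng * (exp (C0 + 2) * C * dec p \<xi>)"
      unfolding nf_def ng_def
      by (intro add_mono mult_mono norm_fourier_le f g finexp_low_frequency_bound[OF J e t True d(1)] finexp_low_frequency_bound[OF J1 e t True d(2)]) auto
    also have "\<dots> = W * dec p \<xi>" by (simp add: W_def algebra_simps)
    finally have "(cmod (H t \<xi>))\<^sup>2 \<le> (W * dec p \<xi>)\<^sup>2" by (intro power_mono) auto
    also have "\<dots> = W\<^sup>2 * dec (2 * p) \<xi>"
      by (simp only: power_mult_distrib power2_eq_square[of "dec p \<xi>"]) (simp add: dec_eq powr_add[symmetric])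
    finally show ?thesis using True by simp
  qed (auto simp: dec_pos less_imp_le)
  have lim: "((\<lambda>t. \<integral>\<xi>. ?A t \<xi> \<partial>lborel) \<longlongrightarrow> (\<integral>\<xi>. ?L \<xi> \<partial>lborel)) at_top"
  proof (rule integral_dominated_convergence_at_top[OF _ _ wi])
    show "\<forall>\<^sub>F t in at_top. AE \<xi> in lborel. norm (?A t \<xi>) \<le> W\<^sup>2 * dec (2 * p) \<xi>"
      using eventually_ge_at_top[of 0] by eventually_elim (use A_le in \<open>auto intro!: AE_I2\<close>)
    show "AE \<xi> in lborel. ((\<lambda>t. ?A t \<xi>) \<longlongrightarrow> ?L \<xi>) at_top"
    proof (rule AE_I2)
      fix \<xi> :: 'a
      have e0: "((\<lambda>t. exp (- t) *\<^sub>R \<xi>) \<longlongrightarrow> 0) at_top"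
      proof -
        have "((\<lambda>t::real. exp (- t)) \<longlongrightarrow> 0) at_top" using exp_neg_tendsto_0[of 1] by simp
        from tendsto_scaleR[OF this tendsto_const[of \<xi>]] show ?thesis by simp
      qed
      \<comment> \<open>Unit mass enters here: in the limit each datum contributes only the value 1
        of its transform at the origin, so the difference is that of the equilibria.\<close>
      have fl: "((\<lambda>t. fourier k (exp (- t) *\<^sub>R \<xi>)) \<longlongrightarrow> 1) at_top" if k: "integrable lborel k" "(\<integral>x. k x \<partial>lborel) = 1" for k :: "'a \<Rightarrow> real"
      proof -
        have "fourier k 0 = 1" using k by (simp add: fourier_def)
        then show ?thesis
          using continuous_on_tendsto_compose[OF fourier_continuous[OF k(1), of UNIV] e0] by simp
      qed
      have lim1: "((\<lambda>t. (cmod (H t \<xi>))\<^sup>2) \<longlongrightarrow> (cmod (1 * exp (- limexp J s \<epsilon> \<xi>) - 1 * exp (- limexp J1 s1 \<epsilon> \<xi>)))\<^sup>2) at_top"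
        unfolding H_def by (intro tendsto_intros fl f g finexp_tendsto[OF J e] finexp_tendsto[OF J1 e])
      have ev: "\<forall>\<^sub>F t in at_top. ?A t \<xi> = (cmod (H t \<xi>))\<^sup>2"
      proof -
        have "\<forall>\<^sub>F t in at_top. norm \<xi> \<le> exp t"
          using exp_at_top unfolding filterlim_at_top by auto
        then show ?thesis by eventually_elim simp
      qed
      show "((\<lambda>t. ?A t \<xi>) \<longlongrightarrow> ?L \<xi>) at_top"
        using lim1 unfolding tendsto_cong[OF ev] by (simp only: mult_1_left)
    qed
  qed measurable
  have Li: "integrable lborel ?L"
    using order.strict_trans1[OF E(1) ennreal_less_top] by (intro integrableI_nonneg) auto
  have "(\<integral>\<xi>. ?L \<xi> \<partial>lborel) \<le> E"
    using E by (subst (asm) nn_integral_eq_integral[OF Li]) (auto simp: ennreal_le_iff)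
  \<comment> \<open>The slack \<open>c\<close> is shared equally between the low and the high
    frequencies.\<close>
  then have "(\<integral>\<xi>. ?L \<xi> \<partial>lborel) < E + c / 2" using c by linarith
  from order_tendstoD(2)[OF lim this]
  have low: "\<forall>\<^sub>F t in at_top. (\<integral>\<xi>. ?A t \<xi> \<partial>lborel) < E + c / 2" .
  obtain D1 t1 where D1: "0 < D1" "\<And>t \<xi>. t1 \<le> t \<Longrightarrow> exp t \<le> norm \<xi> \<Longrightarrow> cmod (exp (- finexp J s \<epsilon> t \<xi>)) \<le> D1 * exp (- (p * t))"
    using finexp_tail_decay[OF J e h th q(1,2) slab(1)] unfolding p(1) by blast
  obtain D2 t2 where D2: "0 < D2" "\<And>t \<xi>. t2 \<le> t \<Longrightarrow> exp t \<le> norm \<xi> \<Longrightarrow> cmod (exp (- finexp J1 s1 \<epsilon> t \<xi>)) \<le> D2 * exp (- (p * t))"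
    using finexp_tail_decay[OF J1 e h th q(1,3) slab(2)] unfolding p(1) by blast
  define I where "I = (2 * pi) ^ DIM('a) * (\<integral>x. (f x)\<^sup>2 \<partial>lborel)"
  define I' where "I' = (2 * pi) ^ DIM('a) * (\<integral>x. (g x)\<^sup>2 \<partial>lborel)"
  have I0: "0 \<le> I" "0 \<le> I'" by (auto simp: I_def I'_def)
  define M where "M = 2 * D1\<^sup>2 * I + 2 * D2\<^sup>2 * I'"
  let ?B = "\<lambda>t \<xi>. indicator {\<xi>. exp t < norm \<xi>} \<xi> * (cmod (H t \<xi>))\<^sup>2 :: real"
  have high: "(\<integral>\<^sup>+\<xi>. ennreal (?B t \<xi>) \<partial>lborel) \<le> ennreal (M * exp (- ((2 * p - real DIM('a)) * t)))" if t: "t1 \<le> t" "t2 \<le> t" for t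
  proof -
    let ?f = "\<lambda>\<xi>. (cmod (fourier f (exp (- t) *\<^sub>R \<xi>)))\<^sup>2" and ?g = "\<lambda>\<xi>. (cmod (fourier g (exp (- t) *\<^sub>R \<xi>)))\<^sup>2"
    let ?k = "exp (- (2 * p * t))"
    have le: "?B t \<xi> \<le> 2 * D1\<^sup>2 * ?k * ?f \<xi> + 2 * D2\<^sup>2 * ?k * ?g \<xi>" for \<xi>
    proof (cases "exp t < norm \<xi>")
      case True
      have "cmod (H t \<xi>) \<le> cmod (fourier f (exp (- t) *\<^sub>R \<xi>)) * cmod (exp (- finexp J s \<epsilon> t \<xi>))
         + cmod (fourier g (exp (- t) *\<^sub>R \<xi>)) * cmod (exp (- finexp J1 s1 \<epsilon> t \<xi>))"
        unfolding H_def norm_mult[symmetric] by (rule norm_triangle_ineq4)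
      also have "\<dots> \<le> cmod (fourier f (exp (- t) *\<^sub>R \<xi>)) * (D1 * exp (- (p * t))) + cmod (fourier g (exp (- t) *\<^sub>R \<xi>)) * (D2 * exp (- (p * t)))"
        using True t by (intro add_mono mult_left_mono D1 D2) auto
      finally have "(cmod (H t \<xi>))\<^sup>2 \<le> (cmod (fourier f (exp (- t) *\<^sub>R \<xi>)) * (D1 * exp (- (p * t))) + cmod (fourier g (exp (- t) *\<^sub>R \<xi>)) * (D2 * exp (- (p * t))))\<^sup>2"
        by (intro power_mono) auto
      also have "\<dots> \<le> 2 * (cmod (fourier f (exp (- t) *\<^sub>R \<xi>)) * (D1 * exp (- (p * t))))\<^sup>2 + 2 * (cmod (fourier g (exp (- t) *\<^sub>R \<xi>)) * (D2 * exp (- (p * t))))\<^sup>2"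
        by (rule sum_squares_le_double)
      also have "\<dots> = 2 * D1\<^sup>2 * ?k * ?f \<xi> + 2 * D2\<^sup>2 * ?k * ?g \<xi>"
      proof -
        have "(exp (- (p * t)))\<^sup>2 = ?k" by (simp add: power2_eq_square mult_exp_exp)
        then show ?thesis by (simp add: power_mult_distrib mult_ac)
      qed
      finally show ?thesis using True by simp
    qed simp
    have "(\<integral>\<^sup>+\<xi>. ennreal (?B t \<xi>) \<partial>lborel) \<le> (\<integral>\<^sup>+\<xi>. ennreal (2 * D1\<^sup>2 * ?k) * ennreal (?f \<xi>) + ennreal (2 * D2\<^sup>2 * ?k) * ennreal (?g \<xi>) \<partial>lborel)"
      using le by (intro nn_integral_mono) (simp add: ennreal_mult'[symmetric] ennreal_plus[symmetric] ennreal_leI del: ennreal_plus)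
    also have "\<dots> = ennreal (2 * D1\<^sup>2 * ?k) * (\<integral>\<^sup>+\<xi>. ennreal (?f \<xi>) \<partial>lborel) + ennreal (2 * D2\<^sup>2 * ?k) * (\<integral>\<^sup>+\<xi>. ennreal (?g \<xi>) \<partial>lborel)"
      by (subst nn_integral_add) (auto simp: nn_integral_cmult)
    also have "\<dots> \<le> ennreal (2 * D1\<^sup>2 * ?k) * ennreal (exp (real DIM('a) * t) * I) + ennreal (2 * D2\<^sup>2 * ?k) * ennreal (exp (real DIM('a) * t) * I')"
      unfolding I_def I'_def
      by (intro add_mono mult_left_mono nn_integral_fourier_dilated f g) auto
    also have "\<dots> = ennreal (2 * D1\<^sup>2 * ?k * (exp (real DIM('a) * t) * I) + 2 * D2\<^sup>2 * ?k * (exp (real DIM('a) * t) * I'))"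
      using I0 by (subst (1 2) ennreal_mult'[symmetric]) (auto simp: ennreal_plus[symmetric] simp del: ennreal_plus)
    also have "2 * D1\<^sup>2 * ?k * (exp (real DIM('a) * t) * I) + 2 * D2\<^sup>2 * ?k * (exp (real DIM('a) * t) * I') = M * (?k * exp (real DIM('a) * t))"
      by (simp add: M_def algebra_simps)
    also have "?k * exp (real DIM('a) * t) = exp (- ((2 * p - real DIM('a)) * t))"
      unfolding mult_exp_exp by (simp add: algebra_simps)
    finally show ?thesis .
  qed
  have "((\<lambda>t. M * exp (- ((2 * p - real DIM('a)) * t))) \<longlongrightarrow> 0) at_top"
  proof -
    show ?thesis using p by (intro tendsto_mult_right_zero exp_neg_tendsto_0) auto
  qed
  from order_tendstoD(2)[OF this, of "c/2"] c
  have small: "\<forall>\<^sub>F t in at_top. M * exp (- ((2 * p - real DIM('a)) * t)) < c / 2" by simp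
  show ?thesis
    using low small eventually_ge_at_top[of 0] eventually_ge_at_top[of t1] eventually_ge_at_top[of t2]
  proof eventually_elim
    case (elim t)
    have Ai: "integrable lborel (?A t)"
      by (rule Bochner_Integration.integrable_bound[OF wi])
         (use order_trans[OF A_le[OF elim(3)] abs_ge_self] in auto)
    have "(\<integral>\<^sup>+\<xi>. ennreal ((cmod (H t \<xi>))\<^sup>2) \<partial>lborel) = (\<integral>\<^sup>+\<xi>. ennreal (?A t \<xi>) + ennreal (?B t \<xi>) \<partial>lborel)"
      by (intro nn_integral_cong) (auto simp: indicator_def)
    also have "\<dots> = (\<integral>\<^sup>+\<xi>. ennreal (?A t \<xi>) \<partial>lborel) + (\<integral>\<^sup>+\<xi>. ennreal (?B t \<xi>) \<partial>lborel)"
      by (rule nn_integral_add) auto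
    also have "\<dots> \<le> ennreal (E + c / 2) + ennreal (c / 2)"
    proof (rule add_mono)
      show "(\<integral>\<^sup>+\<xi>. ennreal (?A t \<xi>) \<partial>lborel) \<le> ennreal (E + c / 2)"
        using elim(1) by (subst nn_integral_eq_integral[OF Ai]) (auto intro: ennreal_leI)
      show "(\<integral>\<^sup>+\<xi>. ennreal (?B t \<xi>) \<partial>lborel) \<le> ennreal (c / 2)"
        using elim(2) by (intro order_trans[OF high[OF elim(4,5)]] ennreal_leI) simp
    qed
    also have "\<dots> = ennreal (E + c)" using E c by (simp add: ennreal_plus[symmetric] del: ennreal_plus)
    finally show ?case unfolding H_def .
  qed
qed

section \<open>Convergence in the weighted norm\<close>

lemma L1k_norm_triangle:
  assumes f: "in_L1k k f" and g: "in_L1k k g" and h: "in_L1k k h"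
  shows "L1k_norm k (\<lambda>x. f x - h x) \<le> L1k_norm k (\<lambda>x. f x - g x) + L1k_norm k (\<lambda>x. g x - h x)"
proof -
  have i: "integrable lborel (\<lambda>x. bracket x powr k * \<bar>f x - g x\<bar>)" "integrable lborel (\<lambda>x. bracket x powr k * \<bar>g x - h x\<bar>)"
    using in_L1k_diff[OF f g] in_L1k_diff[OF g h] by (auto simp: in_L1k_def)
  have "L1k_norm k (\<lambda>x. f x - h x) \<le> (\<integral>x. bracket x powr k * \<bar>f x - g x\<bar> + bracket x powr k * \<bar>g x - h x\<bar> \<partial>lborel)"
    unfolding L1k_norm_def
  proof (rule integral_mono_AE'[OF Bochner_Integration.integrable_add[OF i]])
    have "bracket x powr k * \<bar>f x - h x\<bar> \<le> bracket x powr k * \<bar>f x - g x\<bar> + bracket x powr k * \<bar>g x - h x\<bar>" for x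
      unfolding distrib_left[symmetric] by (intro mult_left_mono) auto
    then show "AE x in lborel. bracket x powr k * \<bar>f x - h x\<bar> \<le> bracket x powr k * \<bar>f x - g x\<bar> + bracket x powr k * \<bar>g x - h x\<bar>"
      by simp
  qed auto
  also have "\<dots> = L1k_norm k (\<lambda>x. f x - g x) + L1k_norm k (\<lambda>x. g x - h x)"
    unfolding L1k_norm_def by (rule Bochner_Integration.integral_add[OF i])
  finally show ?thesis .
qed

lemma in_L1k_zero: "in_L1k k (\<lambda>x. 0)"
  by (simp add: in_L1k_def)

lemma L1k_norm_diff_le:
  assumes f: "in_L1k k f" and g: "in_L1k k g"
  shows "L1k_norm k (\<lambda>x. f x - g x) \<le> L1k_norm k f + L1k_norm k g"
  using L1k_norm_triangle[OF f in_L1k_zero g] by (simp add: L1k_norm_def)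

text \<open>The drift carries all mass to the origin, where the weight equals 1, so the weighted
  norm eventually forgets how spread out the datum was.\<close>

lemma contracted_norm_tendsto:
  fixes f :: "'a::euclidean_space \<Rightarrow> real"
  assumes f: "in_L1k k f" and k: "0 \<le> k"
  shows "((\<lambda>t. \<integral>z. bracket (exp (- t) *\<^sub>R z) powr k * \<bar>f z\<bar> \<partial>lborel) \<longlongrightarrow> (\<integral>z. \<bar>f z\<bar> \<partial>lborel)) at_top"
proof -
  have fi: "integrable lborel (\<lambda>x. bracket x powr k * \<bar>f x\<bar>)" and [measurable]: "f \<in> borel_measurable borel"
    using f by (auto simp: in_L1k_def)
  show ?thesis
  proof (rule integral_dominated_convergence_at_top[OF _ _ fi])
    show "AE z in lborel. ((\<lambda>t. bracket (exp (- t) *\<^sub>R z) powr k * \<bar>f z\<bar>) \<longlongrightarrow> \<bar>f z\<bar>) at_top"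
    proof (rule AE_I2)
      fix z :: 'a
      have "((\<lambda>t::real. exp (- t)) \<longlongrightarrow> 0) at_top" using exp_neg_tendsto_0[of 1] by simp
      then have "((\<lambda>t. sqrt (1 + (norm (exp (- t) *\<^sub>R z))\<^sup>2) powr k * \<bar>f z\<bar>) \<longlongrightarrow> sqrt (1 + (norm (0 *\<^sub>R z))\<^sup>2) powr k * \<bar>f z\<bar>) at_top"
        by (intro tendsto_intros) auto
      then show "((\<lambda>t. bracket (exp (- t) *\<^sub>R z) powr k * \<bar>f z\<bar>) \<longlongrightarrow> \<bar>f z\<bar>) at_top"
        by (simp add: bracket_def)
    qed
    show "\<forall>\<^sub>F t in at_top. AE z in lborel. norm (bracket (exp (- t) *\<^sub>R z) powr k * \<bar>f z\<bar>) \<le> bracket z powr k * \<bar>f z\<bar>"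
      using eventually_ge_at_top[of 0]
    proof eventually_elim
      case (elim t)
      have "bracket (exp (- t) *\<^sub>R z) powr k \<le> bracket z powr k" for z :: 'a
        using bracket_pos[of "exp (- t) *\<^sub>R z"] by (intro powr_mono2 k bracket_contract_le elim) simp
      then show ?case by (intro AE_I2) (auto simp: abs_mult intro!: mult_right_mono)
    qed
  qed measurable
qed

lemma eventually_contracted_norm_le:
  assumes "in_L1k k f" "0 \<le> k" "(\<integral>z. \<bar>f z\<bar> \<partial>lborel) < c"
  shows "\<forall>\<^sub>F t in at_top. (\<integral>z. bracket (exp (- t) *\<^sub>R z) powr k * \<bar>f z\<bar> \<partial>lborel) \<le> c"
  using order_tendstoD(2)[OF contracted_norm_tendsto[OF assms(1,2)] assms(3)]
  by eventually_elim simp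

lemma contracted_norm_le:
  fixes f :: "'a::euclidean_space \<Rightarrow> real"
  assumes f: "in_L1k k f" and k: "0 \<le> k" and t: "0 \<le> t"
  shows "(\<integral>z. bracket (exp (- t) *\<^sub>R z) powr k * \<bar>f z\<bar> \<partial>lborel) \<le> L1k_norm k f"
  unfolding L1k_norm_def
proof (rule integral_mono_AE')
  show "integrable lborel (\<lambda>x. bracket x powr k * \<bar>f x\<bar>)" using f by (auto simp: in_L1k_def)
  have "bracket (exp (- t) *\<^sub>R z) powr k \<le> bracket z powr k" for z :: 'a
    using bracket_pos[of "exp (- t) *\<^sub>R z"] by (intro powr_mono2 k bracket_contract_le t) simp
  then show "AE z in lborel. bracket (exp (- t) *\<^sub>R z) powr k * \<bar>f z\<bar> \<le> bracket z powr k * \<bar>f z\<bar>"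
    by (intro AE_I2 mult_right_mono) auto
qed auto

text \<open>Truncation in space gives all weighted norms, truncation in height gives L^2, and
  division by the remaining mass restores the unit mass that the comparison of the equilibria relies
  on.\<close>

lemma bounded_support_approximation:
  fixes f :: "'a::euclidean_space \<Rightarrow> real"
  assumes f: "in_L1k k f" and k: "0 \<le> k" and f1: "(\<integral>x. f x \<partial>lborel) = 1" and \<eta>: "0 < \<eta>"
  shows "\<exists>v. integrable lborel v \<and> integrable lborel (\<lambda>x. (v x)\<^sup>2) \<and> (\<integral>x. v x \<partial>lborel) = 1 \<and>
    (\<forall>m\<ge>0. in_L1k m v) \<and> L1k_norm k (\<lambda>x. f x - v x) \<le> \<eta>"
proof -
  have fk: "integrable lborel (\<lambda>x. bracket x powr k * \<bar>f x\<bar>)" and [measurable]: "f \<in> borel_measurable borel"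
    using f by (auto simp: in_L1k_def)
  have fi: "integrable lborel f" by (rule in_L1k_integrable[OF f k])
  define T where "T n x = (if norm x \<le> real n \<and> \<bar>f x\<bar> \<le> real n then f x else 0)" for n x
  have [measurable]: "T n \<in> borel_measurable borel" for n unfolding T_def by measurable
  have T_le: "\<bar>T n x\<bar> \<le> \<bar>f x\<bar>" for n x by (auto simp: T_def)
  have Tlim: "(\<lambda>n. T n x) \<longlonglongrightarrow> f x" for x
  proof (rule tendsto_eventually)
    obtain N where N: "max (norm x) \<bar>f x\<bar> \<le> real N" using real_arch_simple by blast
    show "\<forall>\<^sub>F n in sequentially. T n x = f x"
      using eventually_ge_at_top[of N]
    proof eventually_elim
      case (elim n)
      then have "real N \<le> real n" by simp
      then have "norm x \<le> real n" "\<bar>f x\<bar> \<le> real n" using N by auto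
      then show ?case by (simp add: T_def)
    qed
  qed
  have "(\<lambda>n. \<integral>x. T n x \<partial>lborel) \<longlonglongrightarrow> (\<integral>x. f x \<partial>lborel)"
    by (rule integral_dominated_convergence[where w="\<lambda>x. \<bar>f x\<bar>"]) (use fi T_le Tlim in auto)
  then have clim: "(\<lambda>n. \<integral>x. T n x \<partial>lborel) \<longlonglongrightarrow> 1" unfolding f1 .
  define c where "c n = (\<integral>x. T n x \<partial>lborel)" for n
  have cl: "c \<longlonglongrightarrow> 1" using clim by (simp add: c_def[abs_def])
  have c_half: "\<forall>\<^sub>F n in sequentially. 1/2 < c n" by (rule order_tendstoD(1)[OF cl]) simp
  then obtain N0 where N0: "\<And>n. N0 \<le> n \<Longrightarrow> 1/2 < c n" by (auto simp: eventually_sequentially)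
  \<comment> \<open>The shift by \<open>N0\<close> keeps the normalising mass above 1/2 for every n,
    whence the domination by 2 |f|.\<close>
  define v where "v n x = T (n + N0) x / c (n + N0)" for n x
  have cN: "1/2 < c (n + N0)" for n using N0 by simp
  have v_le: "\<bar>v n x\<bar> \<le> 2 * \<bar>f x\<bar>" for n x
  proof -
    have "\<bar>v n x\<bar> = \<bar>T (n + N0) x\<bar> / c (n + N0)" using cN[of n] by (simp add: v_def)
    also have "\<dots> \<le> \<bar>f x\<bar> / (1/2)" using cN[of n] T_le by (intro frac_le) auto
    finally show ?thesis by simp
  qed
  have vlim: "(\<lambda>n. v n x) \<longlonglongrightarrow> f x" for x
    using tendsto_divide[OF LIMSEQ_ignore_initial_segment[OF Tlim[of x], of N0] LIMSEQ_ignore_initial_segment[OF cl, of N0]]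
    by (simp add: v_def)
  have [measurable]: "v n \<in> borel_measurable borel" for n unfolding v_def by measurable
  have f3: "integrable lborel (\<lambda>x. 3 * (bracket x powr k * \<bar>f x\<bar>))" using fk by simp
  have "(\<lambda>n. \<integral>x. bracket x powr k * \<bar>f x - v n x\<bar> \<partial>lborel) \<longlonglongrightarrow> (\<integral>x. (0::real) \<partial>(lborel :: 'a measure))"
  proof (rule integral_dominated_convergence[OF _ _ f3])
    have "(\<lambda>n. bracket x powr k * \<bar>f x - v n x\<bar>) \<longlonglongrightarrow> bracket x powr k * \<bar>f x - f x\<bar>" for x
      by (intro tendsto_intros vlim)
    then show "AE x in lborel. (\<lambda>n. bracket x powr k * \<bar>f x - v n x\<bar>) \<longlonglongrightarrow> 0" by simp
    have "bracket x powr k * \<bar>f x - v n x\<bar> \<le> bracket x powr k * (3 * \<bar>f x\<bar>)" for n x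
      using v_le[of n x] by (intro mult_left_mono) auto
    then show "AE x in lborel. norm (bracket x powr k * \<bar>f x - v n x\<bar>) \<le> 3 * (bracket x powr k * \<bar>f x\<bar>)" for n
      by (intro AE_I2) (simp add: abs_mult mult.left_commute)
  qed measurable
  then have "(\<lambda>n. L1k_norm k (\<lambda>x. f x - v n x)) \<longlonglongrightarrow> 0" by (simp add: L1k_norm_def)
  from order_tendstoD(2)[OF this \<eta>] obtain n where n: "L1k_norm k (\<lambda>x. f x - v n x) < \<eta>"
    by (auto simp: eventually_sequentially)
  have vi: "integrable lborel (v n)"
    by (rule Bochner_Integration.integrable_bound[OF integrable_mult_right[OF fi, of 2]]) (use v_le in \<open>auto simp: abs_mult\<close>)
  define R where "R = real (n + N0)"
  have R0: "0 \<le> R" by (simp add: R_def)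
  have vb: "\<bar>v n x\<bar> \<le> 2 * R * indicator (cball 0 R) x" for x
  proof -
    have "\<bar>v n x\<bar> = \<bar>T (n + N0) x\<bar> / c (n + N0)" using cN[of n] by (simp add: v_def)
    also have "\<dots> \<le> (R * indicator (cball 0 R) x) / (1/2)" using cN[of n] by (intro frac_le) (auto simp: T_def R_def)
    finally show ?thesis by simp
  qed
  have ind: "integrable lborel (\<lambda>x::'a. C * indicator (cball 0 R) x)" for C :: real by simp
  have v2: "integrable lborel (\<lambda>x. (v n x)\<^sup>2)"
  proof (rule Bochner_Integration.integrable_bound[OF ind[of "(2 * R)\<^sup>2"]])
    have "(v n x)\<^sup>2 \<le> (2 * R)\<^sup>2 * indicator (cball 0 R) x" for x
      using power_mono[OF vb[of x] abs_ge_zero, of 2] by (auto simp: indicator_def split: if_splits)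
    then show "AE x in lborel. norm ((v n x)\<^sup>2) \<le> norm ((2 * R)\<^sup>2 * indicator (cball 0 R) x)"
      by (intro AE_I2) simp
  qed measurable
  have vm: "in_L1k m (v n)" if m: "0 \<le> m" for m
  proof -
    have "integrable lborel (\<lambda>x. bracket x powr m * \<bar>v n x\<bar>)"
    proof (rule Bochner_Integration.integrable_bound[OF ind[of "(1 + R) powr m * (2 * R)"]])
      have "bracket x powr m * \<bar>v n x\<bar> \<le> (1 + R) powr m * (2 * R) * indicator (cball 0 R) x" for x
      proof (cases "norm x \<le> R")
        case True
        have "bracket x powr m \<le> (1 + R) powr m"
          using True bracket_le[of x] bracket_pos[of x] m by (intro powr_mono2) auto
        then have "bracket x powr m * \<bar>v n x\<bar> \<le> (1 + R) powr m * (2 * R)"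
          using vb[of x] True by (intro mult_mono) auto
        then show ?thesis using True by simp
      next
        case False
        then show ?thesis using vb[of x] by simp
      qed
      then show "AE x in lborel. norm (bracket x powr m * \<bar>v n x\<bar>) \<le> norm ((1 + R) powr m * (2 * R) * indicator (cball 0 R) x)"
        using R0 by (intro AE_I2) (simp add: abs_mult)
    qed measurable
    then show ?thesis by (simp add: in_L1k_def)
  qed
  have "(\<integral>x. v n x \<partial>lborel) = 1" using cN[of n] by (simp add: v_def c_def)
  then show ?thesis using vi v2 vm n by (intro exI[of _ "v n"]) auto
qed

text \<open>The moment constant is free of s, \<epsilon> and t. Indeed |1 - exp(-z)| \<le> 2 |z|
  when Re z \<ge> 0, and in the unit ball the exponent is at most (C0 + 2) |\<xi>|^(2s), hence at
  most (C0 + 2) |\<xi>| because 2 s > 1; so the linear bound required by \<open>moment_bound\<close>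
  holds with 2 (C0 + 2).\<close>

lemma mild_representation:
  fixes J u0 :: "'a::euclidean_space \<Rightarrow> real"
  assumes J: "stable_kernel C0 \<delta> s J" and e: "0 < \<epsilon>"
    and u: "mild_solution k (rescale J \<epsilon>) (\<epsilon> powr (- 2 * s)) u0 u" and k: "0 \<le> k" and u0: "integrable lborel u0"
    and t: "0 < t" and m: "0 < m" "m < 1"
  shows "\<exists>\<mu>. prob_space \<mu> \<and> sets \<mu> = sets borel \<and> (\<forall>\<xi>. charf \<mu> \<xi> = exp (- finexp J s \<epsilon> t \<xi>)) \<and>
    (\<integral>\<^sup>+y. ennreal (bracket y powr m) \<partial>\<mu>) \<le> ennreal (moment_const TYPE('a) m (2 * (C0 + 2))) \<and>
    (\<forall>\<xi>. fourier (u t) \<xi> = fourier u0 (exp (- t) *\<^sub>R \<xi>) * charf \<mu> \<xi>)"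
proof -
  note F = stable_kernel_facts[OF J]
  note K = prob_density_rescale[OF F(1) e]
  have a: "0 < \<epsilon> powr (- 2 * s)" using e by simp
  obtain \<mu> where \<mu>: "prob_space \<mu>" "sets \<mu> = sets borel"
    and c: "\<And>\<xi>. charf \<mu> \<xi> = exp (- exponent (rescale J \<epsilon>) (\<epsilon> powr (- 2 * s)) t \<xi>)"
    using exponent_charf[OF K(1) a t] by blast
  have c': "charf \<mu> \<xi> = exp (- finexp J s \<epsilon> t \<xi>)" for \<xi>
    unfolding c exponent_eq_finexp[OF F(1) e] ..
  have B: "cmod (1 - charf \<mu> \<xi>) \<le> 2 * (C0 + 2) * norm \<xi>" if x: "norm \<xi> \<le> 1" for \<xi>
  proof -
    have "cmod (exp 0 - exp (- finexp J s \<epsilon> t \<xi>)) \<le> 2 * 1 * cmod (0 - (- finexp J s \<epsilon> t \<xi>)) powr 1"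
      using Re_finexp_nonneg[OF J e] by (intro cmod_exp_diff_le) auto
    also have "\<dots> = 2 * cmod (finexp J s \<epsilon> t \<xi>)" by simp
    also have "\<dots> \<le> 2 * ((C0 + 2) * norm \<xi> powr (2 * s))" by (intro mult_left_mono norm_finexp_le[OF J e]) simp
    also have "\<dots> \<le> 2 * ((C0 + 2) * norm \<xi> powr 1)"
      using x F by (intro mult_left_mono powr_mono') auto
    finally show ?thesis by (simp add: c' algebra_simps)
  qed
  have mom: "(\<integral>\<^sup>+y. ennreal (bracket y powr m) \<partial>\<mu>) \<le> ennreal (moment_const TYPE('a) m (2 * (C0 + 2)))"
    by (rule moment_bound[OF \<mu> m B]) (use F in auto)
  have "fourier (u t) \<xi> = fourier u0 (exp (- t) *\<^sub>R \<xi>) * charf \<mu> \<xi>" for \<xi>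
    unfolding c using fourier_mild_solution[OF u k _ u0, of t \<xi>] K(1) t by (simp add: prob_density_def)
  then show ?thesis using \<mu> c' mom by blast
qed

text \<open>By uniqueness of the transform \<open>w\<close> is the convolution of the contracted
  \<open>f\<close> with \<mu>, and this is linear in the datum. The lemma controls the replacement
  of a datum by another one; with \<open>v = 0\<close> it bounds the solution itself.\<close>

lemma evolve_difference_le:
  fixes w f v :: "'a::euclidean_space \<Rightarrow> real"
  assumes \<mu>: "prob_space \<mu>" "sets \<mu> = sets borel" and k: "0 \<le> k" and t: "0 \<le> t"
    and w: "in_L1k k w" and f: "in_L1k k f" and v: "in_L1k k v"
    and eq: "\<And>\<xi>. fourier w \<xi> = fourier f (exp (- t) *\<^sub>R \<xi>) * charf \<mu> \<xi>"
    and B: "(\<integral>\<^sup>+y. ennreal (bracket y powr k) \<partial>\<mu>) \<le> ennreal B" "0 \<le> B"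
  shows "L1k_norm k (\<lambda>x. w x - evolve \<mu> t v x) \<le> 2 powr k * B * (\<integral>z. bracket (exp (- t) *\<^sub>R z) powr k * \<bar>f z - v z\<bar> \<partial>lborel)"
proof -
  have fi: "integrable lborel f" and vi: "integrable lborel v" and wi: "integrable lborel w"
    using f v w by (auto intro: in_L1k_integrable[OF _ k])
  have fv: "in_L1k k (\<lambda>x. f x - v x)" by (rule in_L1k_diff[OF f v])
  have ev: "integrable lborel (evolve \<mu> t v)" by (rule evolve_integrable[OF \<mu> vi t])
  have "AE x in lborel. w x - evolve \<mu> t v x = evolve \<mu> t (\<lambda>x. f x - v x) x"
  proof (rule fourier_unique)
    show "integrable lborel (\<lambda>x. w x - evolve \<mu> t v x)" using wi ev by simp
    show "integrable lborel (evolve \<mu> t (\<lambda>x. f x - v x))"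
      by (rule evolve_integrable[OF \<mu> _ t]) (use fi vi in simp)
    show "fourier (\<lambda>x. w x - evolve \<mu> t v x) \<xi> = fourier (evolve \<mu> t (\<lambda>x. f x - v x)) \<xi>" for \<xi>
      using fi vi by (simp add: fourier_diff[OF wi ev] eq fourier_evolve[OF \<mu>] fourier_diff[OF fi vi] left_diff_distrib)
  qed
  then have "L1k_norm k (\<lambda>x. w x - evolve \<mu> t v x) = L1k_norm k (evolve \<mu> t (\<lambda>x. f x - v x))"
    unfolding L1k_norm_def
    using wi ev evolve_measurable[OF \<mu>, of "\<lambda>x. f x - v x" t] fi vi
    by (intro integral_cong_AE) auto
  also have "\<dots> \<le> 2 powr k * B * (\<integral>z. bracket (exp (- t) *\<^sub>R z) powr k * \<bar>f z - v z\<bar> \<partial>lborel)"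
    by (rule evolve_in_L1k(2)[OF \<mu> fv k t B])
  finally show ?thesis .
qed

section \<open>Mild solutions in the weighted norm\<close>

lemma moment_mono:
  assumes "k \<le> m" "(\<integral>\<^sup>+y. ennreal (bracket y powr m) \<partial>\<mu>) \<le> B"
  shows "(\<integral>\<^sup>+y. ennreal (bracket y powr k) \<partial>\<mu>) \<le> B"
  by (rule order_trans[OF nn_integral_mono assms(2)]) (auto intro!: ennreal_leI bracket_powr_mono assms(1))

lemma mild_solution_in_L1k: "mild_solution k K a u0 u \<Longrightarrow> 0 \<le> t \<Longrightarrow> in_L1k k (u t)"
  by (simp add: mild_solution_def)

lemma prob_density_abs_integral:
  assumes "prob_density f" shows "(\<integral>x. \<bar>f x\<bar> \<partial>lborel) = 1"
proof -
  have "(\<integral>x. \<bar>f x\<bar> \<partial>lborel) = (\<integral>x. f x \<partial>lborel)"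
    using assms by (intro integral_cong_AE) (auto simp: prob_density_def)
  then show ?thesis using assms by (simp add: prob_density_def)
qed

lemma moment_const_nonneg: "0 < m \<Longrightarrow> m < 1 \<Longrightarrow> 0 \<le> B \<Longrightarrow> 0 \<le> moment_const TYPE('a::euclidean_space) m B"
  unfolding moment_const_def using one_minus_cos_pos
  by (intro mult_nonneg_nonneg add_nonneg_nonneg divide_nonneg_nonneg) auto

text \<open>The norm of the contracted datum tends to its mass 1 and is eventually below 2, which
  makes the bound independent of the datum. This serves the values of s away from 1.\<close>

lemma mild_solution_eventually_bounded:
  fixes J u0 :: "'a::euclidean_space \<Rightarrow> real"
  assumes J: "stable_kernel C0 \<delta> s J" and e: "0 < \<epsilon>"
    and u: "mild_solution k (rescale J \<epsilon>) (\<epsilon> powr (- 2 * s)) u0 u" and k: "0 \<le> k" "k \<le> m"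
    and u0: "prob_density u0" "in_L1k k u0" and m: "0 < m" "m < 1"
  shows "\<forall>\<^sub>F t in at_top. L1k_norm k (u t) \<le> 2 powr k * moment_const TYPE('a) m (2 * (C0 + 2)) * 2"
proof -
  have C0: "0 < C0" using stable_kernel_facts[OF J] by simp
  let ?B = "moment_const TYPE('a) m (2 * (C0 + 2))"
  have B0: "0 \<le> ?B" using C0 m by (intro moment_const_nonneg) auto
  have ui: "integrable lborel u0" using u0 by (simp add: prob_density_def)
  have "\<forall>\<^sub>F t in at_top. (\<integral>z. bracket (exp (- t) *\<^sub>R z) powr k * \<bar>u0 z\<bar> \<partial>lborel) \<le> 2"
    by (rule eventually_contracted_norm_le[OF u0(2) k(1)]) (simp add: prob_density_abs_integral[OF u0(1)])
  then show ?thesis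
    using eventually_gt_at_top[of 0]
  proof eventually_elim
    case (elim t)
    obtain \<mu> where \<mu>: "prob_space \<mu>" "sets \<mu> = sets borel"
      and mom: "(\<integral>\<^sup>+y. ennreal (bracket y powr m) \<partial>\<mu>) \<le> ennreal ?B"
      and eq: "\<And>\<xi>. fourier (u t) \<xi> = fourier u0 (exp (- t) *\<^sub>R \<xi>) * charf \<mu> \<xi>"
      using mild_representation[OF J e u k(1) ui elim(2) m] by blast
    have "L1k_norm k (\<lambda>x. u t x - evolve \<mu> t (\<lambda>x. 0) x)
      \<le> 2 powr k * ?B * (\<integral>z. bracket (exp (- t) *\<^sub>R z) powr k * \<bar>u0 z - 0\<bar> \<partial>lborel)"
      using elim(2) by (intro evolve_difference_le[OF \<mu> k(1) _ mild_solution_in_L1k[OF u] u0(2) in_L1k_zero eq moment_mono[OF k(2) mom] B0]) auto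
    also have "\<dots> \<le> 2 powr k * ?B * 2"
      using elim(1) B0 by (intro mult_left_mono) auto
    finally show ?case by (simp add: evolve_def)
  qed
qed

text \<open>The number \<open>x\<close> stands for 1 - s and \<beta> for the rate in L^2 of the
  equilibria. Each solution is compared with the evolution of an approximating datum, at a cost
  linear in the distance \<eta> of the data; the two evolutions are compared by interpolation
  between L^2 and L^1_m. Their transforms differ little in L^2 only for large t, and only then are
  their L^1_m norms bounded independently of the approximation.\<close>

theorem mild_solutions_comparison:
  fixes J J1 u0 ub0 :: "'a::euclidean_space \<Rightarrow> real"
  assumes J: "stable_kernel C0 \<delta> s J" and J1: "stable_kernel C0 \<delta> s1 J1" and e: "0 < \<epsilon>" and h: "0 < h" and th: "\<theta> < 1"
    and q: "0 < q" "q \<le> \<epsilon> powr (- 2 * s)" "q \<le> \<epsilon> powr (- 2 * s1)"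
    and slab: "\<And>\<xi>. measure (density lborel (\<lambda>x. ennreal (J x))) {x. \<bar>x \<bullet> \<xi>\<bar> < h * norm \<xi>} \<le> \<theta>"
      "\<And>\<xi>. measure (density lborel (\<lambda>x. ennreal (J1 x))) {x. \<bar>x \<bullet> \<xi>\<bar> < h * norm \<xi>} \<le> \<theta>"
    and p: "p = (1 - \<theta>) * q" "real DIM('a) / 2 < p"
    and d: "\<And>\<xi>. cmod (exp (- limexp J s \<epsilon> \<xi>)) \<le> C * dec p \<xi>" "\<And>\<xi>. cmod (exp (- limexp J1 s1 \<epsilon> \<xi>)) \<le> C * dec p \<xi>"
    and x: "0 < x" "x < 1" and \<beta>: "0 < \<beta>" and A: "0 \<le> A"
    and E: "(\<integral>\<^sup>+\<xi>. ennreal ((cmod (exp (- limexp J s \<epsilon> \<xi>) - exp (- limexp J1 s1 \<epsilon> \<xi>)))\<^sup>2) \<partial>lborel) \<le> ennreal (A * x powr (2 * \<beta>))"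
    and k: "0 \<le> k" "k < m" "m < 1"
    and u: "mild_solution k (rescale J \<epsilon>) (\<epsilon> powr (- 2 * s)) u0 u" and ub: "mild_solution k (rescale J1 \<epsilon>) (\<epsilon> powr (- 2 * s1)) ub0 ub"
    and u0: "prob_density u0" "in_L1k k u0" and ub0: "prob_density ub0" "in_L1k k ub0"
  shows "\<forall>\<^sub>F t in at_top. L1k_norm k (\<lambda>x. u t x - ub t x)
    \<le> (2 * (2 powr k * moment_const TYPE('a) m (2 * (C0 + 2))) + interp_const TYPE('a) k * sqrt (A + 1)
        + 6 * (2 powr m * moment_const TYPE('a) m (2 * (C0 + 2)))) * x powr (\<beta> * (m - k) / (m + real DIM('a) / 2))"
proof -
  have C0: "0 < C0" using stable_kernel_facts[OF J] by simp
  have m: "0 < m" "m < 1" using k by auto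
  define B where "B = moment_const TYPE('a) m (2 * (C0 + 2))"
  have B0: "0 \<le> B" unfolding B_def using C0 m by (intro moment_const_nonneg) auto
  define D where "D = m + real DIM('a) / 2"
  have D: "0 < D" using m by (simp add: D_def add_pos_nonneg)
  define \<gamma> where "\<gamma> = \<beta> * (m - k) / D"
  have \<gamma>: "0 \<le> \<gamma>" using \<beta> k D by (simp add: \<gamma>_def)
  \<comment> \<open>The error of the approximation is set equal to the target rate. The approximants
    thus depend on \<open>x\<close>, which affects the waiting time only.\<close>
  define \<eta> where "\<eta> = x powr \<gamma>"
  have \<eta>: "0 < \<eta>" "\<eta> \<le> 1" using x \<gamma> by (auto simp: \<eta>_def powr_le1)
  have ui: "integrable lborel u0" "(\<integral>x. u0 x \<partial>lborel) = 1" and ubi: "integrable lborel ub0" "(\<integral>x. ub0 x \<partial>lborel) = 1"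
    using u0 ub0 by (auto simp: prob_density_def)
  obtain v where v: "integrable lborel v" "integrable lborel (\<lambda>x. (v x)\<^sup>2)" "(\<integral>x. v x \<partial>lborel) = 1"
    and vL: "\<And>m. 0 \<le> m \<Longrightarrow> in_L1k m v" and v\<eta>: "L1k_norm k (\<lambda>x. u0 x - v x) \<le> \<eta>"
    using bounded_support_approximation[OF u0(2) k(1) ui(2) \<eta>(1)] by blast
  obtain vb where vb: "integrable lborel vb" "integrable lborel (\<lambda>x. (vb x)\<^sup>2)" "(\<integral>x. vb x \<partial>lborel) = 1"
    and vbL: "\<And>m. 0 \<le> m \<Longrightarrow> in_L1k m vb" and vb\<eta>: "L1k_norm k (\<lambda>x. ub0 x - vb x) \<le> \<eta>"
    using bounded_support_approximation[OF ub0(2) k(1) ubi(2) \<eta>(1)] by blast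
  \<comment> \<open>The L^1 norm of an approximant is at most 1 + \<eta> \<le> 2; the strict bound
    by 3 is what makes the contracted norm eventually at most 3.\<close>
  have abs3: "(\<integral>x. \<bar>w x\<bar> \<partial>lborel) < 3"
    if f: "prob_density f" "in_L1k k f" and w: "in_L1k k w" "L1k_norm k (\<lambda>x. f x - w x) \<le> \<eta>" for f w :: "'a \<Rightarrow> real"
  proof -
    have fi: "integrable lborel f" "integrable lborel w" using f w by (auto intro: in_L1k_integrable[OF _ k(1)])
    have "(\<integral>x. \<bar>w x\<bar> \<partial>lborel) \<le> (\<integral>x. \<bar>f x\<bar> + \<bar>f x - w x\<bar> \<partial>lborel)"
      by (rule integral_mono_AE') (use fi in auto)
    also have "\<dots> = (\<integral>x. \<bar>f x\<bar> \<partial>lborel) + (\<integral>x. \<bar>f x - w x\<bar> \<partial>lborel)"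
      using fi by (intro Bochner_Integration.integral_add) auto
    also have "\<dots> \<le> 1 + \<eta>"
      using integral_abs_le_L1k_norm[OF in_L1k_diff[OF f(2) w(1)] k(1)] w(2) prob_density_abs_integral[OF f(1)] by simp
    finally show ?thesis using \<eta> by simp
  qed
  have E0: "0 \<le> A * x powr (2 * \<beta>)" using A by simp
  \<comment> \<open>The slack in the L^2 limit is taken of the order of the distance of the
    equilibria itself; it turns \<open>A\<close> into \<open>A + 1\<close>.\<close>
  have c0: "0 < x powr (2 * \<beta>)" using x by simp
  note L2 = evolution_L2_limit[OF J J1 e h th q slab p d v vb E E0 c0]
  note V = eventually_contracted_norm_le[OF vL[of m] _ abs3[OF u0 vL[OF k(1)] v\<eta>]]
  note VB = eventually_contracted_norm_le[OF vbL[of m] _ abs3[OF ub0 vbL[OF k(1)] vb\<eta>]]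
  have m0: "0 \<le> m" using m by simp
  show ?thesis
    using L2 V[OF m0 m0] VB[OF m0 m0] eventually_gt_at_top[of 0]
  proof eventually_elim
    case (elim t)
    have t: "0 \<le> t" using elim(4) by simp
    obtain \<mu> where \<mu>: "prob_space \<mu>" "sets \<mu> = sets borel" and c: "\<And>\<xi>. charf \<mu> \<xi> = exp (- finexp J s \<epsilon> t \<xi>)"
      and mom: "(\<integral>\<^sup>+y. ennreal (bracket y powr m) \<partial>\<mu>) \<le> ennreal B"
      and eq: "\<And>\<xi>. fourier (u t) \<xi> = fourier u0 (exp (- t) *\<^sub>R \<xi>) * charf \<mu> \<xi>"
      using mild_representation[OF J e u k(1) ui(1) elim(4) m] unfolding B_def by blast
    obtain \<mu>1 where \<mu>1: "prob_space \<mu>1" "sets \<mu>1 = sets borel" and c1: "\<And>\<xi>. charf \<mu>1 \<xi> = exp (- finexp J1 s1 \<epsilon> t \<xi>)"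
      and mom1: "(\<integral>\<^sup>+y. ennreal (bracket y powr m) \<partial>\<mu>1) \<le> ennreal B"
      and eq1: "\<And>\<xi>. fourier (ub t) \<xi> = fourier ub0 (exp (- t) *\<^sub>R \<xi>) * charf \<mu>1 \<xi>"
      using mild_representation[OF J1 e ub k(1) ubi(1) elim(4) m] unfolding B_def by blast
    note momk = moment_mono[OF less_imp_le[OF k(2)] mom] moment_mono[OF less_imp_le[OF k(2)] mom1]
    let ?w = "evolve \<mu> t v" and ?w1 = "evolve \<mu>1 t vb"
    have wm: "in_L1k m ?w" "in_L1k m ?w1"
      by (rule evolve_in_L1k(1)[OF \<mu> vL[OF m0] m0 t mom B0] evolve_in_L1k(1)[OF \<mu>1 vbL[OF m0] m0 t mom1 B0])+
    have wk: "in_L1k k ?w" "in_L1k k ?w1"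
      by (rule in_L1k_mono[OF wm(1) less_imp_le[OF k(2)]] in_L1k_mono[OF wm(2) less_imp_le[OF k(2)]])+
    have wi: "integrable lborel ?w" "integrable lborel ?w1"
      by (rule in_L1k_integrable[OF wk(1) k(1)] in_L1k_integrable[OF wk(2) k(1)])+
    have uk: "in_L1k k (u t)" "in_L1k k (ub t)"
      by (rule mild_solution_in_L1k[OF u t] mild_solution_in_L1k[OF ub t])+
    let ?h = "\<lambda>x. ?w x - ?w1 x"
    have hm: "in_L1k m ?h" by (rule in_L1k_diff[OF wm])
    have 1: "L1k_norm k (\<lambda>x. u t x - ?w x) \<le> 2 powr k * B * \<eta>"
    proof -
      have "L1k_norm k (\<lambda>x. u t x - ?w x) \<le> 2 powr k * B * (\<integral>z. bracket (exp (- t) *\<^sub>R z) powr k * \<bar>u0 z - v z\<bar> \<partial>lborel)"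
        by (rule evolve_difference_le[OF \<mu> k(1) t uk(1) u0(2) vL[OF k(1)] eq momk(1) B0])
      also have "\<dots> \<le> 2 powr k * B * \<eta>"
        using B0 by (intro mult_left_mono order_trans[OF contracted_norm_le[OF in_L1k_diff[OF u0(2) vL[OF k(1)]] k(1) t] v\<eta>]) auto
      finally show ?thesis .
    qed
    have 2: "L1k_norm k (\<lambda>x. ?w1 x - ub t x) \<le> 2 powr k * B * \<eta>"
    proof -
      have "L1k_norm k (\<lambda>x. ?w1 x - ub t x) = L1k_norm k (\<lambda>x. ub t x - ?w1 x)"
        by (simp add: L1k_norm_def abs_minus_commute)
      also have "\<dots> \<le> 2 powr k * B * (\<integral>z. bracket (exp (- t) *\<^sub>R z) powr k * \<bar>ub0 z - vb z\<bar> \<partial>lborel)"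
        by (rule evolve_difference_le[OF \<mu>1 k(1) t uk(2) ub0(2) vbL[OF k(1)] eq1 momk(2) B0])
      also have "\<dots> \<le> 2 powr k * B * \<eta>"
        using B0 by (intro mult_left_mono order_trans[OF contracted_norm_le[OF in_L1k_diff[OF ub0(2) vbL[OF k(1)]] k(1) t] vb\<eta>]) auto
      finally show ?thesis .
    qed
    have hm_le: "L1k_norm m ?h \<le> 6 * (2 powr m * B)"
    proof -
      have "L1k_norm m ?h \<le> L1k_norm m ?w + L1k_norm m ?w1" by (rule L1k_norm_diff_le[OF wm])
      also have "\<dots> \<le> 2 powr m * B * (\<integral>z. bracket (exp (- t) *\<^sub>R z) powr m * \<bar>v z\<bar> \<partial>lborel)
         + 2 powr m * B * (\<integral>z. bracket (exp (- t) *\<^sub>R z) powr m * \<bar>vb z\<bar> \<partial>lborel)"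
        by (intro add_mono evolve_in_L1k(2)[OF \<mu> vL[OF m0] m0 t mom B0] evolve_in_L1k(2)[OF \<mu>1 vbL[OF m0] m0 t mom1 B0])
      also have "\<dots> \<le> 2 powr m * B * 3 + 2 powr m * B * 3"
        using B0 elim(2,3) by (intro add_mono mult_left_mono) auto
      also have "\<dots> = 6 * (2 powr m * B)" by simp
      finally show ?thesis .
    qed
    define P where "P = sqrt (A + 1) * x powr \<beta>"
    have P0: "0 \<le> P" using A by (simp add: P_def)
    have P2: "A * x powr (2 * \<beta>) + x powr (2 * \<beta>) = P\<^sup>2"
    proof -
      have "(x powr \<beta>)\<^sup>2 = x powr (2 * \<beta>)" by (simp add: power2_eq_square powr_add[symmetric])
      then show ?thesis using A by (simp add: P_def power_mult_distrib distrib_right)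
    qed
    have fh: "fourier ?h \<xi> = fourier v (exp (- t) *\<^sub>R \<xi>) * exp (- finexp J s \<epsilon> t \<xi>) - fourier vb (exp (- t) *\<^sub>R \<xi>) * exp (- finexp J1 s1 \<epsilon> t \<xi>)" for \<xi>
      by (simp add: fourier_diff[OF wi] fourier_evolve[OF \<mu> v(1)] fourier_evolve[OF \<mu>1 vb(1)] c c1)
    have hP: "(\<integral>\<^sup>+\<xi>. ennreal ((cmod (fourier ?h \<xi>))\<^sup>2) \<partial>lborel) \<le> ennreal (P\<^sup>2)"
      using elim(1) unfolding fh P2 .
    \<comment> \<open>The radius that balances the interpolation:
      \<open>R powr (k + d/2) * x powr \<beta>\<close> and \<open>R powr (k - m)\<close> both become
      \<eta>.\<close>
    define R where "R = x powr (- (\<beta> / D))"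
    have R1: "1 \<le> R"
    proof -
      have "x powr 0 \<le> x powr (- (\<beta> / D))" using x \<beta> D by (intro powr_mono') auto
      then show ?thesis using x by (simp add: R_def)
    qed
    have 3: "L1k_norm k ?h \<le> interp_const TYPE('a) k * R powr (k + DIM('a) / 2) * P + R powr (k - m) * L1k_norm m ?h"
      by (rule L1k_interpolation[OF hm k(1) less_imp_le[OF k(2)] R1 hP P0])
    have e1: "R powr (k + DIM('a) / 2) * x powr \<beta> = \<eta>"
    proof -
      have "- (\<beta> / D) * (k + DIM('a) / 2) + \<beta> = \<gamma>"
        using D unfolding \<gamma>_def by (simp add: field_simps) (simp add: D_def algebra_simps)
      then show ?thesis by (simp add: R_def \<eta>_def powr_powr powr_add[symmetric])
    qed
    have e2: "R powr (k - m) = \<eta>"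
      using D by (simp add: R_def \<eta>_def powr_powr \<gamma>_def algebra_simps diff_divide_distrib)
    have "L1k_norm k ?h \<le> interp_const TYPE('a) k * sqrt (A + 1) * \<eta> + \<eta> * (6 * (2 powr m * B))"
    proof -
      have "interp_const TYPE('a) k * R powr (k + DIM('a) / 2) * P = interp_const TYPE('a) k * sqrt (A + 1) * (R powr (k + DIM('a) / 2) * x powr \<beta>)"
        by (simp add: P_def)
      moreover have "\<eta> * L1k_norm m ?h \<le> \<eta> * (6 * (2 powr m * B))" using hm_le \<eta> by (intro mult_left_mono) auto
      ultimately show ?thesis using 3 unfolding e1 e2 by linarith
    qed
    moreover have "L1k_norm k (\<lambda>x. u t x - ub t x) \<le> L1k_norm k (\<lambda>x. u t x - ?w x) + (L1k_norm k ?h + L1k_norm k (\<lambda>x. ?w1 x - ub t x))"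
      using L1k_norm_triangle[OF uk(1) wk(1) uk(2)] L1k_norm_triangle[OF wk(1) wk(2) uk(2)] by linarith
    ultimately have "L1k_norm k (\<lambda>x. u t x - ub t x)
      \<le> 2 powr k * B * \<eta> + (interp_const TYPE('a) k * sqrt (A + 1) * \<eta> + \<eta> * (6 * (2 powr m * B)) + 2 powr k * B * \<eta>)"
      using 1 2 by linarith
    also have "\<dots> = (2 * (2 powr k * B) + interp_const TYPE('a) k * sqrt (A + 1) + 6 * (2 powr m * B)) * \<eta>"
      by (simp add: algebra_simps)
    finally show ?case by (simp only: B_def \<eta>_def \<gamma>_def D_def)
  qed
qed

section \<open>Choice of the exponents and conclusion\<close>

theorem theorem5p4:
  fixes J :: "real \<Rightarrow> 'a::euclidean_space \<Rightarrow> real" and J1 :: "'a \<Rightarrow> real"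
    and \<delta> k m :: real and u0 ub0 :: "'a \<Rightarrow> real"
    and u :: "real \<Rightarrow> real \<Rightarrow> real \<Rightarrow> 'a \<Rightarrow> real"
    and ub :: "real \<Rightarrow> real \<Rightarrow> 'a \<Rightarrow> real"
  assumes "H1 J \<delta>" and "H2 J J1 \<delta>"
    and "0 \<le> k" and "k < m" and "m < 1"
    and "prob_density u0" and "in_L1k k u0"
    and "prob_density ub0" and "in_L1k k ub0"
    and "\<forall>s\<in>{1/2<..<1}. \<forall>\<epsilon>>0.
           mild_solution k (rescale (J s) \<epsilon>) (\<epsilon> powr (- 2 * s)) u0 (u s \<epsilon>)"
    and "\<forall>\<epsilon>>0. mild_solution k (rescale J1 \<epsilon>) (\<epsilon> powr (- 2)) ub0 (ub \<epsilon>)"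
  shows "\<exists>C. \<forall>s\<in>{1/2<..<1}. \<forall>\<epsilon>. 0 < \<epsilon> \<and> \<epsilon> < sqrt (2 / (4 + 2 * \<delta> + real DIM('a))) \<longrightarrow>
           (\<exists>T>0. \<forall>t\<ge>T.
              L1k_norm k (\<lambda>x. u s \<epsilon> t x - ub \<epsilon> t x)
                \<le> C * (1 - s) powr ((m - k) / (m + real DIM('a) / 2))
                    * (1 + \<epsilon> powr ((m - k) / (m + real DIM('a) / 2) * \<delta>) * \<bar>ln \<epsilon>\<bar>))"
proof -
  let ?d = "real DIM('a)"
  note k = assms(3,4,5)
  have \<delta>: "0 < \<delta>" using assms(1) by (simp add: H1_def)
  obtain Ca where Ca: "0 < Ca" "\<And>s \<xi>. 1/2 < s \<Longrightarrow> s < 1 \<Longrightarrow> norm \<xi> \<le> 1 \<Longrightarrow>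
       cmod (fourier (J s) \<xi> - (1 - complex_of_real (norm \<xi> powr (2 * s)))) \<le> Ca * norm \<xi> powr (2 * s + \<delta>)"
    using assms(1) unfolding H1_def by auto
  obtain Cb where Cb: "0 < Cb" "\<And>\<xi>. norm \<xi> \<le> 1 \<Longrightarrow>
       cmod (fourier J1 \<xi> - (1 - complex_of_real ((norm \<xi>)\<^sup>2))) \<le> Cb * norm \<xi> powr (2 + \<delta>)"
    using assms(2) unfolding H2_def by auto
  obtain CC where CC: "0 < CC" "\<And>s \<xi>. 1/2 < s \<Longrightarrow> s < 1 \<Longrightarrow> \<xi> \<noteq> 0 \<Longrightarrow>
       cmod ((1 - fourier (J s) \<xi>) / complex_of_real (norm \<xi> powr (2 * s)) - (1 - fourier J1 \<xi>) / complex_of_real ((norm \<xi>)\<^sup>2))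
         \<le> CC * (1 - s) * norm \<xi> powr \<delta> * max 1 \<bar>ln (norm \<xi>)\<bar>"
    using assms(2) unfolding H2_def by auto
  \<comment> \<open>One constant for the expansions of all J^s and of J^1.\<close>
  define C0 where "C0 = max Ca Cb"
  have C0: "0 < C0" using Ca by (simp add: C0_def)
  have Js: "stable_kernel C0 \<delta> s (J s)" if s: "1/2 < s" "s < 1" for s
  proof -
    have "prob_density (J s)" using assms(1) s by (auto simp: H1_def)
    moreover have "cmod (fourier (J s) \<xi> - (1 - complex_of_real (norm \<xi> powr (2 * s)))) \<le> C0 * norm \<xi> powr (2 * s + \<delta>)" if "norm \<xi> \<le> 1" for \<xi>
      by (rule order_trans[OF Ca(2)[OF s that] mult_right_mono]) (auto simp: C0_def)
    ultimately show ?thesis using s C0 \<delta> by (simp add: stable_kernel_def)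
  qed
  have J1: "stable_kernel C0 \<delta> 1 J1"
  proof -
    have "prob_density J1" using assms(2) by (auto simp: H2_def)
    moreover have "cmod (fourier J1 \<xi> - (1 - complex_of_real (norm \<xi> powr (2 * 1)))) \<le> C0 * norm \<xi> powr (2 * 1 + \<delta>)" if "norm \<xi> \<le> 1" for \<xi>
      using order_trans[OF Cb(2)[OF that] mult_right_mono[of Cb C0 "norm \<xi> powr (2 + \<delta>)"]] by (simp add: C0_def)
    ultimately show ?thesis using C0 \<delta> by (simp add: stable_kernel_def)
  qed
  have cl: "close_kernels CC \<delta> s (J s) J1" if "1/2 < s" "s < 1" for s
    unfolding close_kernels_def using CC that by auto
  have ue: "mild_solution k (rescale (J s) \<epsilon>) (\<epsilon> powr (- 2 * s)) u0 (u s \<epsilon>)" if "1/2 < s" "s < 1" "0 < \<epsilon>" for s \<epsilon>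
    using assms(10) that by simp
  have ube: "mild_solution k (rescale J1 \<epsilon>) (\<epsilon> powr (- 2 * 1)) ub0 (ub \<epsilon>)" if "0 < \<epsilon>" for \<epsilon>
    using assms(11) that by simp
  \<comment> \<open>The midpoint of m and 1. The interpolation rate increases with the order of the
    moment, so it exceeds the required one.\<close>
  define m' where "m' = (1 + m) / 2"
  have m': "m < m'" "m' < 1" "0 < m'" "k < m'" using k by (auto simp: m'_def)
  define \<gamma> where "\<gamma> = (m - k) / (m + ?d / 2)"
  define \<gamma>' where "\<gamma>' = (m' - k) / (m' + ?d / 2)"
  have dp: "0 < ?d" by simp
  have \<gamma>: "0 < \<gamma>" using k dp by (simp add: \<gamma>_def)
  have \<gamma>': "\<gamma> < \<gamma>'"
  proof -
    have "(m - k) * (m' + ?d / 2) < (m' - k) * (m + ?d / 2)"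
    proof -
      have "(m' - k) * (m + X) - (m - k) * (m' + X) = (m' - m) * (k + X)" for X by (simp add: algebra_simps)
      from this[of "?d / 2"] have "(m' - k) * (m + ?d / 2) - (m - k) * (m' + ?d / 2) = (m' - m) * (k + ?d / 2)" .
      moreover have "0 < k + ?d / 2" using k(1) dp by linarith
      then have "0 < (m' - m) * (k + ?d / 2)" using m'(1) by simp
      ultimately show ?thesis by linarith
    qed
    then show ?thesis using k m' dp unfolding \<gamma>_def \<gamma>'_def by (simp add: divide_less_eq less_divide_eq)
  qed
  \<comment> \<open>The rate in L^2 that, interpolated with moments of order m', gives exactly
    \<gamma>. It lies strictly below 1, and this is the room mentioned at the outset.\<close>
  define \<beta> where "\<beta> = \<gamma> / \<gamma>'"
  have \<beta>: "0 < \<beta>" "\<beta> < 1" using \<gamma> \<gamma>' by (auto simp: \<beta>_def)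
  have \<beta>\<gamma>: "\<beta> * (m' - k) / (m' + ?d / 2) = \<gamma>"
    using \<gamma> \<gamma>' unfolding \<beta>_def times_divide_eq_right[symmetric] \<gamma>'_def[symmetric] by simp
  \<comment> \<open>The assumption on \<epsilon> says precisely that \<epsilon>^(-2) > L.\<close>
  define L where "L = 2 + \<delta> + ?d / 2"
  have L: "1 < L" using \<delta> dp by (simp add: L_def)
  \<comment> \<open>With this choice \<beta> (2 + \<delta> + \<kappa>) is the midpoint of \<beta> (2
    + \<delta>) and 2 + \<delta>: the room left by \<beta> < 1 is partly spent on absorbing the
    logarithms.\<close>
  define \<kappa> where "\<kappa> = (2 + \<delta>) * (1 / \<beta> - 1) / 2"
  have \<kappa>: "0 < \<kappa>" using \<beta> \<delta> by (simp add: \<kappa>_def)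
  have \<beta>N: "\<beta> * (2 + \<delta> + \<kappa>) < 2 + \<delta>"
  proof -
    have "\<beta> * (2 + \<delta> + \<kappa>) = (2 + \<delta>) * ((1 + \<beta>) / 2)" using \<beta> by (simp add: \<kappa>_def field_simps)
    also have "\<dots> < (2 + \<delta>) * 1" using \<beta> \<delta> by (intro mult_strict_left_mono) auto
    finally show ?thesis by simp
  qed
  \<comment> \<open>The decay to be achieved, halfway between the amount needed for square
    integrability, \<beta> (2 + \<delta> + \<kappa>) + d/2, and the threshold
    \<open>L\<close>.\<close>
  define p where "p = (\<beta> * (2 + \<delta> + \<kappa>) + (2 + \<delta>)) / 2 + ?d / 2"
  have p: "\<beta> * (2 + \<delta> + \<kappa>) + ?d / 2 < p" "p < L" using \<beta>N by (auto simp: p_def L_def)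
  have p2: "?d / 2 < p" "0 < p"
  proof -
    have "0 < \<beta> * (2 + \<delta> + \<kappa>)" using \<beta> \<delta> \<kappa> by (intro mult_pos_pos) auto
    then show "?d / 2 < p" using p by linarith
    then show "0 < p" using dp by linarith
  qed
  \<comment> \<open>The part of the jump rate to be used, halfway between \<open>p\<close> and
    \<open>L\<close>. The gap above \<open>p\<close> admits slabs of positive mass, the gap below
    \<open>L\<close> admits s < 1.\<close>
  define q where "q = (p + L) / 2"
  have q: "0 < q" "p < q" "q < L" using p p2 by (auto simp: q_def)
  \<comment> \<open>The slab mass for which the rate \<open>q\<close> still leaves the decay
    \<open>p\<close>.\<close>
  define \<theta> where "\<theta> = 1 - p / q"
  have \<theta>: "0 < \<theta>" "\<theta> < 1" "p = (1 - \<theta>) * q" using q p2 by (auto simp: \<theta>_def)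
  have pc: "prob_density (J s) \<and> close_kernels CC \<delta> s (J s) J1" if "1/2 < s" "s < 1" for s
    using cl[OF that] stable_kernel_facts(1)[OF Js[OF that]] by simp
  have "\<exists>h>0. \<exists>s0<1. (\<forall>\<xi>. measure (density lborel (\<lambda>x. ennreal (J1 x))) {x. \<bar>x \<bullet> \<xi>\<bar> < h * norm \<xi>} \<le> \<theta>) \<and>
      (\<forall>s. 1/2 < s \<longrightarrow> s0 \<le> s \<longrightarrow> s < 1 \<longrightarrow> (\<forall>\<xi>. measure (density lborel (\<lambda>x. ennreal (J s x))) {x. \<bar>x \<bullet> \<xi>\<bar> < h * norm \<xi>} \<le> \<theta>))"
    by (rule slab_uniform[OF _ J1 \<theta>(1)]) (rule pc)
  then obtain h s1 where h: "0 < h" and s1: "s1 < 1"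
    and slab1': "\<forall>\<xi>. measure (density lborel (\<lambda>x. ennreal (J1 x))) {x. \<bar>x \<bullet> \<xi>\<bar> < h * norm \<xi>} \<le> \<theta>"
    and slab': "\<forall>s. 1/2 < s \<longrightarrow> s1 \<le> s \<longrightarrow> s < 1 \<longrightarrow> (\<forall>\<xi>. measure (density lborel (\<lambda>x. ennreal (J s x))) {x. \<bar>x \<bullet> \<xi>\<bar> < h * norm \<xi>} \<le> \<theta>)"
    by (elim exE conjE)
  note slab1 = slab1'[rule_format] and slab = slab'[rule_format]
  \<comment> \<open>Solves C0 r0^\<delta> = 1/2, unless the solution exceeds 1.\<close>
  define r0 where "r0 = min 1 ((1 / (2 * C0)) powr (1 / \<delta>))"
  have r0: "0 < r0" "r0 \<le> 1" using C0 by (auto simp: r0_def)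
  have r0': "C0 * r0 powr \<delta> \<le> 1/2"
  proof -
    have "r0 powr \<delta> \<le> ((1 / (2 * C0)) powr (1 / \<delta>)) powr \<delta>" using r0 \<delta> by (intro powr_mono2) (auto simp: r0_def)
    also have "\<dots> = 1 / (2 * C0)" using C0 \<delta> by (simp add: powr_powr)
    finally have "C0 * r0 powr \<delta> \<le> C0 * (1 / (2 * C0))" using C0 by (intro mult_left_mono) auto
    then show ?thesis using C0 by simp
  qed
  obtain Cd where Cd: "1 \<le> Cd" and decay': "\<forall>(K::'a \<Rightarrow> real) s \<epsilon>. stable_kernel C0 \<delta> s K \<longrightarrow> 0 < \<epsilon> \<longrightarrow> \<epsilon> \<le> 1 \<longrightarrow> q \<le> \<epsilon> powr (- 2 * s) \<longrightarrow>
    (\<forall>\<xi>. measure (density lborel (\<lambda>x. ennreal (K x))) {x. \<bar>x \<bullet> \<xi>\<bar> < h * norm \<xi>} \<le> \<theta>) \<longrightarrow>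
    (\<forall>\<xi>. cmod (exp (- limexp K s \<epsilon> \<xi>)) \<le> Cd * dec p \<xi>)"
    using uniform_decay[OF r0 r0' h \<theta>(2) q(1), where 'a='a] unfolding \<theta>(3)[symmetric] by (elim exE conjE)
  note decay = decay'[rule_format]
  \<comment> \<open>From ln q / ln L on, L^s \<ge> q, hence \<epsilon>^(-2s) \<ge> q for all
    admissible \<epsilon> at once; from \<open>s1\<close> on, the slab bounds hold.\<close>
  define s2 where "s2 = max s1 (ln q / ln L)"
  have s2: "s2 < 1"
  proof -
    have "ln q < ln L" using q by simp
    then have "ln q / ln L < 1" using L by simp
    then show ?thesis using s1 by (simp add: s2_def)
  qed
  define S where "S = 2 * Cd * (3 * symb_const C0 \<delta> CC \<kappa>) powr \<beta>"
  define A where "A = S\<^sup>2 * integral\<^sup>L lborel (dec (2 * p - 2 * (\<beta> * (2 + \<delta> + \<kappa>))) :: 'a \<Rightarrow> real)"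
  have A: "0 \<le> A" unfolding A_def by (intro mult_nonneg_nonneg integral_nonneg_AE AE_I2) (auto simp: dec_pos less_imp_le)
  define B where "B = moment_const TYPE('a) m' (2 * (C0 + 2))"
  have B0: "0 \<le> B" unfolding B_def using C0 m' by (intro moment_const_nonneg) auto
  define K2 where "K2 = 2 * (2 powr k * B) + interp_const TYPE('a) k * sqrt (A + 1) + 6 * (2 powr m' * B)"
  have K2: "0 \<le> K2" unfolding K2_def interp_const_def
    using B0 A by (intro add_nonneg_nonneg mult_nonneg_nonneg) (auto simp: unit_ball_vol_nonneg)
  define K1 where "K1 = 2 * (2 powr k * B * 2)"
  have K1: "0 \<le> K1" using B0 by (simp add: K1_def)
  \<comment> \<open>\<open>K2\<close> serves s close to 1. For s below \<open>s2\<close> the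
    solutions are merely bounded, and dividing \<open>K1\<close> by the value of (1 - s)^\<gamma> at
    \<open>s2\<close> suffices.\<close>
  define K where "K = K2 + K1 / (1 - s2) powr \<gamma>"
  have Kge: "K2 \<le> K" "0 \<le> K" using K1 K2 by (auto simp: K_def)
  have main: "\<forall>\<^sub>F t in at_top. L1k_norm k (\<lambda>x. u s \<epsilon> t x - ub \<epsilon> t x) \<le> K * (1 - s) powr \<gamma>"
    if s: "1/2 < s" "s < 1" and e: "0 < \<epsilon>" "\<epsilon> < sqrt (2 / (4 + 2 * \<delta> + ?d))" for s \<epsilon>
  proof (cases "s2 \<le> s")
    case True
    have eL: "L < \<epsilon> powr (- 2)"
    proof -
      have "\<epsilon>\<^sup>2 < 2 / (4 + 2 * \<delta> + ?d)" 
      proof -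
        have "\<epsilon>\<^sup>2 < (sqrt (2 / (4 + 2 * \<delta> + ?d)))\<^sup>2" using e by (intro power_strict_mono) auto
        then show ?thesis using \<delta> by simp
      qed
      also have "2 / (4 + 2 * \<delta> + ?d) = 1 / L" using \<delta> by (simp add: L_def field_simps)
      finally have "L < 1 / \<epsilon>\<^sup>2" using L e by (simp add: field_simps)
      moreover have "\<epsilon> powr (- 2) = 1 / \<epsilon>\<^sup>2" using e by (simp add: powr_minus_divide)
      ultimately show ?thesis by simp
    qed
    have e1: "\<epsilon> \<le> 1"
    proof (rule ccontr)
      assume "\<not> \<epsilon> \<le> 1"
      then have "\<epsilon> powr (- 2) \<le> \<epsilon> powr 0" by (intro powr_mono) auto
      then show False using eL L e by simp
    qed
    \<comment> \<open>Rewrites ln q / ln L \<le> s as q \<le> L^s and then uses L <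
      \<epsilon>^(-2).\<close>
    have qs: "q \<le> \<epsilon> powr (- 2 * s)"
    proof -
      have "ln q / ln L \<le> s" using True by (simp add: s2_def)
      then have "ln q \<le> s * ln L" using L by (simp add: divide_le_eq)
      then have "exp (ln q) \<le> exp (s * ln L)" by simp
      then have "q \<le> L powr s" using q L by (simp add: powr_def)
      also have "\<dots> \<le> (\<epsilon> powr (- 2)) powr s" using L eL s by (intro powr_mono2) auto
      finally show ?thesis by (simp add: powr_powr)
    qed
    have q1: "q \<le> \<epsilon> powr (- 2 * 1)" using q eL by simp
    have ss: "s1 \<le> s" using True by (simp add: s2_def)
    note slabs = slab[OF s(1) ss s(2)]
    have d1: "cmod (exp (- limexp (J s) s \<epsilon> \<xi>)) \<le> Cd * dec p \<xi>" for \<xi>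
      by (rule decay[OF Js[OF s] e(1) e1 qs slabs])
    have d2: "cmod (exp (- limexp J1 1 \<epsilon> \<xi>)) \<le> Cd * dec p \<xi>" for \<xi>
      by (rule decay[OF J1 e(1) e1 q1 slab1])
    have E: "(\<integral>\<^sup>+\<xi>. ennreal ((cmod (exp (- limexp (J s) s \<epsilon> \<xi>) - exp (- limexp J1 1 \<epsilon> \<xi>)))\<^sup>2) \<partial>lborel) \<le> ennreal (A * (1 - s) powr (2 * \<beta>))"
    proof -
      have "((1 - s) powr \<beta>)\<^sup>2 = (1 - s) powr (2 * \<beta>)" by (simp add: power2_eq_square powr_add[symmetric])
      then have "(S * (1 - s) powr \<beta>)\<^sup>2 * integral\<^sup>L lborel (dec (2 * p - 2 * (\<beta> * (2 + \<delta> + \<kappa>))) :: 'a \<Rightarrow> real) = A * (1 - s) powr (2 * \<beta>)"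
        by (simp add: A_def power_mult_distrib)
      then show ?thesis
        using equilibrium_fourier_diff[OF cl[OF s] J1 Js[OF s] e(1) e1 \<kappa> \<beta>(1) less_imp_le[OF \<beta>(2)] Cd d1 d2 p(1)]
        unfolding S_def by simp
    qed
    have "\<forall>\<^sub>F t in at_top. L1k_norm k (\<lambda>x. u s \<epsilon> t x - ub \<epsilon> t x) \<le> K2 * (1 - s) powr \<gamma>"
      unfolding K2_def B_def \<beta>\<gamma>[symmetric]
      by (rule mild_solutions_comparison[OF Js[OF s] J1 e(1) h \<theta>(2) q(1) qs q1 slabs slab1 \<theta>(3) p2(1) d1 d2 _ _ \<beta>(1) A E k(1) m'(4,2)
            ue[OF s e(1)] ube[OF e(1)] assms(6-9)]) (use s in auto)
    then show ?thesis
    proof eventually_elim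
      case (elim t)
      also have "K2 * (1 - s) powr \<gamma> \<le> K * (1 - s) powr \<gamma>" using Kge by (intro mult_right_mono) auto
      finally show ?case .
    qed
  next
    case False
    have b: "\<forall>\<^sub>F t in at_top. L1k_norm k (u s \<epsilon> t) \<le> 2 powr k * B * 2" "\<forall>\<^sub>F t in at_top. L1k_norm k (ub \<epsilon> t) \<le> 2 powr k * B * 2"
      unfolding B_def
      by (rule mild_solution_eventually_bounded[OF Js[OF s] e(1) ue[OF s e(1)] k(1) less_imp_le[OF m'(4)] assms(6,7) m'(3,2)]
        mild_solution_eventually_bounded[OF J1 e(1) ube[OF e(1)] k(1) less_imp_le[OF m'(4)] assms(8,9) m'(3,2)])+
    have K1_le: "K1 \<le> K * (1 - s) powr \<gamma>"
    proof -
      have "(1 - s2) powr \<gamma> \<le> (1 - s) powr \<gamma>" using False s2 \<gamma> by (intro powr_mono2) auto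
      then have "K1 / (1 - s2) powr \<gamma> * (1 - s2) powr \<gamma> \<le> K * (1 - s) powr \<gamma>"
        using K1 K2 Kge by (intro mult_mono) (auto simp: K_def)
      then show ?thesis using s2 by simp
    qed
    show ?thesis
      using b eventually_ge_at_top[of 0]
    proof eventually_elim
      case (elim t)
      have "L1k_norm k (\<lambda>x. u s \<epsilon> t x - ub \<epsilon> t x) \<le> L1k_norm k (u s \<epsilon> t) + L1k_norm k (ub \<epsilon> t)"
        using elim by (intro L1k_norm_diff_le mild_solution_in_L1k[OF ue[OF s e(1)]] mild_solution_in_L1k[OF ube[OF e(1)]]) auto
      also have "\<dots> \<le> K1" using elim by (simp add: K1_def)
      finally show ?case using K1_le by simp
    qed
  qed
  show ?thesis
  proof (rule exI[of _ K], intro ballI allI impI)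
    fix s \<epsilon> :: real assume s: "s \<in> {1/2<..<1}" and e: "0 < \<epsilon> \<and> \<epsilon> < sqrt (2 / (4 + 2 * \<delta> + ?d))"
    obtain T0 where T0: "\<And>t. T0 \<le> t \<Longrightarrow> L1k_norm k (\<lambda>x. u s \<epsilon> t x - ub \<epsilon> t x) \<le> K * (1 - s) powr \<gamma>"
      using main[of s \<epsilon>] s e by (auto simp: eventually_at_top_linorder)
    show "\<exists>T>0. \<forall>t\<ge>T. L1k_norm k (\<lambda>x. u s \<epsilon> t x - ub \<epsilon> t x)
                \<le> K * (1 - s) powr ((m - k) / (m + ?d / 2)) * (1 + \<epsilon> powr ((m - k) / (m + ?d / 2) * \<delta>) * \<bar>ln \<epsilon>\<bar>)"
    \<comment> \<open>The maximum with 1 makes the waiting time positive.\<close>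
    proof (rule exI[of _ "max 1 T0"], intro conjI allI impI)
      fix t assume "max 1 T0 \<le> t"
      then have "L1k_norm k (\<lambda>x. u s \<epsilon> t x - ub \<epsilon> t x) \<le> K * (1 - s) powr \<gamma> * 1" using T0 by simp
      \<comment> \<open>The last factor is at least 1.\<close>
      also have "\<dots> \<le> K * (1 - s) powr \<gamma> * (1 + \<epsilon> powr (\<gamma> * \<delta>) * \<bar>ln \<epsilon>\<bar>)"
        using Kge by (intro mult_left_mono) auto
      finally show "L1k_norm k (\<lambda>x. u s \<epsilon> t x - ub \<epsilon> t x)
                \<le> K * (1 - s) powr ((m - k) / (m + ?d / 2)) * (1 + \<epsilon> powr ((m - k) / (m + ?d / 2) * \<delta>) * \<bar>ln \<epsilon>\<bar>)"
        by (simp only: \<gamma>_def)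
    qed simp
  qed
qed

end
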